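(* There exist constants $C_k,c_k>0$, $k\in\mathbb{N}^*=\{1,2,\dots\}$, such that the following holds. Let $V:\mathbb{R}\to[0,+\infty)$ be any continuous function with $\liminf_{|x|\to+\infty}V(x)>0$, $V^{-1}(0)=\{0\}$, and such that $V$ is strictly increasing for small positive $x$ and strictly decreasing for small negative $x$. Let $P=-h^2\Delta+V$ on $L^2(\mathbb{R})$, and for $h>0$ small enough let $\delta_-=\delta_-(h)<0<\delta_+=\delta_+(h)$ be the unique solutions of $$V(\delta_-)=V(\delta_+)=\frac{h^2}{(\delta_+-\delta_-)^2}.$$ Then, for all $k\in\mathbb{N}^*$ and all $h>0$ small enough, $$\frac{c_k h^2}{(\delta_+-\delta_-)^2}\le\lambda_k(P)\le\frac{C_k h^2}{(\delta_+-\delta_-)^2}.$$ (The constants $C_k,c_k$ depend only on $k$, not on $P$.)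
   Context: The operator $P=-h^2\Delta+V$ (with $\Delta=d^2/dx^2$) is the non-negative self-adjoint operator on $L^2(\mathbb{R})$ associated with the quadratic form $u\mapsto h^2\|u'\|^2+\|V^{1/2}u\|^2$ on $\{u\in H^1(\mathbb{R}): V^{1/2}u\in L^2(\mathbb{R})\}$; it depends on the semiclassical parameter $h>0$. For a non-negative self-adjoint operator $T$, $\lambda_k(T)$ denotes its $k$-th eigenvalue (in increasing order, counted with multiplicity), or the bottom of its essential spectrum if $T$ has fewer than $k$ eigenvalues below it (equivalently, the $k$-th max-min value of $T$). Under the stated hypotheses the pair $(\delta_-,\delta_+)$ exists and is unique for all sufficiently small $h>0$. *)

theory Defs
  imports "HOL-Analysis.Analysis" "HOL-Library.Extended_Nat"
begin

text \<open>
  Elements of the Hilbert space \<open>L\<^sup>2(\<real>)\<close> are represented by Borel functions \<open>\<real> \<rightarrow> \<complex>\<close>; two functions that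
  agree almost everywhere represent the same element, so all equalities below are taken almost
  everywhere. Every Lebesgue measurable class contains a Borel function.
\<close>

definition L2 :: "(real \<Rightarrow> complex) set" where
  "L2 = {u. u \<in> borel_measurable lborel \<and> integrable lborel (\<lambda>x. (cmod (u x))\<^sup>2)}"

definition L2_inner :: "(real \<Rightarrow> complex) \<Rightarrow> (real \<Rightarrow> complex) \<Rightarrow> complex" where
  "L2_inner u v = (LINT x|lborel. u x * cnj (v x))"

definition L2_norm :: "(real \<Rightarrow> complex) \<Rightarrow> real" where
  "L2_norm u = sqrt (LINT x|lborel. (cmod (u x))\<^sup>2)"

definition test_function :: "(real \<Rightarrow> real) \<Rightarrow> bool" where
  "test_function \<phi> \<longleftrightarrow>
     (\<forall>n x. ((deriv ^^ n) \<phi>) field_differentiable (at x)) \<and> compact (closure {x. \<phi> x \<noteq> 0})"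

text \<open>Real test functions suffice for the weak derivative of a complex function, by linearity.\<close>

definition has_weak_deriv :: "(real \<Rightarrow> complex) \<Rightarrow> (real \<Rightarrow> complex) \<Rightarrow> bool" where
  "has_weak_deriv u w \<longleftrightarrow>
     (\<forall>\<phi>. test_function \<phi> \<longrightarrow>
        (LINT x|lborel. u x * of_real (deriv \<phi> x)) = - (LINT x|lborel. w x * of_real (\<phi> x)))"

definition H1 :: "(real \<Rightarrow> complex) set" where
  "H1 = {u \<in> L2. \<exists>w\<in>L2. has_weak_deriv u w}"

text \<open>The weak derivative of an \<open>H1\<close> function, which is unique up to a null set.\<close>

definition weak_deriv :: "(real \<Rightarrow> complex) \<Rightarrow> (real \<Rightarrow> complex)" where
  "weak_deriv u = (SOME w. w \<in> L2 \<and> has_weak_deriv u w)"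

definition sqrt_mult :: "(real \<Rightarrow> real) \<Rightarrow> (real \<Rightarrow> complex) \<Rightarrow> (real \<Rightarrow> complex)" where
  "sqrt_mult V u = (\<lambda>x. of_real (sqrt (V x)) * u x)"

definition schroedinger_form_domain :: "(real \<Rightarrow> real) \<Rightarrow> (real \<Rightarrow> complex) set" where
  "schroedinger_form_domain V = {u \<in> H1. sqrt_mult V u \<in> L2}"

text \<open>The polarised quadratic form \<open>u \<mapsto> h\<^sup>2 \<parallel>u'\<parallel>\<^sup>2 + \<parallel>V\<^sup>1\<^sup>/\<^sup>2 u\<parallel>\<^sup>2\<close>.\<close>

definition schroedinger_form ::
  "real \<Rightarrow> (real \<Rightarrow> real) \<Rightarrow> (real \<Rightarrow> complex) \<Rightarrow> (real \<Rightarrow> complex) \<Rightarrow> complex" where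
  "schroedinger_form h V u v =
     of_real (h\<^sup>2) * L2_inner (weak_deriv u) (weak_deriv v)
     + L2_inner (sqrt_mult V u) (sqrt_mult V v)"

text \<open>
  An unbounded operator is given by its graph. The operator associated with the form maps \<open>u\<close> to \<open>f\<close>
  iff \<open>u\<close> is in the form domain and \<open>form u v = \<langle>f, v\<rangle>\<close> for all \<open>v\<close> in the form domain (first
  representation theorem).
\<close>

type_synonym L2_operator = "((real \<Rightarrow> complex) \<times> (real \<Rightarrow> complex)) set"

definition schroedinger :: "real \<Rightarrow> (real \<Rightarrow> real) \<Rightarrow> L2_operator" where
  "schroedinger h V =
     {(u, f). u \<in> schroedinger_form_domain V \<and> f \<in> L2 \<and>
        (\<forall>v\<in>schroedinger_form_domain V. schroedinger_form h V u v = L2_inner f v)}"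

text \<open>\<open>z\<close> is in the resolvent set iff \<open>T - z\<close> has a bounded inverse defined on all of \<open>L2\<close>.\<close>

definition resolvent_set :: "L2_operator \<Rightarrow> complex set" where
  "resolvent_set T =
     {z. (\<exists>C. \<forall>(u, f)\<in>T. L2_norm u \<le> C * L2_norm (\<lambda>x. f x - z * u x)) \<and>
         (\<forall>g\<in>L2. \<exists>(u, f)\<in>T. AE x in lborel. f x - z * u x = g x)}"

definition spectrum_of :: "L2_operator \<Rightarrow> complex set" where
  "spectrum_of T = - resolvent_set T"

definition L2_independent :: "nat \<Rightarrow> (nat \<Rightarrow> real \<Rightarrow> complex) \<Rightarrow> bool" where
  "L2_independent n u \<longleftrightarrow>
     (\<forall>c :: nat \<Rightarrow> complex. (AE x in lborel. (\<Sum>i<n. c i * u i x) = 0) \<longrightarrow> (\<forall>i<n. c i = 0))"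

text \<open>The dimension of the eigenspace; it is \<open>0\<close> iff \<open>z\<close> is not an eigenvalue.\<close>

definition multiplicity_of :: "L2_operator \<Rightarrow> complex \<Rightarrow> enat" where
  "multiplicity_of T z =
     (SUP n\<in>{n. \<exists>u. (\<forall>i<n. (u i, \<lambda>x. z * u i x) \<in> T) \<and> L2_independent n u}. enat n)"

text \<open>The essential spectrum is the complement, within the spectrum, of the isolated eigenvalues of
  finite multiplicity.\<close>

definition discrete_spectrum :: "L2_operator \<Rightarrow> complex set" where
  "discrete_spectrum T =
     {z \<in> spectrum_of T. \<not> z islimpt spectrum_of T \<and> 0 < multiplicity_of T z \<and> multiplicity_of T z < \<infinity>}"

definition essential_spectrum :: "L2_operator \<Rightarrow> complex set" where
  "essential_spectrum T = spectrum_of T - discrete_spectrum T"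

text \<open>The bottom of the essential spectrum of a self-adjoint operator; \<open>\<infinity>\<close> if it is empty.\<close>

definition ess_bottom :: "L2_operator \<Rightarrow> ereal" where
  "ess_bottom T = (INF z\<in>essential_spectrum T. ereal (Re z))"

definition eigenvalue_count :: "L2_operator \<Rightarrow> real set \<Rightarrow> enat" where
  "eigenvalue_count T S =
     (SUP F\<in>{F. finite F \<and> F \<subseteq> S}. \<Sum>\<mu>\<in>F. multiplicity_of T (of_real \<mu>))"

text \<open>
  The \<open>k\<close>-th eigenvalue (\<open>k \<ge> 1\<close>) below the essential spectrum, in increasing order with multiplicity,
  is the least \<open>\<mu>\<close> such that at least \<open>k\<close> eigenvalues are \<open>\<le> \<mu>\<close>. The value is \<open>\<infinity>\<close> only if
  the essential spectrum is empty and there are fewer than \<open>k\<close> eigenvalues.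
\<close>

definition lambda :: "nat \<Rightarrow> L2_operator \<Rightarrow> ereal" where
  "lambda k T =
     (if enat k \<le> eigenvalue_count T {\<mu>. ereal \<mu> < ess_bottom T}
      then (INF \<mu>\<in>{\<mu>. ereal \<mu> < ess_bottom T \<and> enat k \<le> eigenvalue_count T {..\<mu>}}. ereal \<mu>)
      else ess_bottom T)"

definition delta_pair :: "(real \<Rightarrow> real) \<Rightarrow> real \<Rightarrow> real \<Rightarrow> real \<Rightarrow> bool" where
  "delta_pair V h dm dp \<longleftrightarrow>
     dm < 0 \<and> 0 < dp \<and> V dm = h\<^sup>2 / (dp - dm)\<^sup>2 \<and> V dp = h\<^sup>2 / (dp - dm)\<^sup>2"

end

theory Submission
  imports Defs
begin

text \<open>
  Put \<open>\<delta> = \<delta>\<^sub>+ - \<delta>\<^sub>-\<close> and \<open>E = h\<^sup>2 / \<delta>\<^sup>2\<close>. For small \<open>h\<close> the window \<open>(\<delta>\<^sub>-, \<delta>\<^sub>+)\<close> lies in the region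
  where \<open>V\<close> is monotone on either side of \<open>0\<close>, so that \<open>V \<le> E\<close> inside the window and \<open>V \<ge> E\<close> outside. The
  defining equation says that \<open>E\<close> is also the kinetic energy of a function that lives on the length
  scale \<open>\<delta>\<close>. Both bounds compare the quadratic form with \<open>E\<close>.

  Upper bound: split the window into \<open>k\<close> equal intervals and take a parabolic hat on each. Their
  supports are disjoint, a normalised hat of width \<open>\<delta> / k\<close> has kinetic energy \<open>10 k\<^sup>2 E\<close> and potential
  energy at most \<open>E\<close>, so for unit vectors the form is at most \<open>(10 k\<^sup>2 + 1) E\<close> on their span (\<open>lambda_le_window\<close>).

  Lower bound: if \<open>x\<close> is in the window then \<open>x + \<delta>\<close> is not, and \<open>u (x + \<delta>) - u x\<close> is an integral of
  \<open>u'\<close> over an interval of length \<open>\<delta>\<close>. So the mass of \<open>u\<close> in the window is bounded by its mass outside,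
  where \<open>V \<ge> E\<close>, and by \<open>\<delta>\<^sup>2 \<parallel>u'\<parallel>\<^sup>2\<close>. This makes the form at least \<open>E / 3\<close> (\<open>form_lower_bound\<close>), and a
  bound for the bottom of the spectrum is a bound for every \<open>\<lambda>\<^sub>k\<close>. Thus \<open>C\<^sub>k = 10 k\<^sup>2 + 1\<close>, \<open>c\<^sub>k = 1 / 3\<close>.

  It remains to pass from the form to \<open>\<lambda>\<^sub>k\<close>, which is defined through the resolvent set, the essential
  spectrum and multiplicities. The Lax--Milgram theorem on the form domain puts the half plane
  \<open>Re z < E / 3\<close> into the resolvent set, which gives the lower bound (\<open>lambda_lower_bound\<close>). For the
  upper bound let \<open>\<Lambda>\<close> be below the essential spectrum. Every real \<open>\<mu> \<le> \<Lambda>\<close> is then in the resolvent set or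
  an isolated point of the spectrum. As long as fewer than \<open>k\<close> orthonormal eigenvectors with eigenvalue
  at most \<open>\<Lambda>\<close> have been found, some trial vector is orthogonal to all of them, and \<open>top_eigenvector\<close>,
  applied to \<open>(T + 1)\<^sup>-\<^sup>1\<close> for the Schroedinger operator \<open>T\<close>, on their orthogonal complement, produces another
  one. The argument in \<open>top_eigenvector\<close> avoids the spectral theorem: it rests on the fact that a
  non-negative symmetric operator with a bounded inverse is bounded below by a positive constant.
\<close>

section \<open>Riesz representation and the Lax--Milgram theorem on a closed subspace\<close>

text \<open>
  The representing vector minimises \<open>J x = \<parallel>x\<parallel>\<^sup>2 / 2 - f x\<close> over \<open>S\<close>: the parallelogram identity makes
  every minimising sequence a Cauchy sequence, and \<open>inner p x - f x\<close> is the derivative of \<open>J\<close> at \<open>p\<close> in the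
  direction \<open>x\<close>.
\<close>
lemma riesz_on_subspace:
  fixes S :: "'a::{real_inner, complete_space} set" and f :: "'a \<Rightarrow> real"
  assumes S: "subspace S" "closed S" and f: "bounded_linear f"
  obtains p where "p \<in> S" "\<And>x. x \<in> S \<Longrightarrow> inner p x = f x"
proof -
  interpret f: bounded_linear f by fact
  define J where "J x = (norm x)\<^sup>2 / 2 - f x" for x
  obtain K where K: "\<And>x. norm (f x) \<le> norm x * K" and K0: "K > 0"
    using f.pos_bounded by blast
  have J_lower: "- K\<^sup>2 / 2 \<le> J x" for x
  proof -
    have "f x \<le> norm x * K" using K[of x] by simp
    moreover have "0 \<le> (norm x - K)\<^sup>2" by simp
    ultimately show ?thesis unfolding J_def by (simp add: power2_eq_square algebra_simps)
  qed
  have bdd: "bdd_below (J ` S)" using J_lower by (intro bdd_belowI2[of _ "- K\<^sup>2 / 2"])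
  have S0: "0 \<in> S" using S(1) subspace_0 by blast
  define d where "d = Inf (J ` S)"
  have d_le: "d \<le> J x" if "x \<in> S" for x
    unfolding d_def using bdd that by (simp add: cInf_lower)
  have "\<exists>x\<in>S. J x < d + 1 / real (Suc n)" for n
  proof -
    have "Inf (J ` S) < d + 1 / real (Suc n)" by (simp add: d_def)
    then show ?thesis using cInf_lessD[of "J ` S"] S0 by blast
  qed
  then obtain X where X: "\<And>n. X n \<in> S" "\<And>n. J (X n) < d + 1 / real (Suc n)" by metis
  have para: "(norm (x - y))\<^sup>2 \<le> 4 * (J x + J y - 2 * d)" if "x \<in> S" "y \<in> S" for x y
  proof -
    have "(1/2) *\<^sub>R (x + y) \<in> S" using that S(1) by (simp add: subspace_add subspace_scale)
    then have "d \<le> J ((1/2) *\<^sub>R (x + y))" by (rule d_le)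
    moreover have "(norm (x - y))\<^sup>2 = 4 * (J x + J y - 2 * J ((1/2) *\<^sub>R (x + y)))"
      unfolding J_def
      by (simp add: f.add f.scale power2_norm_eq_inner inner_add inner_diff inner_commute algebra_simps)
    ultimately show ?thesis by simp
  qed
  have "Cauchy X"
  proof (rule metric_CauchyI)
    fix e :: real assume e: "e > 0"
    obtain N where N: "8 / e\<^sup>2 < real N" using reals_Archimedean2 by blast
    have *: "dist (X m) (X n) < e" if "m \<ge> N" "n \<ge> N" for m n
    proof -
      have N0: "real N > 0" using N e by (smt (verit) divide_nonneg_nonneg zero_le_power2)
      have b: "1 / real (Suc i) < e\<^sup>2 / 8" if "i \<ge> N" for i
      proof -
        have "1 / real (Suc i) < 1 / real N" using that N0 by (intro divide_strict_left_mono) auto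
        also have "\<dots> < e\<^sup>2 / 8" using N N0 e by (simp add: field_simps)
        finally show ?thesis .
      qed
      have "(norm (X m - X n))\<^sup>2 \<le> 4 * (J (X m) + J (X n) - 2 * d)" by (rule para) (rule X)+
      also have "\<dots> < e\<^sup>2" using X(2)[of m] X(2)[of n] b[OF that(1)] b[OF that(2)] by argo
      finally show ?thesis using e by (simp add: dist_norm power2_less_imp_less)
    qed
    then show "\<exists>M. \<forall>m\<ge>M. \<forall>n\<ge>M. dist (X m) (X n) < e" by blast
  qed
  then obtain p where p: "X \<longlonglongrightarrow> p" using Cauchy_convergent_iff convergent_def by blast
  have pS: "p \<in> S" using closed_sequentially[OF S(2)] X(1) p by blast
  have "(\<lambda>n. J (X n)) \<longlonglongrightarrow> J p" unfolding J_def by (intro tendsto_intros p f.tendsto) simp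
  moreover have "(\<lambda>n. d + 1 / real (Suc n)) \<longlonglongrightarrow> d + 0"
    by (intro tendsto_add tendsto_const) (use LIMSEQ_inverse_real_of_nat in \<open>simp add: inverse_eq_divide\<close>)
  ultimately have "J p \<le> d + 0"
    by (rule LIMSEQ_le) (use X(2) less_imp_le in blast)
  then have Jp: "J p \<le> d" by simp
  have "inner p x = f x" if x: "x \<in> S" for x
  proof -
    have *: "0 \<le> t * (inner p x - f x) + t\<^sup>2 * (norm x)\<^sup>2 / 2" for t
    proof -
      have "p + t *\<^sub>R x \<in> S" using pS x S(1) by (simp add: subspace_add subspace_scale)
      then have "J p \<le> J (p + t *\<^sub>R x)" using Jp d_le by fastforce
      then show ?thesis unfolding J_def power2_norm_eq_inner
        by (simp add: f.add f.scale inner_add inner_commute[of x p] field_simps power2_eq_square)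
    qed
    \<comment> \<open>The inequality at (nearly) the best \<open>t\<close>; the summand \<open>1\<close> keeps \<open>b\<close> positive if \<open>x = 0\<close>.\<close>
    define a where "a = inner p x - f x"
    define b where "b = (norm x)\<^sup>2 / 2 + 1"
    have b: "b > 0" by (simp add: b_def add_nonneg_pos)
    have "0 \<le> (- a / b) * a + (- a / b)\<^sup>2 * (norm x)\<^sup>2 / 2" using *[of "- a / b"] by (simp add: a_def)
    also have "\<dots> = (- a / b) * a + (- a / b)\<^sup>2 * (b - 1)" by (simp add: b_def)
    also have "\<dots> = - (a / b)\<^sup>2" using b by (simp add: field_simps power2_eq_square)
    finally have "a = 0" using b by simp
    then show ?thesis by (simp add: a_def)
  qed
  with pS that show ?thesis by blast
qed

text \<open>
  Write \<open>B x v = inner (A x) v\<close> and \<open>f v = inner b v\<close> on \<open>S\<close>. A solution of \<open>A u = b\<close> is a fixed point of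
  \<open>x \<mapsto> x - \<rho> (A x - b)\<close>, whose Lipschitz constant is at most the square root of
  \<open>1 - 2 \<rho> \<alpha> + \<rho>\<^sup>2 K\<^sup>2\<close>; this is smallest at \<open>\<rho> = \<alpha> / K\<^sup>2\<close>. The form \<open>B\<close> need not be symmetric, which
  allows non-real spectral parameters.
\<close>
lemma lax_milgram_on_subspace:
  fixes S :: "'a::{real_inner, complete_space} set" and f :: "'a \<Rightarrow> real"
  assumes S: "subspace S" "closed S" and f: "bounded_linear f" and B: "bounded_bilinear B"
    and coercive: "0 < \<alpha>" "\<And>x. x \<in> S \<Longrightarrow> \<alpha> * (norm x)\<^sup>2 \<le> B x x"
  obtains u where "u \<in> S" "\<And>v. v \<in> S \<Longrightarrow> B u v = f v"
proof -
  interpret B: bounded_bilinear B by fact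
  obtain K0 where K0: "\<And>x y. norm (B x y) \<le> norm x * norm y * K0" "0 < K0"
    using B.pos_bounded by blast
  \<comment> \<open>\<open>K \<ge> \<alpha>\<close> makes \<open>1 - \<alpha>\<^sup>2 / K\<^sup>2\<close> non-negative even if \<open>S\<close> is trivial.\<close>
  define K where "K = max K0 \<alpha>"
  have K: "0 < K" "\<alpha> \<le> K" and BK: "\<bar>B x y\<bar> \<le> K * norm x * norm y" for x y
  proof -
    have "norm x * norm y * K0 \<le> norm x * norm y * K" by (intro mult_left_mono) (auto simp: K_def)
    then show "\<bar>B x y\<bar> \<le> K * norm x * norm y" using K0(1)[of x y] by (simp add: mult_ac)
  qed (use K0(2) coercive(1) in \<open>auto simp: K_def\<close>)
  have "\<exists>p. p \<in> S \<and> (\<forall>v\<in>S. inner p v = B x v)" for x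
    using riesz_on_subspace[OF S B.bounded_linear_right[of x]] by metis
  then obtain A where A: "\<And>x. A x \<in> S" "\<And>x v. v \<in> S \<Longrightarrow> inner (A x) v = B x v" by metis
  obtain b where b: "b \<in> S" "\<And>v. v \<in> S \<Longrightarrow> inner b v = f v"
    using riesz_on_subspace[OF S f] by metis
  define \<rho> where "\<rho> = \<alpha> / K\<^sup>2"
  define T where "T x = x - \<rho> *\<^sub>R (A x - b)" for x
  define c where "c = sqrt (1 - \<alpha>\<^sup>2 / K\<^sup>2)"
  have aK: "0 < \<alpha>\<^sup>2 / K\<^sup>2" "\<alpha>\<^sup>2 / K\<^sup>2 \<le> 1" using K coercive(1) by (auto simp: power_mono)
  have c: "0 \<le> c" "c < 1" "c\<^sup>2 = 1 - \<alpha>\<^sup>2 / K\<^sup>2" using aK by (auto simp: c_def)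
  have contr: "dist (T x) (T y) \<le> c * dist x y" if xy: "x \<in> S" "y \<in> S" for x y
  proof -
    define d where "d = x - y"
    define e where "e = A x - A y"
    have dS: "d \<in> S" and eS: "e \<in> S" using xy A(1) S(1) by (simp_all add: d_def e_def subspace_diff)
    have ev: "inner e v = B d v" if "v \<in> S" for v
      using that A(2) by (simp add: e_def d_def inner_diff_left B.diff_left)
    have "(norm e)\<^sup>2 = B d e" using ev[OF eS] by (simp add: power2_norm_eq_inner)
    also have "\<dots> \<le> K * norm d * norm e" using BK[of d e] by linarith
    finally have "norm e \<le> K * norm d"
      by (metis K(1) linorder_not_le mult_nonneg_nonneg mult_right_le_imp_le norm_ge_zero not_less_iff_gr_or_eq power2_eq_square)
    then have e2: "(norm e)\<^sup>2 \<le> K\<^sup>2 * (norm d)\<^sup>2" by (metis norm_ge_zero power_mono power_mult_distrib)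
    have ed: "\<alpha> * (norm d)\<^sup>2 \<le> inner e d" using ev[OF dS] coercive(2)[OF dS] by simp
    have "T x - T y = d - \<rho> *\<^sub>R e" by (simp add: T_def d_def e_def algebra_simps)
    then have "(norm (T x - T y))\<^sup>2 = inner (d - \<rho> *\<^sub>R e) (d - \<rho> *\<^sub>R e)"
      by (simp add: power2_norm_eq_inner)
    then have "(norm (T x - T y))\<^sup>2 = (norm d)\<^sup>2 - 2 * \<rho> * inner e d + \<rho>\<^sup>2 * (norm e)\<^sup>2"
      unfolding power2_norm_eq_inner[of d] power2_norm_eq_inner[of e]
      by (simp add: inner_diff inner_commute[of d e] algebra_simps power2_eq_square)
    also have "\<dots> \<le> (norm d)\<^sup>2 - 2 * \<rho> * (\<alpha> * (norm d)\<^sup>2) + \<rho>\<^sup>2 * (K\<^sup>2 * (norm d)\<^sup>2)"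
      using ed e2 coercive(1) by (intro add_mono diff_mono mult_left_mono) (auto simp: \<rho>_def)
    also have "\<dots> = (1 - \<alpha>\<^sup>2 / K\<^sup>2) * (norm d)\<^sup>2"
      using K(1) by (simp add: \<rho>_def field_simps power2_eq_square)
    also have "\<dots> = (c * norm d)\<^sup>2" using c by (simp add: power_mult_distrib)
    finally have "norm (T x - T y) \<le> c * norm d" by (rule power2_le_imp_le) (use c(1) in simp)
    then show ?thesis by (simp add: dist_norm d_def)
  qed
  have "complete S" using S(2) by (simp add: complete_eq_closed)
  moreover have "S \<noteq> {}" using b by blast
  moreover have "T ` S \<subseteq> S" using A(1) b(1) S(1) by (auto simp: T_def subspace_diff subspace_scale)
  ultimately have "\<exists>!x\<in>S. T x = x" by (rule Banach_fix[OF _ _ c(1,2) _ contr])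
  then obtain u where u: "u \<in> S" "T u = u" by blast
  have "\<rho> \<noteq> 0" using K coercive(1) by (simp add: \<rho>_def)
  then have "A u = b" using u(2) by (simp add: T_def)
  then have "B u v = f v" if "v \<in> S" for v using A(2) b(2) that by metis
  with u that show ?thesis by blast
qed

section \<open>An eigenvector at the top of the numerical range\<close>

text \<open>
  A right inverse with a norm bound. If \<open>A\<close> is symmetric and maps the subspace \<open>M\<close> into itself, then
  surjectivity already implies injectivity on \<open>M\<close>.
\<close>
definition invertible_on :: "'a::real_normed_vector set \<Rightarrow> ('a \<Rightarrow> 'a) \<Rightarrow> bool" where
  "invertible_on M A \<longleftrightarrow> (\<exists>K. \<forall>u\<in>M. \<exists>v\<in>M. A v = u \<and> norm v \<le> K * norm u)"

lemma invertible_on_compose: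
  assumes "invertible_on M A" "invertible_on M B"
  shows "invertible_on M (\<lambda>x. A (B x))"
proof -
  obtain K where K: "\<And>u. u \<in> M \<Longrightarrow> \<exists>v\<in>M. A v = u \<and> norm v \<le> K * norm u"
    using assms(1) unfolding invertible_on_def by blast
  obtain L where L: "\<And>u. u \<in> M \<Longrightarrow> \<exists>v\<in>M. B v = u \<and> norm v \<le> L * norm u"
    using assms(2) unfolding invertible_on_def by blast
  have "\<exists>v\<in>M. A (B v) = u \<and> norm v \<le> (\<bar>L\<bar> * \<bar>K\<bar>) * norm u" if u: "u \<in> M" for u
  proof -
    obtain w where w: "w \<in> M" "A w = u" "norm w \<le> K * norm u" using K[OF u] by blast
    obtain v where v: "v \<in> M" "B v = w" "norm v \<le> L * norm w" using L[OF w(1)] by blast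
    have "norm v \<le> \<bar>L\<bar> * norm w" using v(3) by (smt (verit) mult_right_mono norm_ge_zero)
    also have "\<dots> \<le> \<bar>L\<bar> * (\<bar>K\<bar> * norm u)"
      using w(3) by (intro mult_left_mono) (smt (verit) mult_right_mono norm_ge_zero, simp)
    finally show ?thesis using v w by (auto simp: mult_ac)
  qed
  then show ?thesis unfolding invertible_on_def by blast
qed

lemma Cauchy_Schwarz_psd:
  fixes D :: "'a::real_inner \<Rightarrow> 'a"
  assumes M: "subspace M" and D: "linear D" "\<And>x y. inner (D x) y = inner x (D y)"
    and psd: "\<And>x. x \<in> M \<Longrightarrow> 0 \<le> inner (D x) x" and xy: "x \<in> M" "y \<in> M"
  shows "(inner (D x) y)\<^sup>2 \<le> inner (D x) x * inner (D y) y"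
proof -
  interpret D: linear D by fact
  define a b c where "a = inner (D x) x" and "b = inner (D x) y" and "c = inner (D y) y"
  have "0 \<le> a * t\<^sup>2 + (2 * b) * t + c" for t
  proof -
    have "t *\<^sub>R x + y \<in> M" using M xy by (simp add: subspace_add subspace_scale)
    then have "0 \<le> inner (D (t *\<^sub>R x + y)) (t *\<^sub>R x + y)" by (rule psd)
    also have "\<dots> = a * t\<^sup>2 + (2 * b) * t + c"
      using D(2)[of x y] D(2)[of y x]
      by (simp add: D.add D.scale inner_add a_def b_def c_def power2_eq_square algebra_simps inner_commute)
    finally show ?thesis .
  qed
  moreover have "0 \<le> a" "0 \<le> c" using psd xy by (auto simp: a_def c_def)
  ultimately have "b\<^sup>2 \<le> a * c"
  proof (cases "a = 0")
    case True
    have "b = 0"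
    proof (rule ccontr)
      assume b: "b \<noteq> 0"
      have "0 \<le> (2 * b) * (- (c + 1) / (2 * b)) + c"
        using \<open>\<And>t. 0 \<le> a * t\<^sup>2 + (2 * b) * t + c\<close>[of "- (c + 1) / (2 * b)"] True by simp
      then show False using b by simp
    qed
    then show ?thesis using True by simp
  next
    case False
    then have a: "a > 0" using \<open>0 \<le> a\<close> by simp
    have "0 \<le> a * (- b / a)\<^sup>2 + (2 * b) * (- b / a) + c"
      using \<open>\<And>t. 0 \<le> a * t\<^sup>2 + (2 * b) * t + c\<close> by blast
    then show ?thesis using a by (simp add: field_simps power2_eq_square)
  qed
  then show ?thesis by (simp add: a_def b_def c_def)
qed

text \<open>
  If \<open>D v = u\<close> and \<open>\<parallel>v\<parallel> \<le> K \<parallel>u\<parallel>\<close>, then the Cauchy--Schwarz inequality for the form of \<open>D\<close> gives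
  \<open>\<parallel>u\<parallel>\<^sup>4 = \<langle>D v, u\<rangle>\<^sup>2 \<le> \<langle>D v, v\<rangle> \<langle>D u, u\<rangle> \<le> K \<parallel>u\<parallel>\<^sup>2 \<langle>D u, u\<rangle>\<close>. In other words, the bottom of the
  numerical range of a symmetric operator belongs to its spectrum.
\<close>
lemma psd_invertible_imp_bounded_below:
  fixes D :: "'a::real_inner \<Rightarrow> 'a"
  assumes M: "subspace M" and D: "linear D" "\<And>x y. inner (D x) y = inner x (D y)"
    and psd: "\<And>x. x \<in> M \<Longrightarrow> 0 \<le> inner (D x) x" and inv: "invertible_on M D"
  obtains \<delta> where "\<delta> > 0" "\<And>u. u \<in> M \<Longrightarrow> \<delta> * (norm u)\<^sup>2 \<le> inner (D u) u"
proof -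
  obtain K0 where K0: "\<And>u. u \<in> M \<Longrightarrow> \<exists>v\<in>M. D v = u \<and> norm v \<le> K0 * norm u"
    using inv unfolding invertible_on_def by blast
  define K where "K = \<bar>K0\<bar> + 1"
  have K: "K > 0" by (simp add: K_def add_nonneg_pos)
  have "(1 / K) * (norm u)\<^sup>2 \<le> inner (D u) u" if u: "u \<in> M" for u
  proof (cases "u = 0")
    case False
    obtain v where v: "v \<in> M" "D v = u" "norm v \<le> K0 * norm u" using K0[OF u] by blast
    have vK: "norm v \<le> K * norm u" using v(3) by (smt (verit) K_def mult_right_mono norm_ge_zero)
    have "((norm u)\<^sup>2)\<^sup>2 = (inner (D v) u)\<^sup>2" by (simp add: v(2) power2_norm_eq_inner)
    also have "\<dots> \<le> inner (D v) v * inner (D u) u" by (rule Cauchy_Schwarz_psd[OF M D psd v(1) u])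
    also have "\<dots> \<le> (norm u * (K * norm u)) * inner (D u) u"
    proof (rule mult_right_mono[OF _ psd[OF u]])
      have "inner (D v) v \<le> norm u * norm v" unfolding v(2) by (rule norm_cauchy_schwarz)
      also have "\<dots> \<le> norm u * (K * norm u)" by (intro mult_left_mono vK) simp
      finally show "inner (D v) v \<le> norm u * (K * norm u)" .
    qed
    also have "\<dots> = (norm u)\<^sup>2 * (K * inner (D u) u)" by (simp add: power2_eq_square mult_ac)
    finally have "(norm u)\<^sup>2 * (norm u)\<^sup>2 \<le> (norm u)\<^sup>2 * (K * inner (D u) u)" by (simp add: power2_eq_square)
    then have "(norm u)\<^sup>2 \<le> K * inner (D u) u" using False
      by (meson mult_le_cancel_left_pos zero_less_norm_iff zero_less_power)
    then show ?thesis using K by (simp add: field_simps)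
  qed (use D(1) in \<open>simp add: linear_0\<close>)
  with K that[of "1 / K"] show ?thesis by simp
qed

lemma subspace_closure:
  fixes S :: "'a::real_normed_vector set"
  assumes S: "subspace S"
  shows "subspace (closure S)"
  unfolding subspace_def
proof (intro conjI ballI allI)
  show "0 \<in> closure S" using S subspace_0 closure_subset by blast
next
  fix x y assume "x \<in> closure S" "y \<in> closure S"
  then obtain X Y where "\<And>n. X n \<in> S" "X \<longlonglongrightarrow> x" "\<And>n. Y n \<in> S" "Y \<longlonglongrightarrow> y"
    unfolding closure_sequential by blast
  then show "x + y \<in> closure S" unfolding closure_sequential
    by (intro exI[of _ "\<lambda>n. X n + Y n"]) (auto intro: tendsto_add subspace_add[OF S])
next
  fix x c assume "x \<in> closure S"
  then obtain X where "\<And>n. X n \<in> S" "X \<longlonglongrightarrow> x" unfolding closure_sequential by blast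
  then show "c *\<^sub>R x \<in> closure S" unfolding closure_sequential
    by (intro exI[of _ "\<lambda>n. c *\<^sub>R X n"]) (auto intro: tendsto_intros subspace_scale[OF S])
qed
text \<open>
  \<open>P\<close> is the orthogonal projection onto a subspace \<open>M\<close> that is invariant under \<open>G\<close>. Let \<open>t\<close> be the supremum
  of \<open>\<langle>G u, u\<rangle>\<close> over the unit vectors of \<open>M\<close> and \<open>B = t - G\<close>. Then \<open>B \<ge> 0\<close> on \<open>M\<close>, with infimum \<open>0\<close>, so
  \<open>G - t\<close> is not invertible and \<open>t\<close> must be isolated: \<open>G - s\<close> is invertible for \<open>0 < \<bar>s - t\<bar> < \<epsilon>\<close>. The gap
  \<open>(0, \<epsilon>)\<close> in the spectrum of \<open>B\<close> gives \<open>B\<^sup>2 \<ge> \<epsilon> B\<close> on \<open>M\<close>, and therefore \<open>\<langle>B f, f\<rangle> \<ge> \<epsilon> \<parallel>f\<parallel>\<^sup>2\<close> on the closure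
  of the range of \<open>B\<close>. As the infimum is \<open>0\<close>, this closure is not all of \<open>M\<close>, and a vector of \<open>M\<close> orthogonal
  to it is in the kernel of \<open>B\<close>.
\<close>
lemma top_eigenvector:
  fixes G P :: "'a::{real_inner, complete_space} \<Rightarrow> 'a"
  assumes G: "bounded_linear G" "\<And>x y. inner (G x) y = inner x (G y)"
    and P: "bounded_linear P" "\<And>x. P (P x) = P x" "\<And>x. norm (P x) \<le> norm x" "\<And>x. P (G x) = G (P x)"
    and spec: "\<And>t. t \<ge> \<gamma> \<Longrightarrow> invertible_on UNIV (\<lambda>x. G x - t *\<^sub>R x) \<or>
       (\<exists>\<epsilon>>0. \<forall>s. 0 < \<bar>s - t\<bar> \<and> \<bar>s - t\<bar> < \<epsilon> \<longrightarrow> invertible_on UNIV (\<lambda>x. G x - s *\<^sub>R x))"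
    and u0: "P u0 = u0" "u0 \<noteq> 0" "\<gamma> * (norm u0)\<^sup>2 \<le> inner (G u0) u0"
  obtains t e where "t \<ge> \<gamma>" "P e = e" "e \<noteq> 0" "G e = t *\<^sub>R e"
proof -
  interpret G: bounded_linear G by fact
  interpret P: bounded_linear P by fact
  define M where "M = {x. P x = x}"
  have M: "subspace M" unfolding subspace_def M_def by (auto simp: P.add P.scale P.zero)
  have Mcl: "closed M" unfolding M_def
    by (intro closed_Collect_eq P.continuous_on continuous_intros)
  have GM: "G x \<in> M" if "x \<in> M" for x using that P(4) by (simp add: M_def)
  have PM: "P x \<in> M" for x by (simp add: M_def P(2))
  obtain L where L: "\<And>x. norm (G x) \<le> norm x * L" "L > 0" using G.pos_bounded by blast
  define R where "R = {inner (G u) u |u. u \<in> M \<and> norm u = 1}"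
  define unit where "unit u = (1 / norm u) *\<^sub>R u" for u :: 'a
  have unit: "unit u \<in> M" "norm (unit u) = 1" if "u \<in> M" "u \<noteq> 0" for u
    using that M by (auto simp: unit_def subspace_scale)
  have unit_G: "inner (G u) u = inner (G (unit u)) (unit u) * (norm u)\<^sup>2" if "u \<noteq> 0" for u
    using that by (simp add: unit_def G.scale power2_eq_square)
  have bddR: "bdd_above R"
  proof (rule bdd_aboveI)
    fix r assume "r \<in> R"
    then obtain u where u: "r = inner (G u) u" "norm u = 1" by (auto simp: R_def)
    have "inner (G u) u \<le> norm (G u) * norm u" by (rule norm_cauchy_schwarz)
    then show "r \<le> L" using L(1)[of u] u by simp
  qed
  have u0M: "u0 \<in> M" using u0 by (simp add: M_def)
  have Rin: "inner (G (unit u)) (unit u) \<in> R" if "u \<in> M" "u \<noteq> 0" for u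
    using unit[OF that] by (auto simp: R_def)
  then have Rne: "R \<noteq> {}" using u0M u0(2) by blast
  define t where "t = Sup R"
  have t\<gamma>: "t \<ge> \<gamma>"
  proof -
    have "\<gamma> * (norm u0)\<^sup>2 \<le> inner (G (unit u0)) (unit u0) * (norm u0)\<^sup>2"
      using u0 unit_G[OF u0(2)] by simp
    then have "\<gamma> \<le> inner (G (unit u0)) (unit u0)" using u0(2) by simp
    also have "\<dots> \<le> t" unfolding t_def by (rule cSup_upper[OF Rin[OF u0M u0(2)] bddR])
    finally show ?thesis .
  qed
  define B where "B x = t *\<^sub>R x - G x" for x
  have Blin: "linear B" unfolding B_def by (intro linearI) (auto simp: G.add G.scale algebra_simps)
  interpret B: linear B by fact
  have Bsym: "inner (B x) y = inner x (B y)" for x y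
    using G(2)[of x y] by (simp add: B_def inner_diff)
  have BM: "B x \<in> M" if "x \<in> M" for x
    using GM[OF that] that M by (simp add: B_def subspace_diff subspace_scale)
  have Bpsd: "0 \<le> inner (B x) x" if "x \<in> M" for x
  proof (cases "x = 0")
    case False
    have "inner (G (unit x)) (unit x) \<le> t"
      unfolding t_def by (rule cSup_upper[OF Rin[OF that False] bddR])
    then have "inner (G x) x \<le> t * (norm x)\<^sup>2" unfolding unit_G[OF False] by (simp add: mult_right_mono)
    then show ?thesis by (simp add: B_def inner_diff_left power2_norm_eq_inner)
  qed (simp add: B.zero)
  have Binf: "\<exists>u\<in>M. inner (B u) u < \<delta> * (norm u)\<^sup>2" if "\<delta> > 0" for \<delta>
  proof -
    have "t - \<delta> < Sup R" using that by (simp add: t_def)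
    then obtain r where "r \<in> R" "t - \<delta> < r" using Rne less_cSupE by blast
    then obtain u where "u \<in> M" "norm u = 1" "t - \<delta> < inner (G u) u" by (auto simp: R_def)
    then have "inner (B u) u < \<delta> * (norm u)\<^sup>2"
      by (simp add: B_def inner_diff_left flip: power2_norm_eq_inner)
    then show ?thesis using \<open>u \<in> M\<close> by blast
  qed
  have restrict: "invertible_on M (\<lambda>x. B x - r *\<^sub>R x)"
    if inv: "invertible_on UNIV (\<lambda>x. G x - (t - r) *\<^sub>R x)" for r
  proof -
    obtain K where K: "\<And>u. \<exists>v. G v - (t - r) *\<^sub>R v = u \<and> norm v \<le> K * norm u"
      using inv unfolding invertible_on_def by blast
    have "\<exists>v\<in>M. B v - r *\<^sub>R v = u \<and> norm v \<le> K * norm u" if u: "u \<in> M" for u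
    proof -
      obtain v where v: "G v - (t - r) *\<^sub>R v = - u" "norm v \<le> K * norm u"
        using K[of "- u"] by auto
      have "B (P v) - r *\<^sub>R P v = - P (G v - (t - r) *\<^sub>R v)"
        by (simp add: B_def P.diff P.add P.scale P(4) algebra_simps)
      also have "\<dots> = u" using u by (simp add: v(1) P.neg M_def)
      finally have "B (P v) - r *\<^sub>R P v = u" .
      then show ?thesis using PM[of v] v(2) P(3)[of v] by (intro bexI[of _ "P v"]) auto
    qed
    then show ?thesis unfolding invertible_on_def by blast
  qed
  have not_inv: "\<not> invertible_on UNIV (\<lambda>x. G x - t *\<^sub>R x)"
  proof
    assume "invertible_on UNIV (\<lambda>x. G x - t *\<^sub>R x)"
    then have "invertible_on M B" using restrict[of 0] by simp
    from psd_invertible_imp_bounded_below[OF M Blin Bsym Bpsd this]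
    obtain \<delta> where "\<delta> > 0" "\<And>u. u \<in> M \<Longrightarrow> \<delta> * (norm u)\<^sup>2 \<le> inner (B u) u" by blast
    then show False using Binf[of \<delta>] by force
  qed
  then obtain \<epsilon> where \<epsilon>: "\<epsilon> > 0"
    "\<And>s. 0 < \<bar>s - t\<bar> \<Longrightarrow> \<bar>s - t\<bar> < \<epsilon> \<Longrightarrow> invertible_on UNIV (\<lambda>x. G x - s *\<^sub>R x)"
    using spec[OF t\<gamma>] by blast
  \<comment> \<open>The form of \<open>B\<^sup>2 - \<epsilon> B\<close>.\<close>
  define Q where "Q u = (norm (B u))\<^sup>2 - \<epsilon> * inner (B u) u" for u
  have gap: "0 \<le> Q u" if uM: "u \<in> M" for u
  proof -
    define W where "W = {Q u |u. u \<in> M \<and> norm u = 1}"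
    have Qlow: "- \<epsilon>\<^sup>2 / 4 \<le> Q u" if "norm u = 1" for u
    proof -
      have "inner (B u) u \<le> norm (B u)" using norm_cauchy_schwarz[of "B u" u] that by simp
      then have "(norm (B u))\<^sup>2 - \<epsilon> * norm (B u) \<le> Q u" using \<epsilon>(1) by (simp add: Q_def)
      moreover have "0 \<le> (norm (B u) - \<epsilon> / 2)\<^sup>2" by simp
      ultimately show ?thesis by (simp add: power2_eq_square algebra_simps)
    qed
    have Wne: "W \<noteq> {}" using unit[OF u0M u0(2)] by (auto simp: W_def)
    have bddW: "bdd_below W" by (rule bdd_belowI[of _ "- \<epsilon>\<^sup>2 / 4"]) (use Qlow in \<open>auto simp: W_def\<close>)
    define \<beta> where "\<beta> = Inf W"
    have \<beta>low: "- \<epsilon>\<^sup>2 / 4 \<le> \<beta>" unfolding \<beta>_def by (rule cInf_greatest[OF Wne]) (use Qlow in \<open>auto simp: W_def\<close>)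
    have unit_Q: "Q u = Q (unit u) * (norm u)\<^sup>2" if "u \<noteq> 0" for u
      using that by (simp add: unit_def Q_def B.scale power2_eq_square field_simps)
    have Q\<beta>: "\<beta> * (norm u)\<^sup>2 \<le> Q u" if "u \<in> M" for u
    proof (cases "u = 0")
      case False
      have "\<beta> \<le> Q (unit u)" unfolding \<beta>_def
        using unit[OF that False] by (intro cInf_lower bddW) (auto simp: W_def)
      then show ?thesis unfolding unit_Q[OF False] by (simp add: mult_right_mono)
    qed (simp add: Q_def B.zero)
    have "\<beta> \<ge> 0"
    proof (rule ccontr)
      assume "\<not> \<beta> \<ge> 0"
      then have \<beta>: "\<beta> < 0" by simp
      \<comment> \<open>\<open>r1\<close> and \<open>r2\<close> are the roots of \<open>r\<^sup>2 - \<epsilon> r - \<beta>\<close>. They lie in the gap, so \<open>B\<^sup>2 - \<epsilon> B - \<beta> = (B - r1) (B - r2)\<close> is invertible, which contradicts that \<open>\<beta>\<close> is the infimum of \<open>Q\<close>.\<close>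
      define q where "q = sqrt (\<epsilon>\<^sup>2 + 4 * \<beta>)"
      have q2: "q\<^sup>2 = \<epsilon>\<^sup>2 + 4 * \<beta>" using \<beta>low by (simp add: q_def)
      have q: "0 \<le> q" "q < \<epsilon>"
        using \<beta>low \<beta> \<epsilon>(1) real_sqrt_less_mono[of "\<epsilon>\<^sup>2 + 4 * \<beta>" "\<epsilon>\<^sup>2"] by (auto simp: q_def)
      define r1 where "r1 = (\<epsilon> + q) / 2"
      define r2 where "r2 = (\<epsilon> - q) / 2"
      have r: "0 < r1" "r1 < \<epsilon>" "0 < r2" "r2 < \<epsilon>" using q \<epsilon>(1) by (auto simp: r1_def r2_def)
      have rr: "r1 + r2 = \<epsilon>" "r1 * r2 = - \<beta>"
        using q2 by (auto simp: r1_def r2_def power2_eq_square field_simps)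
      define D where "D x = B (B x) - \<epsilon> *\<^sub>R B x - \<beta> *\<^sub>R x" for x
      have Dfac: "D = (\<lambda>x. B (B x - r2 *\<^sub>R x) - r1 *\<^sub>R (B x - r2 *\<^sub>R x))"
      proof
        fix x
        have "\<epsilon> *\<^sub>R B x = r1 *\<^sub>R B x + r2 *\<^sub>R B x" "\<beta> *\<^sub>R x = - ((r1 * r2) *\<^sub>R x)"
          using rr by (auto simp flip: scaleR_left_distrib)
        then show "D x = B (B x - r2 *\<^sub>R x) - r1 *\<^sub>R (B x - r2 *\<^sub>R x)"
          by (simp add: D_def B.diff B.scale algebra_simps)
      qed
      have Dinv: "invertible_on M D" unfolding Dfac
        by (rule invertible_on_compose; rule restrict; rule \<epsilon>(2)) (use r in auto)
      have Dlin: "linear D" unfolding D_def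
        by (intro linearI) (auto simp: B.add B.scale algebra_simps)
      have Dsym: "inner (D x) y = inner x (D y)" for x y
        by (simp add: D_def inner_diff Bsym)
      have DQ: "inner (D x) x = Q x - \<beta> * (norm x)\<^sup>2" for x
        by (simp add: D_def Q_def inner_diff_left Bsym[of "B x"] power2_norm_eq_inner)
      have Dpsd: "0 \<le> inner (D x) x" if "x \<in> M" for x using Q\<beta>[OF that] by (simp add: DQ)
      from psd_invertible_imp_bounded_below[OF M Dlin Dsym Dpsd Dinv]
      obtain \<delta> where \<delta>: "\<delta> > 0" "\<And>u. u \<in> M \<Longrightarrow> \<delta> * (norm u)\<^sup>2 \<le> inner (D u) u" by blast
      have "\<beta> + \<delta> \<le> Inf W"
      proof (rule cInf_greatest[OF Wne])
        fix w assume "w \<in> W"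
        then obtain u where "w = Q u" "u \<in> M" "norm u = 1" by (auto simp: W_def)
        then show "\<beta> + \<delta> \<le> w" using \<delta>(2)[of u] by (simp add: DQ)
      qed
      then show False using \<delta>(1) by (simp add: \<beta>_def)
    qed
    then show ?thesis using Q\<beta>[OF uM] by (smt (verit) mult_nonneg_nonneg zero_le_power2)
  qed
  have on_range: "\<epsilon> * (norm f)\<^sup>2 \<le> inner (B f) f" if f: "f \<in> B ` M" for f
  proof (cases "f = 0")
    case False
    obtain v where v: "v \<in> M" "f = B v" using f by blast
    have fM: "f \<in> M" using v BM by simp
    \<comment> \<open>Cauchy--Schwarz for the form of \<open>B\<close>, together with \<open>\<epsilon> \<langle>B v, v\<rangle> \<le> \<parallel>B v\<parallel>\<^sup>2 = \<parallel>f\<parallel>\<^sup>2\<close>.\<close>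
    have "((norm f)\<^sup>2)\<^sup>2 = (inner (B v) f)\<^sup>2" by (simp add: v(2) power2_norm_eq_inner)
    also have "\<dots> \<le> inner (B v) v * inner (B f) f"
      by (rule Cauchy_Schwarz_psd[OF M Blin Bsym Bpsd v(1) fM])
    finally have "\<epsilon> * ((norm f)\<^sup>2)\<^sup>2 \<le> (\<epsilon> * inner (B v) v) * inner (B f) f"
      using \<epsilon>(1) by (simp add: mult_left_mono mult.assoc)
    also have "\<dots> \<le> (norm f)\<^sup>2 * inner (B f) f"
      using gap[OF v(1)] Bpsd[OF fM] by (intro mult_right_mono) (auto simp: Q_def v(2))
    finally have "(norm f)\<^sup>2 * (\<epsilon> * (norm f)\<^sup>2) \<le> (norm f)\<^sup>2 * inner (B f) f"
      by (simp add: power2_eq_square mult_ac)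
    then show ?thesis using False
      by (meson mult_le_cancel_left_pos zero_less_norm_iff zero_less_power)
  qed (simp add: B.zero)
  define S where "S = closure (B ` M)"
  have Bcont: "continuous_on A B" for A unfolding B_def by (intro continuous_intros G.continuous_on)
  have on_closure: "\<epsilon> * (norm f)\<^sup>2 \<le> inner (B f) f" if "f \<in> S" for f
  proof -
    have "closed {f. \<epsilon> * (norm f)\<^sup>2 \<le> inner (B f) f}"
      by (intro closed_Collect_le continuous_intros Bcont)
    moreover have "B ` M \<subseteq> {f. \<epsilon> * (norm f)\<^sup>2 \<le> inner (B f) f}" using on_range by blast
    ultimately show ?thesis using that closure_minimal unfolding S_def by blast
  qed
  obtain u where u: "u \<in> M" "u \<notin> S" using Binf[OF \<epsilon>(1)] on_closure by fastforce
  have Ssub: "subspace S" unfolding S_def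
    by (rule subspace_closure[OF linear_subspace_image[OF Blin M]])
  have SM: "S \<subseteq> M" unfolding S_def by (rule closure_minimal[OF _ Mcl]) (use BM in auto)
  obtain p where p: "p \<in> S" "\<And>x. x \<in> S \<Longrightarrow> inner p x = inner u x"
    using riesz_on_subspace[OF Ssub _ bounded_linear_inner_right[of u]] by (auto simp: S_def)
  define e where "e = u - p"
  have eM: "e \<in> M" using u p SM M by (auto simp: e_def subspace_diff)
  have "inner (B e) (B e) = inner e (B (B e))" by (rule Bsym)
  also have "\<dots> = 0"
  proof -
    have "B (B e) \<in> S" unfolding S_def using BM[OF eM] by (intro closure_subset[THEN subsetD] imageI)
    then show ?thesis using p(2) by (simp add: e_def inner_diff_left)
  qed
  finally have "B e = 0" by simp
  then have "G e = t *\<^sub>R e" by (simp add: B_def)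
  moreover have "e \<noteq> 0" using u p by (auto simp: e_def)
  ultimately show ?thesis using that t\<gamma> eM by (auto simp: M_def)
qed

section \<open>The Hilbert space of square integrable functions\<close>

lemma L2_I:
  assumes "u \<in> borel_measurable borel" "integrable lborel (\<lambda>x. (cmod (u x))\<^sup>2)"
  shows "u \<in> L2"
  using assms by (simp add: L2_def)

lemma L2_measurable [measurable_dest]: "u \<in> L2 \<Longrightarrow> u \<in> borel_measurable borel"
  by (simp add: L2_def)

lemma L2_square_integrable: "u \<in> L2 \<Longrightarrow> integrable lborel (\<lambda>x. (cmod (u x))\<^sup>2)"
  by (simp add: L2_def)

lemma L2_bounded_by:
  assumes "u \<in> borel_measurable borel" "integrable lborel g" "\<And>x. (cmod (u x))\<^sup>2 \<le> g x"
  shows "u \<in> L2"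
proof (rule L2_I)
  show "integrable lborel (\<lambda>x. (cmod (u x))\<^sup>2)"
    by (rule Bochner_Integration.integrable_bound[OF assms(2)])
       (use assms in \<open>auto intro!: AE_I2 order_trans[OF assms(3) abs_ge_self]\<close>)
qed fact

lemma cmod_add_square_le: "(cmod (a + b))\<^sup>2 \<le> 2 * (cmod a)\<^sup>2 + 2 * (cmod b)\<^sup>2"
proof -
  have "(cmod (a + b))\<^sup>2 \<le> (cmod a + cmod b)\<^sup>2" by (simp add: norm_triangle_ineq power_mono)
  also have "\<dots> \<le> 2 * (cmod a)\<^sup>2 + 2 * (cmod b)\<^sup>2"
    using sum_squares_bound[of "cmod a" "cmod b"] by (simp add: power2_sum)
  finally show ?thesis .
qed

lemma L2_add: assumes "u \<in> L2" "v \<in> L2" shows "(\<lambda>x. u x + v x) \<in> L2"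
  by (rule L2_bounded_by[where g = "\<lambda>x. 2 * (cmod (u x))\<^sup>2 + 2 * (cmod (v x))\<^sup>2"])
     (use assms L2_measurable L2_square_integrable cmod_add_square_le in auto)

lemma L2_cmult: assumes "u \<in> L2" shows "(\<lambda>x. c * u x) \<in> L2"
  by (rule L2_bounded_by[where g = "\<lambda>x. (cmod c)\<^sup>2 * (cmod (u x))\<^sup>2"])
     (use assms L2_measurable L2_square_integrable in \<open>auto simp: norm_mult power_mult_distrib\<close>)

lemma L2_zero: "(\<lambda>x. 0) \<in> L2"
  by (rule L2_I) auto

lemma L2_diff: assumes "u \<in> L2" "v \<in> L2" shows "(\<lambda>x. u x - v x) \<in> L2"
  using L2_add[OF assms(1) L2_cmult[OF assms(2), of "-1"]] by simp

lemma L2_sum: assumes "\<And>i. i \<in> I \<Longrightarrow> u i \<in> L2" shows "(\<lambda>x. \<Sum>i\<in>I. u i x) \<in> L2"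
  using assms by (induction I rule: infinite_finite_induct) (auto simp: L2_zero L2_add)

lemma L2_mult_integrable:
  assumes "u \<in> L2" "v \<in> L2"
  shows "integrable lborel (\<lambda>x. u x * v x)" "integrable lborel (\<lambda>x. u x * cnj (v x))"
proof -
  have m: "u \<in> borel_measurable borel" "v \<in> borel_measurable borel" using assms L2_measurable by auto
  have m': "(\<lambda>x. cnj (v x)) \<in> borel_measurable borel"
    by (rule borel_measurable_continuous_on[OF _ m(2)]) (intro continuous_intros)
  have b: "cmod a * cmod b \<le> (cmod a)\<^sup>2 + (cmod b)\<^sup>2" for a b
    using sum_squares_bound[of "cmod a" "cmod b"] mult_nonneg_nonneg[OF norm_ge_zero norm_ge_zero, of a b]
    by linarith
  have i: "integrable lborel (\<lambda>x. (cmod (u x))\<^sup>2 + (cmod (v x))\<^sup>2)"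
    using assms L2_square_integrable by auto
  show "integrable lborel (\<lambda>x. u x * v x)" "integrable lborel (\<lambda>x. u x * cnj (v x))"
    by (rule Bochner_Integration.integrable_bound[OF i]; use m m' b in \<open>auto simp: norm_mult\<close>)+
qed

lemma L2_indicator: "(\<lambda>x. complex_of_real (indicator {a..b} x)) \<in> L2"
proof (rule L2_I)
  have "(\<lambda>x. (cmod (complex_of_real (indicator {a..b} x)))\<^sup>2) = indicator {a..b}"
    by (auto simp: indicator_def)
  then show "integrable lborel (\<lambda>x. (cmod (complex_of_real (indicator {a..b} x)))\<^sup>2)"
    by (simp only:) (rule integrable_real_indicator; simp add: emeasure_lborel_Icc_eq)
qed simp

text \<open>
  Identifying functions that agree almost everywhere turns \<open>L2\<close> into a type to which the lemmas above
  apply. Its real inner product is the real part of the complex one (\<open>cinner\<close>); multiplication by complex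
  scalars (\<open>cscale\<close>) is kept separately.
\<close>
quotient_type l2 = "real \<Rightarrow> complex" /
  partial: "\<lambda>u v. u \<in> L2 \<and> v \<in> L2 \<and> (AE x in lborel. u x = v x)"
  morphisms fn to_l2
proof (rule part_equivpI)
  show "\<exists>u. u \<in> L2 \<and> u \<in> L2 \<and> (AE x in lborel. u x = u x)" using L2_zero by auto
  show "symp (\<lambda>u v. u \<in> L2 \<and> v \<in> L2 \<and> (AE x in lborel. u x = v x))"
    by (auto intro!: sympI)
  show "transp (\<lambda>u v. u \<in> L2 \<and> v \<in> L2 \<and> (AE x in lborel. u x = v x))"
    by (rule transpI, elim conjE, intro conjI; (assumption | (erule (1) eventually_elim2, simp)))
qed

lemma to_l2_eq_iff: "u \<in> L2 \<Longrightarrow> v \<in> L2 \<Longrightarrow> to_l2 u = to_l2 v \<longleftrightarrow> (AE x in lborel. u x = v x)"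
  using Quotient3_rel[OF Quotient3_l2, of u v] by auto

lemma fn_L2 [simp]: "fn x \<in> L2"
  using Quotient3_rep_reflp[OF Quotient3_l2, of x] by simp

lemma to_l2_fn [simp]: "to_l2 (fn x) = x"
  by (rule Quotient3_abs_rep[OF Quotient3_l2])

lemma AE_eq_map2:
  assumes "AE x in M. u x = u' x" "AE x in M. v x = v' x"
  shows "AE x in M. F (u x) (v x) = F (u' x) (v' x)"
  using assms by eventually_elim simp

lemma AE_eq_map:
  assumes "AE x in M. u x = u' x"
  shows "AE x in M. F (u x) = F (u' x)"
  using assms by eventually_elim simp

lemma L2_uminus: "u \<in> L2 \<Longrightarrow> (\<lambda>x. - u x) \<in> L2"
  using L2_cmult[of u "-1"] by simp

instantiation l2 :: real_vector
begin
lift_definition zero_l2 :: l2 is "\<lambda>x. 0" by (intro conjI L2_zero AE_I2 refl)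
lift_definition plus_l2 :: "l2 \<Rightarrow> l2 \<Rightarrow> l2" is "\<lambda>u v x. u x + v x"
  by (elim conjE, intro conjI L2_add, assumption+, rule AE_eq_map2[where F = "(+)"])
lift_definition uminus_l2 :: "l2 \<Rightarrow> l2" is "\<lambda>u x. - u x"
  by (elim conjE, intro conjI L2_uminus, assumption+, rule AE_eq_map[where F = uminus])
lift_definition minus_l2 :: "l2 \<Rightarrow> l2 \<Rightarrow> l2" is "\<lambda>u v x. u x - v x"
  by (elim conjE, intro conjI L2_diff, assumption+, rule AE_eq_map2[where F = "(-)"])
lift_definition scaleR_l2 :: "real \<Rightarrow> l2 \<Rightarrow> l2" is "\<lambda>c u x. of_real c * u x"
  by (elim conjE, intro conjI L2_cmult, assumption+, rule AE_eq_map)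
instance
proof
  fix x y z :: l2 and a b :: real
  show "x + y + z = x + (y + z)" by transfer (simp add: L2_add algebra_simps)
  show "x + y = y + x" by transfer (simp add: L2_add algebra_simps)
  show "0 + x = x" by transfer simp
  show "- x + x = 0" by transfer (simp add: L2_zero)
  show "x - y = x + - y" by transfer (simp add: L2_diff)
  show "a *\<^sub>R (x + y) = a *\<^sub>R x + a *\<^sub>R y" by transfer (simp add: L2_add L2_cmult distrib_left)
  show "(a + b) *\<^sub>R x = a *\<^sub>R x + b *\<^sub>R x" by transfer (simp add: L2_add L2_cmult distrib_right)
  show "a *\<^sub>R b *\<^sub>R x = (a * b) *\<^sub>R x" by transfer (simp add: L2_cmult mult.assoc)
  show "1 *\<^sub>R x = x" by transfer simp
qed
end

lift_definition cscale :: "complex \<Rightarrow> l2 \<Rightarrow> l2" is "\<lambda>c u x. c * u x"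
  by (elim conjE, intro conjI L2_cmult, assumption+, rule AE_eq_map)

lift_definition cinner :: "l2 \<Rightarrow> l2 \<Rightarrow> complex" is L2_inner
  unfolding L2_inner_def
  by (rule integral_cong_AE)
    ((auto intro: L2_mult_integrable(2)[THEN borel_measurable_integrable, simplified])[2],
     use AE_eq_map2[where F = "\<lambda>a b. a * cnj b"] in blast)

lemma L2_inner_self: "u \<in> L2 \<Longrightarrow> L2_inner u u = of_real (LINT x|lborel. (cmod (u x))\<^sup>2)"
  unfolding L2_inner_def by (simp add: complex_norm_square[symmetric] flip: integral_complex_of_real)

lemma L2_norm_square: "(L2_norm u)\<^sup>2 = (LINT x|lborel. (cmod (u x))\<^sup>2)"
  unfolding L2_norm_def by (intro real_sqrt_pow2 integral_nonneg) auto

lemma L2_inner_add_left: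
  "u \<in> L2 \<Longrightarrow> v \<in> L2 \<Longrightarrow> w \<in> L2 \<Longrightarrow> L2_inner (\<lambda>x. u x + v x) w = L2_inner u w + L2_inner v w"
  unfolding L2_inner_def by (simp add: distrib_right L2_mult_integrable)

lemma L2_inner_cmult_left: "L2_inner (\<lambda>x. c * u x) w = c * L2_inner u w"
  unfolding L2_inner_def by (simp add: mult.assoc)

lemma L2_inner_commute: "L2_inner u w = cnj (L2_inner w u)"
  unfolding L2_inner_def by (subst Bochner_Integration.integral_cnj[symmetric]) (simp add: mult.commute)

instantiation l2 :: real_inner
begin
definition inner_l2 :: "l2 \<Rightarrow> l2 \<Rightarrow> real" where "inner_l2 u v = Re (cinner u v)"
definition norm_l2 :: "l2 \<Rightarrow> real" where "norm_l2 u = sqrt (inner u u)"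
definition sgn_l2 :: "l2 \<Rightarrow> l2" where "sgn_l2 u = inverse (norm u) *\<^sub>R u"
definition dist_l2 :: "l2 \<Rightarrow> l2 \<Rightarrow> real" where "dist_l2 u v = norm (u - v)"
definition uniformity_l2 :: "(l2 \<times> l2) filter" where
  "uniformity_l2 = (INF e\<in>{0<..}. principal {(x, y). dist x y < e})"
definition open_l2 :: "l2 set \<Rightarrow> bool" where
  "open_l2 U = (\<forall>x\<in>U. \<forall>\<^sub>F (x', y) in uniformity. x' = x \<longrightarrow> y \<in> U)"
instance
proof
  fix x y z :: l2 and r :: real
  show "inner x y = inner y x"
    unfolding inner_l2_def by transfer (metis L2_inner_commute cnj.sel(1))
  show "inner (x + y) z = inner x z + inner y z"
    unfolding inner_l2_def by transfer (simp add: L2_inner_add_left)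
  show "inner (r *\<^sub>R x) y = r * inner x y"
    unfolding inner_l2_def by transfer (simp add: L2_inner_cmult_left)
  show "0 \<le> inner x x"
    unfolding inner_l2_def by transfer (simp add: L2_inner_self)
  show "inner x x = 0 \<longleftrightarrow> x = 0"
    unfolding inner_l2_def
  proof transfer
    fix u assume u: "u \<in> L2 \<and> u \<in> L2 \<and> (AE x in lborel. u x = u x)"
    have "Re (L2_inner u u) = 0 \<longleftrightarrow> (LINT x|lborel. (cmod (u x))\<^sup>2) = 0"
      using u by (simp add: L2_inner_self)
    also have "\<dots> \<longleftrightarrow> (AE x in lborel. (cmod (u x))\<^sup>2 = 0)"
      using u by (intro integral_nonneg_eq_0_iff_AE) (auto simp: L2_square_integrable)
    finally show "(Re (L2_inner u u) = 0) = (u \<in> L2 \<and> (\<lambda>x. 0) \<in> L2 \<and> (AE x in lborel. u x = 0))"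
      using u L2_zero by simp
  qed
qed (simp_all add: norm_l2_def sgn_l2_def dist_l2_def uniformity_l2_def open_l2_def)
end

lemma cinner_to_l2: "u \<in> L2 \<Longrightarrow> v \<in> L2 \<Longrightarrow> cinner (to_l2 u) (to_l2 v) = L2_inner u v"
  by (rule cinner.abs_eq) simp_all

lemma norm_to_l2: "u \<in> L2 \<Longrightarrow> norm (to_l2 u) = L2_norm u"
  unfolding norm_l2_def inner_l2_def by (simp add: cinner_to_l2 L2_inner_self L2_norm_def)

lemma cscale_to_l2: "u \<in> L2 \<Longrightarrow> cscale c (to_l2 u) = to_l2 (\<lambda>x. c * u x)"
  by (rule cscale.abs_eq) simp
lemma plus_to_l2: "u \<in> L2 \<Longrightarrow> v \<in> L2 \<Longrightarrow> to_l2 u + to_l2 v = to_l2 (\<lambda>x. u x + v x)"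
  by (rule plus_l2.abs_eq) simp_all
lemma minus_to_l2: "u \<in> L2 \<Longrightarrow> v \<in> L2 \<Longrightarrow> to_l2 u - to_l2 v = to_l2 (\<lambda>x. u x - v x)"
  by (rule minus_l2.abs_eq) simp_all
lemma scaleR_to_l2: "u \<in> L2 \<Longrightarrow> c *\<^sub>R to_l2 u = to_l2 (\<lambda>x. of_real c * u x)"
  by (rule scaleR_l2.abs_eq) simp
lemma zero_to_l2: "0 = to_l2 (\<lambda>x. 0)"
  by (rule zero_l2.abs_eq)

lemma cinner_commute: "cinner x y = cnj (cinner y x)"
  by transfer (rule L2_inner_commute)
lemma cinner_add_left: "cinner (x + y) z = cinner x z + cinner y z"
  by transfer (simp add: L2_inner_add_left)
lemma cinner_cscale_left: "cinner (cscale c x) y = c * cinner x y"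
  by transfer (simp add: L2_inner_cmult_left)
lemma cinner_add_right: "cinner z (x + y) = cinner z x + cinner z y"
  using cinner_add_left cinner_commute by (metis complex_cnj_add)
lemma cinner_cscale_right: "cinner x (cscale c y) = cnj c * cinner x y"
  using cinner_cscale_left cinner_commute by (metis complex_cnj_mult)
lemma cscale_of_real: "cscale (of_real r) x = r *\<^sub>R x"
  by transfer (simp add: L2_cmult)
lemma cscale_add_right: "cscale c (x + y) = cscale c x + cscale c y"
  by transfer (simp add: L2_cmult L2_add algebra_simps)
lemma cscale_add_left: "cscale (c + d) x = cscale c x + cscale d x"
  by transfer (simp add: L2_cmult L2_add algebra_simps)
lemma cscale_cscale: "cscale c (cscale d x) = cscale (c * d) x"
  by transfer (simp add: L2_cmult mult.assoc)
lemma cinner_scaleR_left: "cinner (r *\<^sub>R x) y = of_real r * cinner x y"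
  by (simp flip: cscale_of_real add: cinner_cscale_left)
lemma cinner_scaleR_right: "cinner x (r *\<^sub>R y) = of_real r * cinner x y"
  by (simp flip: cscale_of_real add: cinner_cscale_right)
lemma cscale_scaleR: "cscale c (r *\<^sub>R x) = r *\<^sub>R cscale c x"
  by (simp add: cscale_cscale mult.commute flip: cscale_of_real)
lemma cinner_self: "cinner x x = of_real ((norm x)\<^sup>2)"
  unfolding power2_norm_eq_inner inner_l2_def by transfer (simp add: L2_inner_self)
lemma cinner_zero_left [simp]: "cinner 0 x = 0"
  using cinner_scaleR_left[of 0 x x] by simp
lemma Im_cinner: "Im (cinner x y) = inner x (cscale \<i> y)"
  by (simp add: inner_l2_def cinner_cscale_right)
lemma cinner_eq: "cinner x y = Complex (inner x y) (inner x (cscale \<i> y))"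
  by (simp add: complex_eq_iff Im_cinner) (simp add: inner_l2_def)
lemma norm_cscale: "norm (cscale c x) = cmod c * norm x"
proof -
  have "complex_of_real ((norm (cscale c x))\<^sup>2) = (c * cnj c) * of_real ((norm x)\<^sup>2)"
    by (simp only: cinner_self[symmetric] cinner_cscale_left cinner_cscale_right mult_ac)
  also have "c * cnj c = of_real ((cmod c)\<^sup>2)" by (rule complex_norm_square[symmetric])
  finally have "(norm (cscale c x))\<^sup>2 = (cmod c)\<^sup>2 * (norm x)\<^sup>2"
    unfolding of_real_mult[symmetric] of_real_eq_iff .
  then have "(norm (cscale c x))\<^sup>2 = (cmod c * norm x)\<^sup>2" by (simp add: power_mult_distrib)
  then show ?thesis by (simp add: power2_eq_iff_nonneg)
qed

text \<open>
  The real Cauchy--Schwarz inequality, after multiplying \<open>x\<close> by a phase that makes \<open>cinner x y\<close> positive.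
\<close>
lemma norm_cinner_le: "cmod (cinner x y) \<le> norm x * norm y"
proof (cases "cinner x y = 0")
  case False
  define z where "z = cnj (cinner x y) / of_real (cmod (cinner x y))"
  have "cmod z = 1" using False by (simp add: z_def norm_divide)
  have "z * cinner x y = (cinner x y * cnj (cinner x y)) / of_real (cmod (cinner x y))"
    by (simp add: z_def)
  also have "\<dots> = of_real ((cmod (cinner x y))\<^sup>2) / of_real (cmod (cinner x y))"
    by (simp only: complex_norm_square)
  also have "\<dots> = of_real (cmod (cinner x y))" using False by (simp add: power2_eq_square)
  finally have "z * cinner x y = of_real (cmod (cinner x y))" .
  then have "cmod (cinner x y) = inner (cscale z x) y"
    by (simp add: inner_l2_def cinner_cscale_left)
  also have "\<dots> \<le> norm (cscale z x) * norm y" by (rule norm_cauchy_schwarz)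
  also have "\<dots> = norm x * norm y" using \<open>cmod z = 1\<close> by (simp add: norm_cscale)
  finally show ?thesis .
qed simp

lemma summable_of_weighted_squares:
  fixes d :: "nat \<Rightarrow> complex"
  assumes "summable (\<lambda>n. 2 ^ n * (cmod (d n))\<^sup>2)"
  shows "summable d"
proof -
  have "(\<lambda>n. 2 ^ n * (cmod (d n))\<^sup>2) \<longlonglongrightarrow> 0" by (rule summable_LIMSEQ_zero[OF assms])
  then have "\<forall>\<^sub>F n in sequentially. 2 ^ n * (cmod (d n))\<^sup>2 < 1" by (rule order_tendstoD) simp
  then obtain N where N: "\<And>n. n \<ge> N \<Longrightarrow> 2 ^ n * (cmod (d n))\<^sup>2 < 1"
    unfolding eventually_sequentially by blast
  have "cmod (d n) \<le> (1 / sqrt 2) ^ n" if "n \<ge> N" for n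
  proof (rule power2_le_imp_le)
    have "((1 / sqrt 2) ^ n)\<^sup>2 = 1 / 2 ^ n"
      by (simp add: power_divide flip: power_mult_distrib power_mult[of _ 2 n] power_mult[of _ n 2])
         (simp add: power_mult mult.commute[of n])
    then show "(cmod (d n))\<^sup>2 \<le> ((1 / sqrt 2) ^ n)\<^sup>2"
      using N[OF that] by (simp add: field_simps)
  qed simp
  then show ?thesis
    by (intro summable_comparison_test[OF _ summable_geometric[of "1 / sqrt 2"]]) auto
qed

text \<open>
  The integral of \<open>\<Sum>n. 2 ^ n * \<bar>f (Suc n) x - f n x\<bar>\<^sup>2\<close> is finite because \<open>2 ^ n * (1/4) ^ n\<close> is summable. So the
  sum is finite at almost every \<open>x\<close>, the increments are then \<open>O(2 ^ (- n / 2))\<close>, and \<open>f n x\<close> converges. Fatou's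
  lemma carries the rate over to the limit.
\<close>
lemma L2_rapid_Cauchy_limit:
  fixes f :: "nat \<Rightarrow> real \<Rightarrow> complex"
  assumes f: "\<And>n. f n \<in> L2"
    and c: "\<And>n m. n \<le> m \<Longrightarrow> (LINT x|lborel. (cmod (f n x - f m x))\<^sup>2) \<le> (1/4) ^ n"
  obtains v where "v \<in> L2" "\<And>n. (LINT x|lborel. (cmod (f n x - v x))\<^sup>2) \<le> (1/4) ^ n"
proof -
  have [measurable]: "f n \<in> borel_measurable borel" for n by (rule L2_measurable[OF f])
  have nn: "(\<integral>\<^sup>+x. ennreal ((cmod (f n x - f m x))\<^sup>2) \<partial>lborel) \<le> ennreal ((1/4) ^ n)" if "n \<le> m" for n m
  proof -
    have "(\<integral>\<^sup>+x. ennreal ((cmod (f n x - f m x))\<^sup>2) \<partial>lborel)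
        = ennreal (LINT x|lborel. (cmod (f n x - f m x))\<^sup>2)"
      by (rule nn_integral_eq_integral) (use L2_square_integrable[OF L2_diff[OF f f]] in auto)
    then show ?thesis using c[OF that] by (simp add: ennreal_leI)
  qed
  define d where "d n x = f (Suc n) x - f n x" for n x
  have [measurable]: "d n \<in> borel_measurable borel" for n unfolding d_def by measurable
  have "(\<integral>\<^sup>+x. (\<Sum>n. ennreal (2 ^ n * (cmod (d n x))\<^sup>2)) \<partial>lborel)
      = (\<Sum>n. \<integral>\<^sup>+x. ennreal (2 ^ n * (cmod (d n x))\<^sup>2) \<partial>lborel)"
    by (rule nn_integral_suminf) auto
  also have "\<dots> \<le> (\<Sum>n. ennreal ((1/2) ^ n))"
  proof (intro suminf_le summableI)
    fix n
    have "(\<integral>\<^sup>+x. ennreal (2 ^ n * (cmod (d n x))\<^sup>2) \<partial>lborel)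
        = ennreal (2 ^ n) * (\<integral>\<^sup>+x. ennreal ((cmod (f n x - f (Suc n) x))\<^sup>2) \<partial>lborel)"
      by (simp add: ennreal_mult d_def nn_integral_cmult norm_minus_commute)
    also have "\<dots> \<le> ennreal (2 ^ n) * ennreal ((1/4) ^ n)" by (intro mult_left_mono nn) auto
    also have "\<dots> = ennreal (2 ^ n * (1/4) ^ n)" by (simp flip: ennreal_mult)
    also have "2 ^ n * (1/4) ^ n = ((1/2) ^ n :: real)" by (simp flip: power_mult_distrib)
    finally show "(\<integral>\<^sup>+x. ennreal (2 ^ n * (cmod (d n x))\<^sup>2) \<partial>lborel) \<le> ennreal ((1/2) ^ n)" .
  qed
  also have "\<dots> = ennreal (\<Sum>n. (1/2) ^ n)" by (rule suminf_ennreal2) (auto intro: summable_geometric)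
  also have "\<dots> < \<infinity>" by simp
  finally have "AE x in lborel. (\<Sum>n. ennreal (2 ^ n * (cmod (d n x))\<^sup>2)) \<noteq> \<infinity>"
    by (intro nn_integral_PInf_AE) auto
  then have lim: "AE x in lborel. (\<lambda>n. f n x) \<longlonglongrightarrow> lim (\<lambda>n. f n x)"
  proof eventually_elim
    fix x assume "(\<Sum>n. ennreal (2 ^ n * (cmod (d n x))\<^sup>2)) \<noteq> \<infinity>"
    then have "summable (\<lambda>n. 2 ^ n * (cmod (d n x))\<^sup>2)" by (intro summable_suminf_not_top) auto
    then have "summable (\<lambda>n. d n x)" by (rule summable_of_weighted_squares)
    then have "convergent (\<lambda>n. f n x - f 0 x)"
      by (simp add: d_def summable_iff_convergent sum_lessThan_telescope[of "\<lambda>n. f n x"])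
    from convergent_add[OF this convergent_const[of "f 0 x"]] have "convergent (\<lambda>n. f n x)" by simp
    then show "(\<lambda>n. f n x) \<longlonglongrightarrow> lim (\<lambda>n. f n x)" by (simp add: convergent_LIMSEQ_iff)
  qed
  define v where "v x = lim (\<lambda>n. f n x)" for x
  have [measurable]: "v \<in> borel_measurable borel" unfolding v_def by (rule borel_measurable_lim_metric) auto
  have fatou: "(\<integral>\<^sup>+x. ennreal ((cmod (f n x - v x))\<^sup>2) \<partial>lborel) \<le> ennreal ((1/4) ^ n)" for n
  proof -
    have "(\<integral>\<^sup>+x. ennreal ((cmod (f n x - v x))\<^sup>2) \<partial>lborel)
        = (\<integral>\<^sup>+x. liminf (\<lambda>m. ennreal ((cmod (f n x - f m x))\<^sup>2)) \<partial>lborel)"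
    proof (rule nn_integral_cong_AE, use lim in eventually_elim)
      fix x assume "(\<lambda>n. f n x) \<longlonglongrightarrow> lim (\<lambda>n. f n x)"
      then have "(\<lambda>m. ennreal ((cmod (f n x - f m x))\<^sup>2)) \<longlonglongrightarrow> ennreal ((cmod (f n x - v x))\<^sup>2)"
        unfolding v_def by (intro tendsto_intros tendsto_ennrealI)
      then show "ennreal ((cmod (f n x - v x))\<^sup>2) = liminf (\<lambda>m. ennreal ((cmod (f n x - f m x))\<^sup>2))"
        by (metis lim_imp_Liminf trivial_limit_sequentially)
    qed
    also have "\<dots> \<le> liminf (\<lambda>m. \<integral>\<^sup>+x. ennreal ((cmod (f n x - f m x))\<^sup>2) \<partial>lborel)"
      by (rule nn_integral_liminf) auto
    also have "\<dots> \<le> limsup (\<lambda>m. \<integral>\<^sup>+x. ennreal ((cmod (f n x - f m x))\<^sup>2) \<partial>lborel)"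
      by (rule Liminf_le_Limsup) simp
    also have "\<dots> \<le> ennreal ((1/4) ^ n)"
      by (rule Limsup_bounded) (use nn in \<open>auto simp: eventually_sequentially\<close>)
    finally show ?thesis .
  qed
  have int: "integrable lborel (\<lambda>x. (cmod (f n x - v x))\<^sup>2)" for n
    by (rule integrableI_bounded) (use fatou[of n] in \<open>auto simp: le_less_trans\<close>)
  have "(\<lambda>x. f 0 x - v x) \<in> L2" by (rule L2_I) (use int in auto)
  from L2_diff[OF f[of 0] this] have "v \<in> L2" by simp
  moreover have "(LINT x|lborel. (cmod (f n x - v x))\<^sup>2) \<le> (1/4) ^ n" for n
    using fatou[of n] nn_integral_eq_integral[OF int[of n]] by simp
  ultimately show ?thesis using that by blast
qed

instance l2 :: complete_space
proof
  fix X :: "nat \<Rightarrow> l2" assume X: "Cauchy X"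
  have "\<exists>N. \<forall>m\<ge>N. \<forall>n\<ge>N. dist (X m) (X n) < (1/2) ^ k" for k :: nat
    using metric_CauchyD[OF X, of "(1/2) ^ k"] by simp
  then obtain N where N: "\<And>k m n. m \<ge> N k \<Longrightarrow> n \<ge> N k \<Longrightarrow> dist (X m) (X n) < (1/2) ^ k" by metis
  \<comment> \<open>Indices of a subsequence with geometric rate; the sum makes \<open>r\<close> increasing.\<close>
  define r where "r k = (\<Sum>i\<le>k. N i) + k" for k
  have r: "r k \<ge> N k" for k unfolding r_def by (intro trans_le_add1 member_le_sum) auto
  have r_mono: "r j \<le> r k" if "j \<le> k" for j k
    unfolding r_def using that by (intro add_mono sum_mono2) auto
  have rk: "r k \<ge> k" for k by (simp add: r_def)
  define f where "f k = fn (X (r k))" for k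
  have fX: "(LINT x|lborel. (cmod (f j x - v x))\<^sup>2) = (dist (X (r j)) (to_l2 v))\<^sup>2" if "v \<in> L2" for j v
  proof -
    have "X (r j) - to_l2 v = to_l2 (\<lambda>x. f j x - v x)"
      using minus_to_l2[of "f j" v] that by (simp add: f_def)
    then show ?thesis using that
      by (simp add: dist_norm norm_to_l2 L2_diff f_def L2_norm_square)
  qed
  have "(LINT x|lborel. (cmod (f j x - f k x))\<^sup>2) \<le> (1/4) ^ j" if "j \<le> k" for j k
  proof -
    have "dist (X (r j)) (X (r k)) \<le> (1/2) ^ j"
      using N[of j "r j" "r k"] r[of j] r_mono[OF that] by simp
    then have "(dist (X (r j)) (X (r k)))\<^sup>2 \<le> ((1/2) ^ j)\<^sup>2" by (intro power_mono) auto
    also have "\<dots> = (1/4) ^ j" by (simp add: power_mult_distrib power2_eq_square flip: power_mult_distrib)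
    finally show ?thesis using fX[of "f k" j] by (simp add: f_def)
  qed
  then obtain v where v: "v \<in> L2" "\<And>n. (LINT x|lborel. (cmod (f n x - v x))\<^sup>2) \<le> (1/4) ^ n"
    using L2_rapid_Cauchy_limit[of f] by (auto simp: f_def)
  have vk: "dist (X (r k)) (to_l2 v) \<le> (1/2) ^ k" for k
  proof (rule power2_le_imp_le)
    have "(dist (X (r k)) (to_l2 v))\<^sup>2 \<le> (1/4) ^ k" using v(2)[of k] fX[OF v(1), of k] by simp
    also have "\<dots> = ((1/2) ^ k)\<^sup>2" by (simp add: power2_eq_square flip: power_mult_distrib)
    finally show "(dist (X (r k)) (to_l2 v))\<^sup>2 \<le> ((1/2) ^ k)\<^sup>2" .
  qed simp
  have "X \<longlonglongrightarrow> to_l2 v"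
  proof (rule metric_LIMSEQ_I)
    fix e :: real assume e: "e > 0"
    obtain k where k: "(1/2) ^ k < e / 2" using real_arch_pow_inv[of "e / 2" "1/2"] e by auto
    have "dist (X n) (to_l2 v) < e" if "n \<ge> r k" for n
      using N[of k n "r k"] r[of k] that vk[of k] k dist_triangle[of "X n" "to_l2 v" "X (r k)"] by linarith
    then show "\<exists>no. \<forall>n\<ge>no. dist (X n) (to_l2 v) < e" by blast
  qed
  then show "convergent X" by (auto simp: convergent_def)
qed

section \<open>Test functions and weak derivatives\<close>

text \<open>
  The derivative is quantified existentially, so closure under sums and products is a plain induction
  that never computes a term of the form \<open>deriv f\<close>.
\<close>
primrec times_differentiable :: "nat \<Rightarrow> (real \<Rightarrow> real) \<Rightarrow> bool" where
  "times_differentiable 0 f \<longleftrightarrow> True"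
| "times_differentiable (Suc n) f \<longleftrightarrow>
     (\<exists>f'. (\<forall>x. (f has_real_derivative f' x) (at x)) \<and> times_differentiable n f')"

lemma times_differentiable_Suc_imp:
  "times_differentiable (Suc n) f \<Longrightarrow> (deriv ^^ n) f field_differentiable (at x)"
proof (induction n arbitrary: f)
  case 0
  then show ?case by (auto simp: field_differentiable_def)
next
  case (Suc n)
  then obtain f' where f': "\<And>x. (f has_real_derivative f' x) (at x)" "times_differentiable (Suc n) f'" by auto
  then have "deriv f = f'" by (auto intro: DERIV_imp_deriv)
  then show ?case using Suc.IH[OF f'(2)] by (simp add: funpow_swap1)
qed

lemma smooth_iff_times_differentiable:
  "(\<forall>n x. ((deriv ^^ n) f) field_differentiable (at x)) \<longleftrightarrow> (\<forall>n. times_differentiable n f)"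
proof safe
  fix n assume "\<forall>n x. ((deriv ^^ n) f) field_differentiable (at x)"
  then show "times_differentiable n f"
  proof (induction n arbitrary: f)
    case (Suc n)
    have "((deriv ^^ m) (deriv f)) field_differentiable (at x)" for m x
      using Suc.prems[rule_format, of "Suc m" x] by (simp add: funpow_swap1)
    then have "times_differentiable n (deriv f)" by (intro Suc.IH) blast
    moreover have "(f has_real_derivative deriv f x) (at x)" for x
      using Suc.prems[rule_format, of 0 x] by (simp add: DERIV_deriv_iff_field_differentiable)
    ultimately show ?case by auto
  qed simp
qed (auto intro: times_differentiable_Suc_imp)

lemma times_differentiable_Suc_D: "times_differentiable (Suc n) f \<Longrightarrow> times_differentiable n f"
  by (induction n arbitrary: f) (force, metis times_differentiable.simps(2))

lemma times_differentiable_add: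
  "times_differentiable n f \<Longrightarrow> times_differentiable n g \<Longrightarrow> times_differentiable n (\<lambda>x. f x + g x)"
proof (induction n arbitrary: f g)
  case (Suc n)
  then obtain f' g' where "\<And>x. (f has_real_derivative f' x) (at x)" "times_differentiable n f'"
    "\<And>x. (g has_real_derivative g' x) (at x)" "times_differentiable n g'" by auto
  then show ?case using Suc.IH[of f' g']
    by (auto intro!: exI[of _ "\<lambda>x. f' x + g' x"] derivative_eq_intros)
qed simp

lemma times_differentiable_mult:
  "times_differentiable n f \<Longrightarrow> times_differentiable n g \<Longrightarrow> times_differentiable n (\<lambda>x. f x * g x)"
proof (induction n arbitrary: f g)
  case (Suc n)
  then obtain f' g' where d: "\<And>x. (f has_real_derivative f' x) (at x)" "times_differentiable n f'"
    "\<And>x. (g has_real_derivative g' x) (at x)" "times_differentiable n g'" by auto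
  have "times_differentiable n (\<lambda>x. f' x * g x + f x * g' x)"
    using d Suc.prems[THEN times_differentiable_Suc_D] by (intro times_differentiable_add Suc.IH)
  moreover have "((\<lambda>x. f x * g x) has_real_derivative f' x * g x + f x * g' x) (at x)" for x
    using d(1,3) by (auto intro!: derivative_eq_intros)
  ultimately show ?case unfolding times_differentiable.simps
    by (intro exI[of _ "\<lambda>x. f' x * g x + f x * g' x"]) simp
qed simp

lemma times_differentiable_const: "times_differentiable n (\<lambda>x. c)"
  by (induction n arbitrary: c) (auto intro!: exI[of _ "\<lambda>x. 0"])

lemma times_differentiable_affine:
  "times_differentiable n f \<Longrightarrow> times_differentiable n (\<lambda>x. f (c * x + d))"
proof (induction n arbitrary: f)
  case (Suc n)
  then obtain f' where d: "\<And>x. (f has_real_derivative f' x) (at x)" "times_differentiable n f'" by auto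
  have "times_differentiable n (\<lambda>x. c * f' (c * x + d))"
    by (rule times_differentiable_mult[OF times_differentiable_const Suc.IH[OF d(2)]])
  moreover have "((\<lambda>x. f (c * x + d)) has_real_derivative c * f' (c * x + d)) (at x)" for x
    by (rule DERIV_chain2[OF d(1), of "\<lambda>x. c * x + d" c, simplified mult.commute[of _ c]])
       (auto intro!: derivative_eq_intros)
  ultimately show ?case unfolding times_differentiable.simps
    by (intro exI[of _ "\<lambda>x. c * f' (c * x + d)"]) simp
qed simp

text \<open>
  The function \<open>p (1 / x) exp (- 1 / x)\<close>, extended by \<open>0\<close>. The family over all polynomials \<open>p\<close> is closed under
  differentiation, so its members, in particular \<open>exp (- 1 / x)\<close>, are smooth.
\<close>
definition flat_at_zero :: "real poly \<Rightarrow> real \<Rightarrow> real" where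
  "flat_at_zero p x = (if 0 < x then poly p (1 / x) * exp (- (1 / x)) else 0)"

lemma poly_mult_exp_uminus_tendsto_0:
  "((\<lambda>y. poly p y * exp (- y)) \<longlongrightarrow> (0::real)) at_top"
proof -
  have "((\<lambda>y. \<Sum>i\<le>degree p. coeff p i * (y ^ i / exp y)) \<longlongrightarrow> (\<Sum>i\<le>degree p. coeff p i * 0)) at_top"
    by (intro tendsto_intros tendsto_power_div_exp_0)
  moreover have "(\<lambda>y. \<Sum>i\<le>degree p. coeff p i * (y ^ i / exp y)) = (\<lambda>y. poly p y * exp (- y))"
    by (auto simp: poly_altdef sum_divide_distrib exp_minus field_simps)
  ultimately show ?thesis by simp
qed

lemma flat_at_zero_deriv:
  "(flat_at_zero p has_real_derivative flat_at_zero ([:0, 0, 1:] * (p - pderiv p)) x) (at x)"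
proof -
  consider "x > 0" | "x < 0" | "x = 0" by linarith
  then show ?thesis
  proof cases
    case 1
    have "((\<lambda>x. poly p (1 / x) * exp (- (1 / x))) has_real_derivative
        flat_at_zero ([:0, 0, 1:] * (p - pderiv p)) x) (at x)"
      using 1 by (auto intro!: derivative_eq_intros simp: flat_at_zero_def field_simps power2_eq_square)
    then show ?thesis
      by (rule has_field_derivative_transform_within_open[OF _ open_greaterThan[of 0]])
         (use 1 in \<open>auto simp: flat_at_zero_def\<close>)
  next
    case 2
    have "((\<lambda>x. 0) has_real_derivative flat_at_zero ([:0, 0, 1:] * (p - pderiv p)) x) (at x)"
      using 2 by (auto simp: flat_at_zero_def)
    then show ?thesis
      by (rule has_field_derivative_transform_within_open[OF _ open_lessThan[of 0]])
         (use 2 in \<open>auto simp: flat_at_zero_def\<close>)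
  next
    case 3
    have "((\<lambda>y. (flat_at_zero p y - flat_at_zero p 0) / (y - 0)) \<longlongrightarrow> 0) (at 0)"
    proof (rule filterlim_split_at)
      show "((\<lambda>y. (flat_at_zero p y - flat_at_zero p 0) / (y - 0)) \<longlongrightarrow> 0) (at_left 0)"
        by (rule tendsto_eventually) (auto simp: flat_at_zero_def eventually_at_filter)
      have "((\<lambda>y. poly (pCons 0 p) (inverse y) * exp (- inverse y)) \<longlongrightarrow> 0) (at_right (0::real))"
        by (rule filterlim_compose[OF poly_mult_exp_uminus_tendsto_0 filterlim_inverse_at_top_right])
      then show "((\<lambda>y. (flat_at_zero p y - flat_at_zero p 0) / (y - 0)) \<longlongrightarrow> 0) (at_right 0)"
        by (rule Lim_transform_eventually)
           (auto simp: flat_at_zero_def eventually_at_filter field_simps inverse_eq_divide)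
    qed
    then show ?thesis using 3 by (simp add: DERIV_def flat_at_zero_def has_field_derivative_iff)
  qed
qed

lemma times_differentiable_flat_at_zero: "times_differentiable n (flat_at_zero p)"
  by (induction n arbitrary: p) (use flat_at_zero_deriv in auto)

lemma test_function_iff:
  "test_function \<phi> \<longleftrightarrow> (\<forall>n. times_differentiable n \<phi>) \<and> (\<exists>R. \<forall>x. \<phi> x \<noteq> 0 \<longrightarrow> \<bar>x\<bar> \<le> R)"
proof -
  have "compact (closure {x. \<phi> x \<noteq> 0}) \<longleftrightarrow> (\<exists>R. \<forall>x. \<phi> x \<noteq> 0 \<longrightarrow> \<bar>x\<bar> \<le> R)"
    by (simp add: compact_closure bounded_iff)
  then show ?thesis unfolding test_function_def smooth_iff_times_differentiable by simp
qed

lemma test_function_DERIV: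
  assumes "test_function \<phi>"
  shows "(\<phi> has_real_derivative deriv \<phi> x) (at x)" "test_function (deriv \<phi>)"
proof -
  have sm: "\<And>n. times_differentiable n \<phi>" using assms by (simp add: test_function_iff)
  obtain R where R: "\<And>x. \<phi> x \<noteq> 0 \<Longrightarrow> \<bar>x\<bar> \<le> R" using assms unfolding test_function_iff by blast
  have d: "(\<phi> has_real_derivative deriv \<phi> x) (at x)" for x
    using times_differentiable_Suc_imp[of 0 \<phi> x] sm by (simp add: DERIV_deriv_iff_field_differentiable)
  show "(\<phi> has_real_derivative deriv \<phi> x) (at x)" by (rule d)
  have "deriv \<phi> x = 0" if "R < \<bar>x\<bar>" for x
  proof (rule DERIV_unique[OF d[of x]])
    have "open {x. R < \<bar>x\<bar>}" by (intro open_Collect_less continuous_intros)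
    then show "(\<phi> has_real_derivative 0) (at x)"
      by (rule has_field_derivative_transform_within_open[OF DERIV_const[of 0]])
         (use that R in force)+
  qed
  then have "\<And>x. deriv \<phi> x \<noteq> 0 \<Longrightarrow> \<bar>x\<bar> \<le> R" by force
  moreover have "times_differentiable n (deriv \<phi>)" for n
  proof -
    obtain f' where f': "\<And>x. (\<phi> has_real_derivative f' x) (at x)" "times_differentiable n f'"
      using sm[of "Suc n"] by auto
    then have "deriv \<phi> = f'" by (auto intro: DERIV_imp_deriv)
    then show ?thesis using f' by simp
  qed
  ultimately show "test_function (deriv \<phi>)" unfolding test_function_iff by blast
qed

lemma test_function_continuous: "test_function \<phi> \<Longrightarrow> continuous_on A \<phi>"
  using test_function_DERIV(1) by (meson DERIV_isCont continuous_at_imp_continuous_on)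

lemma L2_continuous_compact_support:
  fixes g :: "real \<Rightarrow> complex"
  assumes "continuous_on UNIV g" "\<And>x. g x \<noteq> 0 \<Longrightarrow> \<bar>x\<bar> \<le> R"
  shows "g \<in> L2"
proof (rule L2_I)
  show "g \<in> borel_measurable borel" using assms(1) by (rule borel_measurable_continuous_onI)
  have "continuous_on {-R..R} (\<lambda>x. (cmod (g x))\<^sup>2)"
    by (intro continuous_intros continuous_on_subset[OF assms(1)]) auto
  then have "integrable lborel (\<lambda>x. indicator {-R..R} x *\<^sub>R (cmod (g x))\<^sup>2)"
    by (rule borel_integrable_compact[rotated]) simp
  moreover have "(\<lambda>x. indicator {-R..R} x *\<^sub>R (cmod (g x))\<^sup>2) = (\<lambda>x. (cmod (g x))\<^sup>2)"
    using assms(2) by (fastforce simp: indicator_def abs_le_iff)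
  ultimately show "integrable lborel (\<lambda>x. (cmod (g x))\<^sup>2)" by simp
qed

lemma test_function_L2: "test_function \<phi> \<Longrightarrow> (\<lambda>x. of_real (\<phi> x)) \<in> L2"
  using test_function_continuous[of \<phi> UNIV]
  by (auto simp: test_function_iff intro!: L2_continuous_compact_support continuous_intros)

text \<open>
  Inside \<open>(a, b)\<close> this is the root of order \<open>n + 1\<close> of \<open>exp (- 1 / (x - a) - 1 / (b - x))\<close>, which tends to \<open>1\<close>:
  the indicator function of the interval is a bounded pointwise limit of test functions.
\<close>
definition bump :: "real \<Rightarrow> real \<Rightarrow> nat \<Rightarrow> real \<Rightarrow> real" where
  "bump a b n x = flat_at_zero 1 (real (Suc n) * (x - a)) * flat_at_zero 1 (real (Suc n) * (b - x))"

lemma test_function_bump: "test_function (bump a b n)"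
proof -
  have "times_differentiable k (\<lambda>x. flat_at_zero 1 (real (Suc n) * x + - real (Suc n) * a) *
     flat_at_zero 1 (- real (Suc n) * x + real (Suc n) * b))" for k
    by (rule times_differentiable_mult; rule times_differentiable_affine; rule times_differentiable_flat_at_zero)
  then have "times_differentiable k (bump a b n)" for k
    unfolding bump_def[abs_def] by (simp add: algebra_simps)
  moreover have "\<bar>x\<bar> \<le> \<bar>a\<bar> + \<bar>b\<bar>" if "bump a b n x \<noteq> 0" for x
    using that by (auto simp: bump_def flat_at_zero_def zero_less_mult_iff split: if_splits)
  ultimately show ?thesis unfolding test_function_iff by blast
qed

lemma bump_bounds: "0 \<le> bump a b n x" "bump a b n x \<le> indicator {a<..<b} x"
proof -
  have f: "0 \<le> flat_at_zero 1 y" "flat_at_zero 1 y \<le> 1" for y by (auto simp: flat_at_zero_def)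
  show "0 \<le> bump a b n x" using f by (simp add: bump_def)
  have "bump a b n x = 0" if "x \<notin> {a<..<b}"
    using that by (auto simp: bump_def flat_at_zero_def zero_less_mult_iff not_less)
  then show "bump a b n x \<le> indicator {a<..<b} x"
    using f by (auto simp: indicator_def bump_def intro!: mult_le_one)
qed

lemma bump_tendsto_indicator: "(\<lambda>n. bump a b n x) \<longlonglongrightarrow> indicator {a<..<b} x"
proof (cases "x \<in> {a<..<b}")
  case False
  then have "bump a b n x = 0" for n
    using bump_bounds[of a b n x] by simp
  then show ?thesis using False by simp
next
  case True
  have lim: "(\<lambda>n. flat_at_zero 1 (real (Suc n) * c)) \<longlonglongrightarrow> 1" if "c > 0" for c
  proof -
    have "(\<lambda>n. exp (- (inverse (real (Suc n)) * (1 / c)))) \<longlonglongrightarrow> exp (- (0 * (1 / c)))"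
      by (intro tendsto_intros LIMSEQ_inverse_real_of_nat)
    moreover have "exp (- (inverse (real (Suc n)) * (1 / c))) = flat_at_zero 1 (real (Suc n) * c)" for n
      using that by (simp add: flat_at_zero_def inverse_eq_divide del: of_nat_Suc)
    ultimately show ?thesis by simp
  qed
  have "(\<lambda>n. bump a b n x) \<longlonglongrightarrow> 1 * 1"
    unfolding bump_def using True by (intro tendsto_mult lim) auto
  then show ?thesis using True by simp
qed

text \<open>
  The open intervals form a generator of the Borel sets that is stable under intersections, so the
  integrals over all Borel sets vanish.
\<close>
lemma AE_zero_of_interval_integrals:
  fixes f :: "real \<Rightarrow> complex"
  assumes int: "integrable lborel f" and supp: "\<And>x. f x \<noteq> 0 \<Longrightarrow> \<bar>x\<bar> < R"
    and zero: "\<And>a b. (LINT x|lborel. indicator {a<..<b} x *\<^sub>R f x) = 0"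
  shows "AE x in lborel. f x = 0"
proof (rule sigma_finite_measure.density_zero[OF sigma_finite_lborel int])
  have gen: "sigma_sets UNIV (range (\<lambda>(a, b). {a<..<b::real})) = sets lborel"
    unfolding sets_lborel by (subst borel_eq_box) (simp add: box_real case_prod_unfold)
  fix A :: "real set" assume "A \<in> sets lborel"
  then have mem: "A \<in> sigma_sets UNIV (range (\<lambda>(a, b). {a<..<b::real}))" by (simp only: gen)
  have stable: "Int_stable (range (\<lambda>(a, b). {a<..<b::real}))"
  proof (rule Int_stableI)
    fix A B assume "A \<in> range (\<lambda>(a, b). {a<..<b::real})" "B \<in> range (\<lambda>(a, b). {a<..<b::real})"
    then obtain a b c d where "A = {a<..<b}" "B = {c<..<d}" by auto
    then have "A \<inter> B = (\<lambda>(a, b). {a<..<b}) (max a c, min b d)" by auto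
    then show "A \<inter> B \<in> range (\<lambda>(a, b). {a<..<b::real})" by blast
  qed
  have sub: "range (\<lambda>(a, b). {a<..<b::real}) \<subseteq> Pow UNIV" by simp
  show "set_lebesgue_integral lborel A f = 0"
    using stable sub mem
  proof (induction rule: sigma_sets_induct_disjoint)
    case (basic A)
    then show ?case using zero by (auto simp: set_lebesgue_integral_def)
  next
    case empty
    then show ?case by (simp add: set_lebesgue_integral_def)
  next
    case (compl A)
    then have A: "A \<in> sets lborel" by (simp only: gen)
    have "integral\<^sup>L lborel f = (LINT x|lborel. indicator {-R<..<R} x *\<^sub>R f x)"
      by (rule Bochner_Integration.integral_cong) (use supp in \<open>force simp: indicator_def abs_less_iff\<close>)+
    also have "\<dots> = 0" by (rule zero)
    finally have "integral\<^sup>L lborel f = 0" .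
    moreover have "set_lebesgue_integral lborel (UNIV - A) f
      = (LINT x|lborel. f x - indicator A x *\<^sub>R f x)"
      unfolding set_lebesgue_integral_def by (rule Bochner_Integration.integral_cong) (auto simp: indicator_def)
    moreover have "\<dots> = integral\<^sup>L lborel f - (LINT x|lborel. indicator A x *\<^sub>R f x)"
      using int A by (intro Bochner_Integration.integral_diff integrable_mult_indicator)
    ultimately show ?case using compl by (simp add: set_lebesgue_integral_def)
  next
    case (union A)
    then have A: "\<And>i. A i \<in> sets lborel" by (simp only: gen) blast
    have "set_integrable lborel (\<Union>(range A)) f"
      unfolding set_integrable_def using int A by (intro integrable_mult_indicator) auto
    then have "set_lebesgue_integral lborel (\<Union>(range A)) f = (\<Sum>i. set_lebesgue_integral lborel (A i) f)"
      using A union by (intro lebesgue_integral_countable_add) (auto simp: disjoint_family_on_def)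
    then show ?case using union by simp
  qed
qed

text \<open>
  By dominated convergence along bumps, the integral over every interval vanishes. Local integrability
  is assumed instead of square integrability because \<open>f\<close> will involve \<open>V\<^sup>1\<^sup>/\<^sup>2 u\<close>, which is not known to be in
  \<open>L2\<close> when the lemma is applied.
\<close>
lemma fundamental_lemma:
  fixes f :: "real \<Rightarrow> complex"
  assumes [measurable]: "f \<in> borel_measurable borel"
    and int: "\<And>R. integrable lborel (\<lambda>x. indicator {-R..R} x *\<^sub>R f x)"
    and test: "\<And>\<phi>. test_function \<phi> \<Longrightarrow> (LINT x|lborel. f x * of_real (\<phi> x)) = 0"
  shows "AE x in lborel. f x = 0"
proof -
  have zero: "(LINT x|lborel. indicator {a<..<b} x *\<^sub>R f x) = 0" for a b
  proof -
    define R where "R = \<bar>a\<bar> + \<bar>b\<bar>"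
    have [measurable]: "bump a b n \<in> borel_measurable borel" for n
      using test_function_continuous[OF test_function_bump] by (intro borel_measurable_continuous_onI)
    have "(\<lambda>n. LINT x|lborel. f x * of_real (bump a b n x))
        \<longlonglongrightarrow> (LINT x|lborel. f x * of_real (indicator {a<..<b} x))"
    proof (rule integral_dominated_convergence[where w = "\<lambda>x. norm (indicator {-R..R} x *\<^sub>R f x)"])
      show "AE x in lborel. (\<lambda>n. f x * of_real (bump a b n x)) \<longlonglongrightarrow> f x * of_real (indicator {a<..<b} x)"
        by (intro AE_I2 tendsto_intros bump_tendsto_indicator)
      fix n
      have "norm (f x * of_real (bump a b n x)) \<le> norm (indicator {-R..R} x *\<^sub>R f x)" for x
      proof -
        have "bump a b n x \<le> indicator {-R..R} x"
          using bump_bounds(2)[of a b n x] by (rule order_trans) (auto simp: indicator_def R_def)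
        then show ?thesis using bump_bounds(1)[of a b n x] mult_right_mono[of "bump a b n x" "indicator {-R..R} x" "norm (f x)"]
          by (simp add: norm_mult mult.commute)
      qed
      then show "AE x in lborel. norm (f x * of_real (bump a b n x)) \<le> norm (indicator {-R..R} x *\<^sub>R f x)" by simp
    qed (use integrable_norm[OF int] in \<open>auto simp del: norm_scaleR\<close>)
    then have "(LINT x|lborel. f x * of_real (indicator {a<..<b} x)) = 0"
      by (simp add: test[OF test_function_bump] LIMSEQ_const_iff)
    moreover have "(\<lambda>x. f x * of_real (indicator {a<..<b} x)) = (\<lambda>x. indicator {a<..<b} x *\<^sub>R f x)"
      by (auto simp: scaleR_conv_of_real mult.commute)
    ultimately show ?thesis by simp
  qed
  have "AE x in lborel. indicator {-real N..real N} x *\<^sub>R f x = 0" for N :: nat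
  proof (rule AE_zero_of_interval_integrals[where R = "real N + 1"])
    show "integrable lborel (\<lambda>x. indicator {- real N..real N} x *\<^sub>R f x)" by (rule int)
    show "\<bar>x\<bar> < real N + 1" if "indicator {- real N..real N} x *\<^sub>R f x \<noteq> 0" for x
      using that by (auto simp: indicator_def abs_le_iff split: if_splits)
    fix a b :: real
    have "(LINT x|lborel. indicator {a<..<b} x *\<^sub>R indicator {- real N..real N} x *\<^sub>R f x)
        = (LINT x|lborel. indicator {max a (- real N)<..<min b (real N)} x *\<^sub>R f x)"
    proof (rule integral_cong_AE)
      have "AE x in lborel. x \<noteq> real N \<and> x \<noteq> - real N"
        using AE_lborel_singleton[of "real N"] AE_lborel_singleton[of "- real N"] by eventually_elim simp
      then show "AE x in lborel. indicator {a<..<b} x *\<^sub>R indicator {- real N..real N} x *\<^sub>R f x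
          = indicator {max a (- real N)<..<min b (real N)} x *\<^sub>R f x"
        by eventually_elim (auto simp: indicator_def)
    qed auto
    then show "(LINT x|lborel. indicator {a<..<b} x *\<^sub>R indicator {- real N..real N} x *\<^sub>R f x) = 0"
      by (simp add: zero)
  qed
  then have "AE x in lborel. \<forall>N::nat. indicator {-real N..real N} x *\<^sub>R f x = 0"
    by (subst AE_all_countable) blast
  then show ?thesis
  proof eventually_elim
    fix x assume *: "\<forall>N::nat. indicator {-real N..real N} x *\<^sub>R f x = 0"
    obtain N :: nat where "\<bar>x\<bar> \<le> real N" using real_arch_simple by blast
    then show "f x = 0" using *[rule_format, of N] by (simp add: indicator_def abs_le_iff split: if_splits)
  qed
qed

lemma L2_locally_integrable:
  assumes "u \<in> L2"
  shows "integrable lborel (\<lambda>x. indicator {-R..R} x *\<^sub>R u x)"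
  using L2_mult_integrable(1)[OF L2_indicator assms, of "-R" R] by (simp add: scaleR_conv_of_real)

lemma fundamental_lemma_L2:
  assumes "u \<in> L2" "v \<in> L2"
    and "\<And>\<phi>. test_function \<phi> \<Longrightarrow> (LINT x|lborel. u x * of_real (\<phi> x)) = (LINT x|lborel. v x * of_real (\<phi> x))"
  shows "AE x in lborel. u x = v x"
proof -
  have d: "(\<lambda>x. u x - v x) \<in> L2" using assms by (simp add: L2_diff)
  have "AE x in lborel. u x - v x = 0"
  proof (rule fundamental_lemma[OF L2_measurable[OF d] L2_locally_integrable[OF d]])
    fix \<phi> assume \<phi>: "test_function \<phi>"
    show "(LINT x|lborel. (u x - v x) * of_real (\<phi> x)) = 0"
      using assms \<phi> by (simp add: left_diff_distrib L2_mult_integrable(1) test_function_L2)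
  qed
  then show ?thesis by simp
qed

lemma has_weak_deriv_unique:
  assumes "w \<in> L2" "w' \<in> L2" "has_weak_deriv u w" "has_weak_deriv u w'"
  shows "AE x in lborel. w x = w' x"
  using assms unfolding has_weak_deriv_def
  by (intro fundamental_lemma_L2) (auto simp: minus_equation_iff[of _ "integral\<^sup>L _ _"])

lemma weak_deriv:
  assumes "u \<in> H1"
  shows "weak_deriv u \<in> L2" "has_weak_deriv u (weak_deriv u)"
proof -
  have "\<exists>w. w \<in> L2 \<and> has_weak_deriv u w" using assms by (auto simp: H1_def)
  from someI_ex[OF this] show "weak_deriv u \<in> L2" "has_weak_deriv u (weak_deriv u)"
    unfolding weak_deriv_def by auto
qed

section \<open>The form domain, the operator and its resolvent\<close>

lemma bounded_linear_cinner_left: "bounded_linear (\<lambda>x. cinner x y)"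
  by (rule bounded_linear_intro[where K = "norm y"])
     (auto simp: cinner_add_left cinner_scaleR_left scaleR_conv_of_real norm_cinner_le)

lemma continuous_on_cinner_left:
  "continuous_on A f \<Longrightarrow> continuous_on A (\<lambda>x. cinner (f x) y)"
  by (rule bounded_linear.continuous_on[OF bounded_linear_cinner_left])

definition test_l2 :: "(real \<Rightarrow> real) \<Rightarrow> l2" where
  "test_l2 \<phi> = to_l2 (\<lambda>x. of_real (\<phi> x))"

lemma cinner_real_to_l2:
  assumes "u \<in> L2" "(\<lambda>x. of_real (\<psi> x)) \<in> L2"
  shows "cinner (to_l2 u) (test_l2 \<psi>) = (LINT x|lborel. u x * of_real (\<psi> x))"
  using assms by (simp add: test_l2_def cinner_to_l2 L2_inner_def)

lemma has_weak_deriv_iff: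
  assumes "u \<in> L2" "w \<in> L2"
  shows "has_weak_deriv u w \<longleftrightarrow>
    (\<forall>\<phi>. test_function \<phi> \<longrightarrow> cinner (to_l2 u) (test_l2 (deriv \<phi>)) = - cinner (to_l2 w) (test_l2 \<phi>))"
  unfolding has_weak_deriv_def
  using assms by (auto simp: cinner_real_to_l2 test_function_L2 test_function_DERIV(2))

lemma L2_AE_cong:
  assumes "v \<in> L2" "u \<in> borel_measurable borel" "AE x in lborel. u x = v x"
  shows "u \<in> L2"
proof (rule L2_I)
  show "integrable lborel (\<lambda>x. (cmod (u x))\<^sup>2)"
    using L2_square_integrable[OF assms(1)]
    by (rule integrable_cong_AE_imp) (use assms in \<open>auto elim: eventually_mono\<close>)
qed fact

locale schroedinger_potential =
  fixes V :: "real \<Rightarrow> real"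
  assumes V_cont: "continuous_on UNIV V" and V_nonneg: "0 \<le> V x"
begin

abbreviation "form_dom \<equiv> schroedinger_form_domain V"

lemma V_measurable [measurable]: "V \<in> borel_measurable borel"
  using V_cont by (rule borel_measurable_continuous_onI)

lemma domD:
  assumes "u \<in> form_dom"
  shows "u \<in> L2" "weak_deriv u \<in> L2" "has_weak_deriv u (weak_deriv u)" "sqrt_mult V u \<in> L2"
  using assms weak_deriv by (auto simp: schroedinger_form_domain_def H1_def)

text \<open>
  The set of all triples \<open>(u, u', V\<^sup>1\<^sup>/\<^sup>2 u)\<close> with \<open>u\<close> in the form domain (\<open>form_graph_dom\<close>,
  \<open>form_graph_imp_dom\<close>), so that the form norm becomes the norm of a product Hilbert space. Both defining
  properties are tested against test functions, hence continuous in the triple, and the set is closed: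
  this is the completeness of the form domain.
\<close>
definition form_graph :: "(l2 \<times> l2 \<times> l2) set" where
  "form_graph = {(a, b, c).
     (\<forall>\<phi>. test_function \<phi> \<longrightarrow> cinner a (test_l2 (deriv \<phi>)) = - cinner b (test_l2 \<phi>)) \<and>
     (\<forall>\<phi>. test_function \<phi> \<longrightarrow> cinner c (test_l2 \<phi>) = cinner a (test_l2 (\<lambda>x. sqrt (V x) * \<phi> x)))}"

lemma sqrt_V_test_L2:
  assumes "test_function \<phi>"
  shows "(\<lambda>x. of_real (sqrt (V x) * \<phi> x)) \<in> L2"
proof -
  obtain R where R: "\<And>x. \<phi> x \<noteq> 0 \<Longrightarrow> \<bar>x\<bar> \<le> R" using assms unfolding test_function_iff by blast
  show ?thesis
    by (rule L2_continuous_compact_support[where R = R])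
       (use R in \<open>auto intro!: continuous_intros V_cont test_function_continuous[OF assms]\<close>)
qed

lemma form_graph_I:
  assumes d: "u \<in> L2" "w \<in> L2" "has_weak_deriv u w" "sqrt_mult V u \<in> L2"
  shows "(to_l2 u, to_l2 w, to_l2 (sqrt_mult V u)) \<in> form_graph"
proof -
  have "cinner (to_l2 (sqrt_mult V u)) (test_l2 \<phi>) = cinner (to_l2 u) (test_l2 (\<lambda>x. sqrt (V x) * \<phi> x))"
    if "test_function \<phi>" for \<phi>
    using d that sqrt_V_test_L2[OF that]
    by (simp only: cinner_real_to_l2 test_function_L2) (simp add: sqrt_mult_def mult_ac)
  then show ?thesis using d has_weak_deriv_iff[OF d(1,2)] by (simp add: form_graph_def)
qed

lemma form_graph_dom:
  assumes "u \<in> form_dom"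
  shows "(to_l2 u, to_l2 (weak_deriv u), to_l2 (sqrt_mult V u)) \<in> form_graph"
  using domD[OF assms] by (rule form_graph_I)

text \<open>
  The uniqueness of weak derivatives identifies \<open>b\<close>, and \<open>fundamental_lemma\<close> identifies \<open>c\<close> with \<open>V\<^sup>1\<^sup>/\<^sup>2 u\<close>.
\<close>
lemma form_graph_imp_dom:
  assumes u: "u \<in> L2" and g: "(to_l2 u, b, c) \<in> form_graph"
  shows "u \<in> form_dom" "b = to_l2 (weak_deriv u)" "c = to_l2 (sqrt_mult V u)"
proof -
  have um [measurable]: "u \<in> borel_measurable borel" "fn c \<in> borel_measurable borel"
    using L2_measurable[OF u] L2_measurable[OF fn_L2] by auto
  have wd: "has_weak_deriv u (fn b)"
    using g by (simp add: form_graph_def has_weak_deriv_iff[OF u fn_L2])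
  then have H1: "u \<in> H1" using u fn_L2 by (auto simp: H1_def)
  have "AE x in lborel. fn b x = weak_deriv u x"
    using has_weak_deriv_unique[OF fn_L2 weak_deriv(1)[OF H1] wd weak_deriv(2)[OF H1]] .
  then show b: "b = to_l2 (weak_deriv u)"
    using to_l2_eq_iff[OF fn_L2 weak_deriv(1)[OF H1], of b] by simp
  have sm [measurable]: "sqrt_mult V u \<in> borel_measurable borel"
    unfolding sqrt_mult_def by measurable
  have sloc: "integrable lborel (\<lambda>x. sqrt_mult V u x * (indicator {-R..R} x))" for R
  proof -
    have "(\<lambda>x. of_real (sqrt (V x)) * indicator {-R..R} x) \<in> L2"
    proof (rule L2_I)
      have "continuous_on {-R..R} V" by (rule continuous_on_subset[OF V_cont]) simp
      then have "integrable lborel (\<lambda>x. indicator {-R..R} x *\<^sub>R V x)"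
        by (rule borel_integrable_compact[rotated]) simp
      moreover have "(\<lambda>x. indicator {-R..R} x *\<^sub>R V x) = (\<lambda>x. (cmod (of_real (sqrt (V x)) * indicator {-R..R} x))\<^sup>2)"
        using V_nonneg by (auto simp: indicator_def norm_mult)
      ultimately show "integrable lborel (\<lambda>x. (cmod (of_real (sqrt (V x)) * indicator {-R..R} x))\<^sup>2)" by simp
    qed measurable
    from L2_mult_integrable(1)[OF this u] show ?thesis by (simp add: sqrt_mult_def mult_ac)
  qed
  have "AE x in lborel. sqrt_mult V u x - fn c x = 0"
  proof (rule fundamental_lemma)
    fix R
    show "integrable lborel (\<lambda>x. indicator {-R..R} x *\<^sub>R (sqrt_mult V u x - fn c x))"
    proof -
      have "integrable lborel (\<lambda>x. sqrt_mult V u x * (indicator {-R..R} x) - indicator {-R..R} x *\<^sub>R fn c x)"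
        by (intro Bochner_Integration.integrable_diff sloc L2_locally_integrable fn_L2)
      moreover have "(\<lambda>x. sqrt_mult V u x * (indicator {-R..R} x) - indicator {-R..R} x *\<^sub>R fn c x)
        = (\<lambda>x. indicator {-R..R} x *\<^sub>R (sqrt_mult V u x - fn c x))"
        by (auto simp: indicator_def)
      ultimately show ?thesis by simp
    qed
  next
    fix \<phi> assume \<phi>: "test_function \<phi>"
    have "(LINT x|lborel. u x * of_real (sqrt (V x) * \<phi> x)) = (LINT x|lborel. fn c x * of_real (\<phi> x))"
      using g \<phi> cinner_real_to_l2[OF u sqrt_V_test_L2[OF \<phi>]] cinner_real_to_l2[OF fn_L2 test_function_L2[OF \<phi>], of c]
      by (simp add: form_graph_def)
    moreover have "integrable lborel (\<lambda>x. u x * of_real (sqrt (V x) * \<phi> x))" "integrable lborel (\<lambda>x. fn c x * of_real (\<phi> x))"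
      using L2_mult_integrable(1)[OF u sqrt_V_test_L2[OF \<phi>]]
        L2_mult_integrable(1)[OF fn_L2 test_function_L2[OF \<phi>]] by auto
    ultimately have "(LINT x|lborel. u x * of_real (sqrt (V x) * \<phi> x) - fn c x * of_real (\<phi> x)) = 0" by simp
    then show "(LINT x|lborel. (sqrt_mult V u x - fn c x) * of_real (\<phi> x)) = 0"
      by (simp add: sqrt_mult_def algebra_simps)
  qed measurable
  then have ae: "AE x in lborel. sqrt_mult V u x = fn c x" by simp
  have s: "sqrt_mult V u \<in> L2" by (rule L2_AE_cong[OF fn_L2 sm ae])
  show "u \<in> form_dom" using H1 s by (simp add: schroedinger_form_domain_def)
  show "c = to_l2 (sqrt_mult V u)" using to_l2_eq_iff[OF s fn_L2, of c] ae by simp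
qed

lemma closed_form_graph: "closed form_graph"
proof -
  have "form_graph = {p.
     (\<forall>\<phi>. test_function \<phi> \<longrightarrow> cinner (fst p) (test_l2 (deriv \<phi>)) = - cinner (fst (snd p)) (test_l2 \<phi>)) \<and>
     (\<forall>\<phi>. test_function \<phi> \<longrightarrow> cinner (snd (snd p)) (test_l2 \<phi>) = cinner (fst p) (test_l2 (\<lambda>x. sqrt (V x) * \<phi> x)))}"
    by (auto simp: form_graph_def)
  also have "closed \<dots>"
    by (intro closed_Collect_conj closed_Collect_all closed_Collect_imp open_Collect_const closed_Collect_eq
        continuous_intros continuous_on_cinner_left)
  finally show ?thesis .
qed

lemma subspace_form_graph: "subspace form_graph"
  unfolding subspace_def form_graph_def
  by (auto simp: zero_prod_def cinner_add_left cinner_scaleR_left)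

lemma cscale_form_graph:
  "(a, b, c) \<in> form_graph \<Longrightarrow> (cscale z a, cscale z b, cscale z c) \<in> form_graph"
  unfolding form_graph_def by (auto simp: cinner_cscale_left)

text \<open>
  The graph of the Schroedinger operator in terms of classes of functions (\<open>schroedinger_iff\<close>).
\<close>
definition operator_graph :: "real \<Rightarrow> (l2 \<times> l2) set" where
  "operator_graph h = {(a, f). \<exists>b c. (a, b, c) \<in> form_graph \<and>
     (\<forall>a' b' c'. (a', b', c') \<in> form_graph \<longrightarrow> of_real (h\<^sup>2) * cinner b b' + cinner c c' = cinner f a')}"

lemma schroedinger_form_eq:
  assumes "u \<in> form_dom" "v \<in> form_dom"
  shows "schroedinger_form h V u v = of_real (h\<^sup>2) * cinner (to_l2 (weak_deriv u)) (to_l2 (weak_deriv v))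
    + cinner (to_l2 (sqrt_mult V u)) (to_l2 (sqrt_mult V v))"
  using assms[THEN domD(2)] assms[THEN domD(4)] by (simp add: schroedinger_form_def cinner_to_l2)

lemma form_graph_cases:
  assumes "(a, b, c) \<in> form_graph"
  obtains u where "u \<in> form_dom" "a = to_l2 u" "b = to_l2 (weak_deriv u)" "c = to_l2 (sqrt_mult V u)"
  using form_graph_imp_dom[of "fn a" b c] assms by simp

lemma schroedinger_iff:
  assumes "u \<in> L2" "f \<in> L2"
  shows "(u, f) \<in> schroedinger h V \<longleftrightarrow> (to_l2 u, to_l2 f) \<in> operator_graph h"
proof
  assume s: "(u, f) \<in> schroedinger h V"
  then have u: "u \<in> form_dom" by (simp add: schroedinger_def)
  have "of_real (h\<^sup>2) * cinner (to_l2 (weak_deriv u)) b' + cinner (to_l2 (sqrt_mult V u)) c' = cinner (to_l2 f) a'"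
    if "(a', b', c') \<in> form_graph" for a' b' c'
  proof -
    from form_graph_cases[OF that] obtain v where
      v: "v \<in> form_dom" "a' = to_l2 v" "b' = to_l2 (weak_deriv v)" "c' = to_l2 (sqrt_mult V v)" by blast
    then show ?thesis
      using s schroedinger_form_eq[OF u v(1), of h] assms domD(1)[OF v(1)]
      by (simp add: schroedinger_def cinner_to_l2)
  qed
  then show "(to_l2 u, to_l2 f) \<in> operator_graph h"
    using form_graph_dom[OF u] unfolding operator_graph_def by blast
next
  assume "(to_l2 u, to_l2 f) \<in> operator_graph h"
  then obtain b c where bc: "(to_l2 u, b, c) \<in> form_graph"
    and eq: "\<And>a' b' c'. (a', b', c') \<in> form_graph \<Longrightarrow> of_real (h\<^sup>2) * cinner b b' + cinner c c' = cinner (to_l2 f) a'"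
    unfolding operator_graph_def by blast
  note u = form_graph_imp_dom[OF assms(1) bc]
  have "schroedinger_form h V u v = L2_inner f v" if v: "v \<in> form_dom" for v
    using eq[OF form_graph_dom[OF v]] schroedinger_form_eq[OF u(1) v, of h] u assms domD(1)[OF v]
    by (simp add: cinner_to_l2)
  then show "(u, f) \<in> schroedinger h V" using u(1) assms by (simp add: schroedinger_def)
qed

lemma schroedinger_L2: "(u, f) \<in> schroedinger h V \<Longrightarrow> u \<in> L2 \<and> f \<in> L2"
  using domD(1) by (auto simp: schroedinger_def)

lemma operator_graph_self:
  assumes "(a, f) \<in> operator_graph h"
  obtains b c where "(a, b, c) \<in> form_graph" "cinner f a = of_real (h\<^sup>2 * (norm b)\<^sup>2 + (norm c)\<^sup>2)"
proof -
  obtain b c where 1: "(a, b, c) \<in> form_graph"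
    "\<And>x y z. (x, y, z) \<in> form_graph \<Longrightarrow> of_real (h\<^sup>2) * cinner b y + cinner c z = cinner f x"
    using assms(1) unfolding operator_graph_def by blast
  from 1(2)[OF 1(1)] that[OF 1(1)] show ?thesis by (simp add: cinner_self)
qed

lemma operator_graph_symmetric:
  assumes "(a, f) \<in> operator_graph h" "(a', f') \<in> operator_graph h"
  shows "cinner f a' = cinner a f'"
proof -
  obtain b c where 1: "(a, b, c) \<in> form_graph"
    "\<And>x y z. (x, y, z) \<in> form_graph \<Longrightarrow> of_real (h\<^sup>2) * cinner b y + cinner c z = cinner f x"
    using assms(1) unfolding operator_graph_def by blast
  obtain b' c' where 2: "(a', b', c') \<in> form_graph"
    "\<And>x y z. (x, y, z) \<in> form_graph \<Longrightarrow> of_real (h\<^sup>2) * cinner b' y + cinner c' z = cinner f' x"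
    using assms(2) unfolding operator_graph_def by blast
  have "cinner f a' = of_real (h\<^sup>2) * cinner b b' + cinner c c'" using 1(2)[OF 2(1)] by simp
  also have "\<dots> = cnj (of_real (h\<^sup>2) * cinner b' b + cinner c' c)"
    by (simp flip: cinner_commute)
  also have "\<dots> = cnj (cinner f' a)" using 2(2)[OF 1(1)] by simp
  also have "\<dots> = cinner a f'" by (simp flip: cinner_commute)
  finally show ?thesis .
qed

end

locale bounded_below_form = schroedinger_potential +
  fixes h c0 :: real
  assumes h: "h \<noteq> 0" and c0: "0 \<le> c0"
    and form_ge: "(a, b, c) \<in> form_graph \<Longrightarrow> c0 * (norm a)\<^sup>2 \<le> h\<^sup>2 * (norm b)\<^sup>2 + (norm c)\<^sup>2"
begin

text \<open>
  Lax--Milgram for the real part of the form of \<open>T - z\<close>. Testing with \<open>v\<close> and with \<open>\<i> v\<close> turns the resulting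
  real equation into a complex one.
\<close>
lemma operator_surjective:
  assumes z: "Re z < c0"
  shows "\<exists>a. (a, g + cscale z a) \<in> operator_graph h"
proof -
  define B where "B p q = h\<^sup>2 * inner (fst (snd p)) (fst (snd q)) + inner (snd (snd p)) (snd (snd q))
      - inner (cscale z (fst p)) (fst q)" for p q :: "l2 \<times> l2 \<times> l2"
  have Bbil: "bounded_bilinear B"
  proof
    fix p p' q q' :: "l2 \<times> l2 \<times> l2" and r :: real
    show "B (p + p') q = B p q + B p' q" "B p (q + q') = B p q + B p q'"
      by (simp_all add: B_def inner_add_left inner_add_right cscale_add_right algebra_simps)
    show "B (r *\<^sub>R p) q = r *\<^sub>R B p q" "B p (r *\<^sub>R q) = r *\<^sub>R B p q"
      by (simp_all add: B_def cscale_scaleR algebra_simps)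
    show "\<exists>K. \<forall>p q. norm (B p q) \<le> norm p * norm q * K"
    proof (intro exI allI)
      fix p q :: "l2 \<times> l2 \<times> l2"
      have n: "norm (fst r) \<le> norm r" "norm (fst (snd r)) \<le> norm r" "norm (snd (snd r)) \<le> norm r"
        for r :: "l2 \<times> l2 \<times> l2"
        using norm_fst_le[of "fst r" "snd r"] norm_snd_le[of "snd r" "fst r"]
          norm_fst_le[of "fst (snd r)" "snd (snd r)"] norm_snd_le[of "snd (snd r)" "fst (snd r)"] by auto
      have i: "\<bar>inner x y\<bar> \<le> norm p * norm q" if "norm x \<le> norm p" "norm y \<le> norm q" for x y :: l2
        using Cauchy_Schwarz_ineq2[of x y] mult_mono[OF that] by simp
      have "\<bar>inner (cscale z (fst p)) (fst q)\<bar> \<le> norm (cscale z (fst p)) * norm (fst q)"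
        by (rule Cauchy_Schwarz_ineq2)
      also have "\<dots> \<le> cmod z * norm p * norm q"
        unfolding norm_cscale by (intro mult_mono n) auto
      finally have c: "\<bar>inner (cscale z (fst p)) (fst q)\<bar> \<le> norm p * norm q * cmod z" by (simp add: mult_ac)
      have "\<bar>h\<^sup>2 * inner (fst (snd p)) (fst (snd q))\<bar> \<le> h\<^sup>2 * (norm p * norm q)"
        using i[OF n(2) n(2)] by (simp add: abs_mult mult_left_mono)
      then show "norm (B p q) \<le> norm p * norm q * (h\<^sup>2 + 1 + cmod z)"
        using c i[OF n(3)[of p] n(3)[of q]] by (simp add: B_def algebra_simps)
    qed
  qed
  define x where "x = Re z"
  define d where "d = c0 - x"
  \<comment> \<open>The fraction \<open>\<theta>\<close> of the form controls \<open>b\<close> and \<open>c\<close>; the rest exceeds \<open>Re z \<parallel>a\<parallel>\<^sup>2\<close> by at least \<open>d / 2 \<parallel>a\<parallel>\<^sup>2\<close>.\<close>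
  define \<theta> where "\<theta> = min 1 (d / (2 * (c0 + 1)))"
  define \<alpha> where "\<alpha> = min (\<theta> * h\<^sup>2) (min \<theta> (d / 2))"
  have d: "0 < d" using z by (simp add: d_def x_def)
  have \<theta>: "0 < \<theta>" "\<theta> \<le> 1" "\<theta> * c0 \<le> d / 2"
  proof -
    show "0 < \<theta>" "\<theta> \<le> 1" using d c0 by (auto simp: \<theta>_def)
    have "\<theta> * c0 \<le> d / (2 * (c0 + 1)) * (c0 + 1)" using c0 d by (intro mult_mono) (auto simp: \<theta>_def)
    also have "\<dots> = d / 2" using c0 by (simp add: divide_simps)
    finally show "\<theta> * c0 \<le> d / 2" .
  qed
  have \<alpha>: "0 < \<alpha>" using \<theta> d h by (auto simp: \<alpha>_def)
  have coercive: "\<alpha> * (norm p)\<^sup>2 \<le> B p p" if p: "p \<in> form_graph" for p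
  proof -
    obtain a b c where pabc: "p = (a, b, c)" by (cases p)
    define A B' C N where "A = (norm a)\<^sup>2" and "B' = (norm b)\<^sup>2" and "C = (norm c)\<^sup>2" and "N = h\<^sup>2 * B' + C"
    have nn: "0 \<le> A" "0 \<le> B'" "0 \<le> C" by (auto simp: A_def B'_def C_def)
    have N: "c0 * A \<le> N" using form_ge p by (simp add: pabc A_def B'_def C_def N_def)
    have Bpp: "B p p = N - x * A"
      by (simp add: B_def pabc N_def B'_def C_def A_def x_def power2_norm_eq_inner)
         (simp add: inner_l2_def cinner_cscale_left cinner_self)
    have "\<alpha> * (norm p)\<^sup>2 = \<alpha> * A + \<alpha> * B' + \<alpha> * C"
      by (simp add: pabc norm_Pair A_def B'_def C_def algebra_simps)
    also have "\<dots> \<le> (d / 2) * A + (\<theta> * h\<^sup>2) * B' + \<theta> * C"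
      by (intro add_mono mult_right_mono nn) (auto simp: \<alpha>_def)
    also have "\<dots> \<le> (d - \<theta> * c0) * A + \<theta> * N"
      using \<theta>(3) mult_right_mono[of "d / 2" "d - \<theta> * c0" A] nn by (simp add: N_def algebra_simps)
    also have "\<dots> \<le> N - x * A"
      using mult_left_mono[OF N, of "1 - \<theta>"] \<theta> by (simp add: d_def algebra_simps)
    finally show ?thesis by (simp add: Bpp)
  qed
  have "bounded_linear (\<lambda>p :: l2 \<times> l2 \<times> l2. inner g (fst p))"
    by (rule bounded_linear_compose[OF bounded_linear_inner_right bounded_linear_fst])
  from lax_milgram_on_subspace[OF subspace_form_graph closed_form_graph this Bbil \<alpha> coercive]
  obtain p where p: "p \<in> form_graph" "\<And>q. q \<in> form_graph \<Longrightarrow> B p q = inner g (fst q)" by blast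
  obtain a b c where pabc: "p = (a, b, c)" by (cases p)
  have re: "h\<^sup>2 * inner b b' + inner c c' = inner (g + cscale z a) a'" if "(a', b', c') \<in> form_graph" for a' b' c'
    using p(2)[OF that] by (simp add: pabc B_def inner_add_left)
  have "of_real (h\<^sup>2) * cinner b b' + cinner c c' = cinner (g + cscale z a) a'"
    if "(a', b', c') \<in> form_graph" for a' b' c'
    using re[OF that] re[OF cscale_form_graph[OF that, of \<i>]] unfolding cinner_eq by (simp add: complex_eq_iff)
  then have "(a, g + cscale z a) \<in> operator_graph h"
    using p(1) unfolding operator_graph_def pabc by blast
  then show ?thesis by blast
qed

lemma operator_bound:
  assumes "(a, f) \<in> operator_graph h"
  shows "(c0 - Re z) * norm a \<le> norm (f - cscale z a)"
proof (cases "a = 0")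
  case False
  from operator_graph_self[OF assms] obtain b c where
    bc: "(a, b, c) \<in> form_graph" "cinner f a = of_real (h\<^sup>2 * (norm b)\<^sup>2 + (norm c)\<^sup>2)" by blast
  have "c0 * (norm a)\<^sup>2 \<le> inner f a" using form_ge[OF bc(1)] bc(2) by (simp add: inner_l2_def)
  moreover have "inner (cscale z a) a = Re z * (norm a)\<^sup>2"
    by (simp add: inner_l2_def cinner_cscale_left cinner_self)
  ultimately have "(c0 - Re z) * (norm a)\<^sup>2 \<le> inner (f - cscale z a) a"
    by (simp add: inner_diff_left algebra_simps)
  also have "\<dots> \<le> norm (f - cscale z a) * norm a" by (rule norm_cauchy_schwarz)
  finally show ?thesis using False by (simp add: power2_eq_square flip: mult.assoc)
qed simp

lemma below_in_resolvent_set: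
  assumes z: "Re z < c0"
  shows "z \<in> resolvent_set (schroedinger h V)"
  unfolding resolvent_set_def
proof (intro CollectI conjI ballI)
  have "L2_norm u \<le> 1 / (c0 - Re z) * L2_norm (\<lambda>x. f x - z * u x)" if "(u, f) \<in> schroedinger h V" for u f
  proof -
    have L: "u \<in> L2" "f \<in> L2" using schroedinger_L2 that by auto
    have "to_l2 (\<lambda>x. f x - z * u x) = to_l2 f - cscale z (to_l2 u)"
      using L by (simp add: cscale_to_l2 minus_to_l2 L2_cmult)
    then have "(c0 - Re z) * L2_norm u \<le> L2_norm (\<lambda>x. f x - z * u x)"
      using operator_bound[of "to_l2 u" "to_l2 f" z] that schroedinger_iff[OF L, of h] L
      by (simp flip: norm_to_l2 add: L2_diff L2_cmult)
    then show ?thesis using z by (simp add: field_simps)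
  qed
  then show "\<exists>C. \<forall>(u, f)\<in>schroedinger h V. L2_norm u \<le> C * L2_norm (\<lambda>x. f x - z * u x)" by blast
next
  fix g assume g: "g \<in> L2"
  obtain a where a: "(a, to_l2 g + cscale z a) \<in> operator_graph h" using operator_surjective[OF z] by blast
  define f where "f x = g x + z * fn a x" for x
  have f: "f \<in> L2" unfolding f_def[abs_def] by (intro L2_add g L2_cmult fn_L2)
  have "to_l2 f = to_l2 g + cscale z a"
    using cscale_to_l2[OF fn_L2, of z a] plus_to_l2[OF g L2_cmult[OF fn_L2], of z a] by (simp add: f_def[abs_def])
  then have "(fn a, f) \<in> schroedinger h V" using a schroedinger_iff[OF fn_L2 f, of a h] by simp
  then show "\<exists>(u, f)\<in>schroedinger h V. AE x in lborel. f x - z * u x = g x"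
    by (intro bexI[of _ "(fn a, f)"]) (auto simp: f_def)
qed

end

lemma L2_norm_eq_0_iff: "u \<in> L2 \<Longrightarrow> L2_norm u = 0 \<longleftrightarrow> (AE x in lborel. u x = 0)"
  using to_l2_eq_iff[OF _ L2_zero, of u] by (simp flip: norm_to_l2 zero_to_l2)

lemma L2_independent_nonzero:
  assumes "L2_independent n u" "i < n"
  shows "\<not> (AE x in lborel. u i x = 0)"
proof
  assume ae: "AE x in lborel. u i x = 0"
  have "(\<Sum>j<n. of_bool (j = i) * u j x) = u i x" for x
    using assms(2) by (simp add: of_bool_def if_distrib[of "\<lambda>c. c * _"] cong: if_cong)
  then have "\<forall>j<n. (of_bool (j = i) :: complex) = 0"
    using assms(1)[unfolded L2_independent_def, THEN spec, of "\<lambda>j. of_bool (j = i)"] ae by simp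
  then show False using assms(2) by auto
qed

lemma multiplicity_of_resolvent_set:
  assumes T: "\<And>u f. (u, f) \<in> T \<Longrightarrow> u \<in> L2" and z: "z \<in> resolvent_set T"
  shows "multiplicity_of T z = 0"
proof -
  obtain C where C: "\<And>u f. (u, f) \<in> T \<Longrightarrow> L2_norm u \<le> C * L2_norm (\<lambda>x. f x - z * u x)"
    using z unfolding resolvent_set_def by blast
  have "n = 0" if n: "\<forall>i<n. (u i, \<lambda>x. z * u i x) \<in> T" "L2_independent n u" for n u
  proof (rule ccontr)
    assume "n \<noteq> 0"
    then have u0: "(u 0, \<lambda>x. z * u 0 x) \<in> T" using n by simp
    have "L2_norm (u 0) \<le> 0" using C[OF u0] by (simp add: L2_norm_def)
    moreover have "0 \<le> L2_norm (u 0)" unfolding L2_norm_def by simp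
    ultimately have "AE x in lborel. u 0 x = 0" using L2_norm_eq_0_iff[OF T[OF u0]] by simp
    then show False using L2_independent_nonzero[OF n(2), of 0] \<open>n \<noteq> 0\<close> by simp
  qed
  then have "{n. \<exists>u. (\<forall>i<n. (u i, \<lambda>x. z * u i x) \<in> T) \<and> L2_independent n u} \<subseteq> {0}" by blast
  then have "multiplicity_of T z \<le> Sup (enat ` {0})"
    unfolding multiplicity_of_def by (intro Sup_subset_mono image_mono)
  then show ?thesis by (simp flip: zero_enat_def)
qed

text \<open>
  Eigenvalues and the essential spectrum both consist of points outside the resolvent set, so neither
  reaches to the left of \<open>c\<close>; and as \<open>k \<ge> 1\<close>, a count of \<open>k\<close> needs at least one eigenvalue.
\<close>
lemma lambda_lower_bound:
  assumes T: "\<And>u f. (u, f) \<in> T \<Longrightarrow> u \<in> L2" and k: "k \<ge> 1"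
    and res: "\<And>z. Re z < c \<Longrightarrow> z \<in> resolvent_set T"
  shows "ereal c \<le> lambda k T"
proof (cases "enat k \<le> eigenvalue_count T {\<mu>. ereal \<mu> < ess_bottom T}")
  case True
  have "c \<le> \<mu>" if "enat k \<le> eigenvalue_count T {..\<mu>}" for \<mu>
  proof (rule ccontr)
    assume "\<not> c \<le> \<mu>"
    then have "multiplicity_of T (of_real \<nu>) = 0" if "\<nu> \<le> \<mu>" for \<nu>
      using that by (intro multiplicity_of_resolvent_set[OF T res]) auto
    then have "eigenvalue_count T {..\<mu>} \<le> 0"
      unfolding eigenvalue_count_def by (intro SUP_least) (auto intro!: sum.neutral)
    then have "enat k \<le> enat 0" unfolding zero_enat_def by (rule order_trans[OF that])
    then show False using k by simp
  qed
  then show ?thesis using True unfolding lambda_def by (auto intro!: INF_greatest)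
next
  case False
  have "c \<le> Re z" if "z \<in> essential_spectrum T" for z
    using that res[of z] by (force simp: essential_spectrum_def spectrum_of_def not_less[symmetric])
  then show ?thesis using False unfolding lambda_def ess_bottom_def by (auto intro!: INF_greatest)
qed

section \<open>Eigenvalues from trial spaces\<close>

text \<open>
  Gaussian elimination: an equation with a nonzero coefficient at \<open>p\<close> is used to eliminate the unknown
  \<open>p\<close> from the remaining ones.
\<close>
lemma homogeneous_system_nontrivial_solution:
  fixes A :: "'j \<Rightarrow> 'i \<Rightarrow> 'a::field"
  assumes "finite J" "finite I" "card J < card I"
  shows "\<exists>c. (\<exists>i\<in>I. c i \<noteq> 0) \<and> (\<forall>j\<in>J. (\<Sum>i\<in>I. c i * A j i) = 0)"
  using assms
proof (induction J arbitrary: I A rule: finite_induct)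
  case empty
  then obtain i where "i \<in> I" by (auto simp: card_gt_0_iff)
  then show ?case by (intro exI[of _ "\<lambda>_. 1"]) auto
next
  case (insert j J)
  show ?case
  proof (cases "\<forall>i\<in>I. A j i = 0")
    case True
    have "card J < card I" using insert by simp
    from insert.IH[OF insert.prems(1) this, of A] obtain c where
      c: "\<exists>i\<in>I. c i \<noteq> 0" "\<forall>j\<in>J. (\<Sum>i\<in>I. c i * A j i) = 0" by blast
    moreover have "(\<Sum>i\<in>I. c i * A j i) = 0" using True by (intro sum.neutral) auto
    ultimately show ?thesis by blast
  next
    case False
    then obtain p where p: "p \<in> I" "A j p \<noteq> 0" by blast
    define I' where "I' = I - {p}"
    have I': "finite I'" "card J < card I'" using insert p by (auto simp: I'_def)
    define A' where "A' l i = A l i - A l p * (A j i / A j p)" for l i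
    from insert.IH[OF I', of A'] obtain c where
      c: "\<exists>i\<in>I'. c i \<noteq> 0" "\<And>l. l \<in> J \<Longrightarrow> (\<Sum>i\<in>I'. c i * A' l i) = 0" by blast
    define s where "s = (\<Sum>i\<in>I'. c i * (A j i / A j p))"
    define d where "d = c(p := - s)"
    have split: "(\<Sum>i\<in>I. d i * A l i) = (\<Sum>i\<in>I'. c i * A' l i)" for l
    proof -
      have "(\<Sum>i\<in>I. d i * A l i) = d p * A l p + (\<Sum>i\<in>I'. d i * A l i)"
        unfolding I'_def by (rule sum.remove[OF insert.prems(1) p(1)])
      also have "(\<Sum>i\<in>I'. d i * A l i) = (\<Sum>i\<in>I'. c i * A l i)"
        by (rule sum.cong) (auto simp: d_def I'_def)
      also have "d p * A l p + \<dots> = (\<Sum>i\<in>I'. c i * A l i) - A l p * s" by (simp add: d_def)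
      also have "\<dots> = (\<Sum>i\<in>I'. c i * A' l i)"
        by (simp add: A'_def s_def sum_distrib_left sum_subtractf right_diff_distrib mult_ac)
      finally show ?thesis .
    qed
    have "A' j i = 0" for i using p(2) by (simp add: A'_def)
    then have "\<forall>l\<in>insert j J. (\<Sum>i\<in>I. d i * A l i) = 0" using c(2) by (auto simp: split)
    moreover have "\<exists>i\<in>I. d i \<noteq> 0" using c(1) by (auto simp: I'_def d_def)
    ultimately show ?thesis by blast
  qed
qed

lemma cinner_sum_left: "cinner (\<Sum>i\<in>I. f i) y = (\<Sum>i\<in>I. cinner (f i) y)"
  using linear_sum[OF bounded_linear.linear[OF bounded_linear_cinner_left]] .

lemma cinner_sum_right: "cinner x (\<Sum>i\<in>I. f i) = (\<Sum>i\<in>I. cinner x (f i))"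
  by (subst (1 2) cinner_commute) (simp add: cinner_sum_left)

lemma cinner_diff_left: "cinner (x - z) y = cinner x y - cinner z y"
  using cinner_add_left[of "x - z" z y] by simp

lemma cscale_zero_left [simp]: "cscale 0 x = 0"
  using cscale_of_real[of 0 x] by simp
lemma cscale_one [simp]: "cscale 1 x = x"
  using cscale_of_real[of 1 x] by simp

lemma scaleR_cscale: "r *\<^sub>R cscale z x = cscale (of_real r * z) x"
  by (simp add: cscale_cscale flip: cscale_of_real)

lemma to_l2_sum:
  fixes n :: nat
  assumes "\<And>i. i < n \<Longrightarrow> u i \<in> L2"
  shows "to_l2 (\<lambda>x. \<Sum>i<n. c i * u i x) = (\<Sum>i<n. cscale (c i) (to_l2 (u i)))"
  using assms
proof (induction n)
  case (Suc n)
  have "(\<lambda>x. \<Sum>i<n. c i * u i x) \<in> L2" using Suc.prems by (intro L2_sum L2_cmult) auto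
  then have "to_l2 (\<lambda>x. (\<Sum>i<n. c i * u i x) + c n * u n x)
      = to_l2 (\<lambda>x. \<Sum>i<n. c i * u i x) + to_l2 (\<lambda>x. c n * u n x)"
    using Suc.prems by (intro plus_to_l2[symmetric] L2_cmult) auto
  then show ?case using Suc by (simp add: cscale_to_l2)
qed (simp add: zero_to_l2)

lemma eigenvalue_count_mono: "A \<subseteq> B \<Longrightarrow> eigenvalue_count T A \<le> eigenvalue_count T B"
  unfolding eigenvalue_count_def by (intro SUP_subset_mono) auto

lemma eigenvalue_count_ge:
  assumes "finite F" "F \<subseteq> S"
  shows "(\<Sum>\<mu>\<in>F. multiplicity_of T (of_real \<mu>)) \<le> eigenvalue_count T S"
  unfolding eigenvalue_count_def using assms by (intro SUP_upper) auto

text \<open>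
  If \<open>\<Lambda>\<close> is not below the essential spectrum, there is nothing to count: either \<open>\<lambda>\<^sub>k\<close> is the bottom of the
  essential spectrum, or finitely many eigenvalues below it already have total multiplicity at least \<open>k\<close>,
  and \<open>\<lambda>\<^sub>k\<close> is at most their maximum.
\<close>
lemma lambda_upper_bound:
  assumes k: "k \<ge> 1"
    and count: "ereal \<Lambda> < ess_bottom T \<Longrightarrow> enat k \<le> eigenvalue_count T {..\<Lambda>}"
  shows "lambda k T \<le> ereal \<Lambda>"
proof (cases "ereal \<Lambda> < ess_bottom T")
  case True
  have sub: "{..\<Lambda>} \<subseteq> {\<mu>. ereal \<mu> < ess_bottom T}"
  proof
    fix \<mu> assume "\<mu> \<in> {..\<Lambda>}"
    then have "ereal \<mu> \<le> ereal \<Lambda>" by simp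
    then show "\<mu> \<in> {\<mu>. ereal \<mu> < ess_bottom T}" using le_less_trans[OF _ True] by blast
  qed
  have "enat k \<le> eigenvalue_count T {\<mu>. ereal \<mu> < ess_bottom T}"
    using count[OF True] eigenvalue_count_mono[OF sub] by (rule order_trans)
  then show ?thesis unfolding lambda_def using count[OF True] True by (auto intro: INF_lower)
next
  case False
  then have ess: "ess_bottom T \<le> ereal \<Lambda>" by simp
  show ?thesis
  proof (cases "enat k \<le> eigenvalue_count T {\<mu>. ereal \<mu> < ess_bottom T}")
    case True
    have "\<exists>F. finite F \<and> F \<subseteq> {\<mu>. ereal \<mu> < ess_bottom T} \<and> enat k \<le> (\<Sum>\<mu>\<in>F. multiplicity_of T (of_real \<mu>))"
    proof (rule ccontr)
      assume no: "\<not> ?thesis"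
      have "eigenvalue_count T {\<mu>. ereal \<mu> < ess_bottom T} \<le> enat (k - 1)"
        unfolding eigenvalue_count_def
      proof (rule SUP_least)
        fix F assume "F \<in> {F. finite F \<and> F \<subseteq> {\<mu>. ereal \<mu> < ess_bottom T}}"
        then have "(\<Sum>\<mu>\<in>F. multiplicity_of T (of_real \<mu>)) < enat (Suc (k - 1))"
          using no k by (auto simp: not_le)
        then show "(\<Sum>\<mu>\<in>F. multiplicity_of T (of_real \<mu>)) \<le> enat (k - 1)"
          by (cases "\<Sum>\<mu>\<in>F. multiplicity_of T (complex_of_real \<mu>)") auto
      qed
      from order_trans[OF True this] show False using k by simp
    qed
    then obtain F where F: "finite F" "F \<subseteq> {\<mu>. ereal \<mu> < ess_bottom T}"
      "enat k \<le> (\<Sum>\<mu>\<in>F. multiplicity_of T (of_real \<mu>))" by blast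
    have "F \<noteq> {}" using F(3) k by (auto simp: zero_enat_def)
    define \<mu> where "\<mu> = Max F"
    have \<mu>: "ereal \<mu> < ess_bottom T" using F Max_in[OF F(1) \<open>F \<noteq> {}\<close>] by (auto simp: \<mu>_def)
    have "F \<subseteq> {..\<mu>}" using F(1) by (auto simp: \<mu>_def)
    then have "enat k \<le> eigenvalue_count T {..\<mu>}"
      using F(3) eigenvalue_count_ge[OF F(1)] by (meson order_trans)
    then have "lambda k T \<le> ereal \<mu>" unfolding lambda_def using True \<mu> by (auto intro: INF_lower)
    then show ?thesis using \<mu> ess by (meson less_le_trans less_imp_le order_trans)
  next
    case False
    then show ?thesis using ess by (simp add: lambda_def)
  qed
qed

locale schroedinger_operator = schroedinger_potential +
  fixes h :: real
  assumes h_nonzero: "h \<noteq> 0"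
begin

sublocale bounded_below_form V h 0
  by unfold_locales (use h_nonzero in auto)

lemma operator_graph_add_cscale:
  assumes "(a, f) \<in> operator_graph h" "(a', f') \<in> operator_graph h"
  shows "(a + cscale z a', f + cscale z f') \<in> operator_graph h"
proof -
  obtain b c where 1: "(a, b, c) \<in> form_graph"
    "\<And>x y z. (x, y, z) \<in> form_graph \<Longrightarrow> of_real (h\<^sup>2) * cinner b y + cinner c z = cinner f x"
    using assms(1) unfolding operator_graph_def by blast
  obtain b' c' where 2: "(a', b', c') \<in> form_graph"
    "\<And>x y z. (x, y, z) \<in> form_graph \<Longrightarrow> of_real (h\<^sup>2) * cinner b' y + cinner c' z = cinner f' x"
    using assms(2) unfolding operator_graph_def by blast
  have "(a + cscale z a', b + cscale z b', c + cscale z c') \<in> form_graph"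
    using subspace_add[OF subspace_form_graph 1(1) cscale_form_graph[OF 2(1), of z]] by simp
  moreover have "of_real (h\<^sup>2) * cinner (b + cscale z b') y + cinner (c + cscale z c') w = cinner (f + cscale z f') x"
    if "(x, y, w) \<in> form_graph" for x y w
    unfolding cinner_add_left cinner_cscale_left 1(2)[OF that, symmetric] 2(2)[OF that, symmetric]
    by (simp add: algebra_simps)
  ultimately show ?thesis unfolding operator_graph_def by blast
qed

lemma operator_graph_zero: "(0, 0) \<in> operator_graph h"
  unfolding operator_graph_def
  using subspace_0[OF subspace_form_graph] by (auto simp: zero_prod_def intro!: exI[of _ 0])

lemma operator_graph_cscale:
  "(a, f) \<in> operator_graph h \<Longrightarrow> (cscale z a, cscale z f) \<in> operator_graph h"
  using operator_graph_add_cscale[OF operator_graph_zero, of a f z] by simp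

text \<open>
  The operator \<open>(T + 1)\<^sup>-\<^sup>1\<close>, which is bounded, symmetric and defined everywhere. It has the eigenvalue
  \<open>1 / (1 + \<mu>)\<close> where \<open>T\<close> has the eigenvalue \<open>\<mu>\<close>, so low eigenvalues of \<open>T\<close> are found at the top of its
  spectrum.
\<close>
definition resolvent :: "l2 \<Rightarrow> l2" where
  "resolvent g = (SOME a. (a, g - a) \<in> operator_graph h)"

lemma cscale_minus_one: "cscale (- 1) x = - x"
  using cscale_of_real[of "- 1" x] by simp

lemma resolvent_graph: "(resolvent g, g - resolvent g) \<in> operator_graph h"
proof -
  have "\<exists>a. (a, g - a) \<in> operator_graph h"
    using operator_surjective[of "- 1" g] by (simp add: cscale_minus_one)
  then show ?thesis unfolding resolvent_def by (rule someI_ex)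
qed

lemma resolvent_unique:
  assumes "(a, g - a) \<in> operator_graph h"
  shows "resolvent g = a"
proof -
  have "(resolvent g - a, (g - resolvent g) - (g - a)) \<in> operator_graph h"
    using operator_graph_add_cscale[OF resolvent_graph[of g] assms, where z = "- 1"]
    by (simp add: cscale_minus_one algebra_simps)
  from operator_bound[OF this, of "- 1"] show ?thesis by (simp add: cscale_minus_one)
qed

lemma resolvent_add_cscale: "resolvent (x + cscale z y) = resolvent x + cscale z (resolvent y)"
proof (rule resolvent_unique)
  have e: "cscale z (y - resolvent y) = cscale z y - cscale z (resolvent y)"
    using cscale_add_right[of z "y - resolvent y" "resolvent y"] by simp
  show "(resolvent x + cscale z (resolvent y), x + cscale z y - (resolvent x + cscale z (resolvent y)))
      \<in> operator_graph h"
    using operator_graph_add_cscale[OF resolvent_graph resolvent_graph, of x z y]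
    by (simp add: e algebra_simps)
qed

lemma resolvent_add: "resolvent (x + y) = resolvent x + resolvent y"
  using resolvent_add_cscale[of x 1 y] by simp

lemma resolvent_cscale: "resolvent (cscale z y) = cscale z (resolvent y)"
proof -
  have "resolvent 0 = 0" by (rule resolvent_unique) (simp add: operator_graph_zero)
  then show ?thesis using resolvent_add_cscale[of 0 z y] by simp
qed

lemma norm_resolvent_le: "norm (resolvent g) \<le> norm g"
  using operator_bound[OF resolvent_graph, of "- 1" g] by (simp add: cscale_minus_one)

lemma bounded_linear_resolvent: "bounded_linear resolvent"
  by (rule bounded_linear_intro[where K = 1])
     (auto simp: resolvent_add norm_resolvent_le simp flip: cscale_of_real simp: resolvent_cscale)

lemma cinner_resolvent: "cinner (resolvent x) y = cinner x (resolvent y)"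
proof -
  have "cinner (x - resolvent x) (resolvent y) = cinner (resolvent x) (y - resolvent y)"
    by (rule operator_graph_symmetric[OF resolvent_graph resolvent_graph])
  moreover have "cinner (resolvent x) (y - resolvent y) = cinner (resolvent x) y - cinner (resolvent x) (resolvent y)"
    using cinner_add_right[of "resolvent x" "y - resolvent y" "resolvent y"] by simp
  ultimately show ?thesis by (simp add: cinner_diff_left)
qed

text \<open>
  With \<open>G = (T + 1)\<^sup>-\<^sup>1\<close> and \<open>\<mu> = 1 / t - 1\<close> one has \<open>G - t = - t (T - \<mu>) G\<close>. So \<open>G v - t v = y\<close> is solved by
  \<open>v = (T + 1) a\<close>, where \<open>(T - \<mu>) a = - y / t\<close>.
\<close>
lemma resolvent_invertible:
  assumes t: "t > 0" and res: "of_real (1 / t - 1) \<in> resolvent_set (schroedinger h V)"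
  shows "invertible_on UNIV (\<lambda>x. resolvent x - t *\<^sub>R x)"
proof -
  define \<mu> where "\<mu> = 1 / t - 1"
  obtain C where C: "\<And>u f. (u, f) \<in> schroedinger h V \<Longrightarrow> L2_norm u \<le> C * L2_norm (\<lambda>x. f x - of_real \<mu> * u x)"
    using res unfolding resolvent_set_def \<mu>_def by blast
  define K where "K = (1 + \<bar>C\<bar> / t) / t"
  have "\<exists>v. resolvent v - t *\<^sub>R v = y \<and> norm v \<le> K * norm y" for y
  proof -
    define g where "g = - ((1 / t) *\<^sub>R y)"
    have "\<exists>(u, f)\<in>schroedinger h V. AE x in lborel. f x - of_real \<mu> * u x = fn g x"
      using res fn_L2 unfolding resolvent_set_def \<mu>_def by blast
    then obtain u f where uf: "(u, f) \<in> schroedinger h V" "AE x in lborel. f x - of_real \<mu> * u x = fn g x" by blast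
    have L: "u \<in> L2" "f \<in> L2" using schroedinger_L2 uf by auto
    define a where "a = to_l2 u"
    have d: "to_l2 (\<lambda>x. f x - of_real \<mu> * u x) = to_l2 f - \<mu> *\<^sub>R a"
      using L by (simp add: a_def scaleR_to_l2 minus_to_l2 L2_cmult)
    moreover have "to_l2 (\<lambda>x. f x - of_real \<mu> * u x) = g"
      using to_l2_eq_iff[OF L2_diff[OF L(2) L2_cmult[OF L(1)]] fn_L2, of "of_real \<mu>" g] uf(2) by simp
    ultimately have fg: "to_l2 f = g + \<mu> *\<^sub>R a" by (simp add: algebra_simps)
    have na: "norm a \<le> C * norm g"
      using C[OF uf(1)] L d fg by (simp flip: norm_to_l2 add: a_def L2_diff L2_cmult)
    define v where "v = g + (1 / t) *\<^sub>R a"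
    have "v - a = g + \<mu> *\<^sub>R a" by (simp add: v_def \<mu>_def algebra_simps)
    then have "(a, v - a) \<in> operator_graph h" using schroedinger_iff[OF L, of h] uf(1) by (simp add: a_def fg)
    then have "resolvent v = a" by (rule resolvent_unique)
    then have 1: "resolvent v - t *\<^sub>R v = y" using t by (simp add: v_def g_def algebra_simps)
    have ng: "norm g = norm y / t" using t by (simp add: g_def)
    have "norm v \<le> norm g + norm a / t" unfolding v_def using t norm_triangle_ineq[of g "(1 / t) *\<^sub>R a"] by simp
    also have "\<dots> \<le> norm g + \<bar>C\<bar> * norm g / t"
      using order_trans[OF na, of "\<bar>C\<bar> * norm g"] t
      by (intro add_left_mono divide_right_mono) (auto simp: mult_right_mono)
    also have "\<dots> = K * norm y" using t by (simp add: K_def ng field_simps)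
    finally show ?thesis using 1 by blast
  qed
  then show ?thesis unfolding invertible_on_def by blast
qed

text \<open>
  The condition on \<open>t\<close> means \<open>1 / t - 1 \<le> \<Lambda>\<close>. Below the essential spectrum a point is in the resolvent set or
  isolated in the spectrum, and this carries over along the continuous map \<open>s \<mapsto> 1 / s - 1\<close>.
\<close>
lemma resolvent_spectrum_isolated:
  assumes ess: "ereal \<Lambda> < ess_bottom (schroedinger h V)" and \<Lambda>: "0 \<le> \<Lambda>" and t: "t \<ge> 1 / (1 + \<Lambda>)"
  shows "invertible_on UNIV (\<lambda>x. resolvent x - t *\<^sub>R x) \<or>
    (\<exists>\<epsilon>>0. \<forall>s. 0 < \<bar>s - t\<bar> \<and> \<bar>s - t\<bar> < \<epsilon> \<longrightarrow> invertible_on UNIV (\<lambda>x. resolvent x - s *\<^sub>R x))"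
proof -
  define T where "T = schroedinger h V"
  define \<mu> where "\<mu> = 1 / t - 1"
  have t0: "t > 0" using t \<Lambda> by (smt (verit) zero_less_divide_1_iff)
  have "1 \<le> t * (1 + \<Lambda>)" using t \<Lambda> by (simp add: field_simps)
  then have \<mu>\<Lambda>: "\<mu> \<le> \<Lambda>" using t0 by (simp add: \<mu>_def field_simps)
  show ?thesis
  proof (cases "complex_of_real \<mu> \<in> resolvent_set T")
    case True
    then show ?thesis using resolvent_invertible[OF t0] by (simp add: \<mu>_def T_def)
  next
    case False
    then have sp: "complex_of_real \<mu> \<in> spectrum_of T" by (simp add: spectrum_of_def)
    have "complex_of_real \<mu> \<notin> essential_spectrum T"
    proof
      assume "complex_of_real \<mu> \<in> essential_spectrum T"
      then have "ess_bottom T \<le> ereal (Re (complex_of_real \<mu>))" unfolding ess_bottom_def by (rule INF_lower)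
      also have "\<dots> \<le> ereal \<Lambda>" using \<mu>\<Lambda> by simp
      finally show False using ess by (simp add: T_def)
    qed
    then have "\<not> complex_of_real \<mu> islimpt spectrum_of T"
      using sp by (simp add: essential_spectrum_def discrete_spectrum_def)
    then obtain e where e: "e > 0" "\<And>z. z \<in> spectrum_of T \<Longrightarrow> z \<noteq> of_real \<mu> \<Longrightarrow> e \<le> dist z (of_real \<mu>)"
      unfolding islimpt_approachable by (metis not_le)
    have "isCont (\<lambda>s. 1 / s - 1) t" using t0 by (intro continuous_intros) auto
    then obtain d where d: "d > 0" "\<And>s. dist s t < d \<Longrightarrow> dist (1 / s - 1) (1 / t - 1) < e"
      using e(1) unfolding continuous_at_eps_delta by blast
    have "invertible_on UNIV (\<lambda>x. resolvent x - s *\<^sub>R x)" if s: "0 < \<bar>s - t\<bar>" "\<bar>s - t\<bar> < min d t" for s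
    proof (rule resolvent_invertible)
      show s0: "s > 0" using s by linarith
      have "dist (1 / s - 1) \<mu> < e" using d(2)[of s] s by (simp add: dist_real_def \<mu>_def)
      then have "dist (complex_of_real (1 / s - 1)) (of_real \<mu>) < e" by (simp only: dist_of_real)
      moreover have "complex_of_real (1 / s - 1) \<noteq> of_real \<mu>"
        using s s0 t0 unfolding of_real_eq_iff \<mu>_def by auto
      ultimately have "complex_of_real (1 / s - 1) \<notin> spectrum_of T" using e(2) by force
      then show "complex_of_real (1 / s - 1) \<in> resolvent_set (schroedinger h V)"
        by (simp only: spectrum_of_def T_def ComplD Compl_iff not_not)
    qed
    moreover have "min d t > 0" using d t0 by simp
    ultimately show ?thesis by blast
  qed
qed

text \<open>
  In the inner product of the form domain, which is the form plus the inner product of \<open>L2\<close>, the vectors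
  \<open>(T + 1)\<^sup>-\<^sup>1 u\<close> and \<open>u\<close> have inner product \<open>\<parallel>u\<parallel>\<^sup>2\<close>. The square of the form norm of the first is
  \<open>\<langle>(T + 1)\<^sup>-\<^sup>1 u, u\<rangle>\<close> and that of the second is at most \<open>(1 + \<Lambda>) \<parallel>u\<parallel>\<^sup>2\<close>; apply Cauchy--Schwarz.
\<close>
lemma resolvent_form_ge:
  assumes g: "(u, b, c) \<in> form_graph" and q: "h\<^sup>2 * (norm b)\<^sup>2 + (norm c)\<^sup>2 \<le> \<Lambda> * (norm u)\<^sup>2" and \<Lambda>: "0 \<le> \<Lambda>"
  shows "1 / (1 + \<Lambda>) * (norm u)\<^sup>2 \<le> inner (resolvent u) u"
proof (cases "u = 0")
  case False
  define a where "a = resolvent u"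
  obtain b' c' where g': "(a, b', c') \<in> form_graph"
    and eq: "\<And>x y z. (x, y, z) \<in> form_graph \<Longrightarrow> of_real (h\<^sup>2) * cinner b' y + cinner c' z = cinner (u - a) x"
    using resolvent_graph[of u] unfolding operator_graph_def a_def by blast
  have re: "h\<^sup>2 * inner b' y + inner c' z + inner a x = inner u x" if "(x, y, z) \<in> form_graph" for x y z
    using arg_cong[OF eq[OF that], of Re] by (simp add: inner_l2_def cinner_diff_left)
  \<comment> \<open>The form norms of \<open>u\<close> and \<open>a\<close> as norms in the product space.\<close>
  define p where "p = (u, h *\<^sub>R b, c)"
  define p' where "p' = (a, h *\<^sub>R b', c')"
  have "inner p' p = (norm u)\<^sup>2"
    unfolding power2_norm_eq_inner
    using re[OF g] by (simp add: p_def p'_def power2_eq_square algebra_simps)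
  moreover have "inner p' p' = inner a u"
    using re[OF g'] by (simp add: p'_def inner_commute[of u a] power2_eq_square algebra_simps)
  moreover have "inner p p \<le> (1 + \<Lambda>) * (norm u)\<^sup>2"
    using q unfolding power2_norm_eq_inner by (simp add: p_def power2_eq_square algebra_simps)
  moreover have "0 \<le> inner a u" using calculation(2) inner_ge_zero[of p'] by simp
  ultimately have "((norm u)\<^sup>2)\<^sup>2 \<le> inner a u * ((1 + \<Lambda>) * (norm u)\<^sup>2)"
    using Cauchy_Schwarz_ineq[of p' p] by (smt (verit) mult_left_mono)
  then have "(norm u)\<^sup>2 * (norm u)\<^sup>2 \<le> (norm u)\<^sup>2 * ((1 + \<Lambda>) * inner a u)"
    by (simp add: power2_eq_square mult_ac)
  then have "(norm u)\<^sup>2 \<le> (1 + \<Lambda>) * inner a u" using False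
    by (meson mult_le_cancel_left_pos zero_less_norm_iff zero_less_power)
  then show ?thesis using \<Lambda> by (simp add: a_def field_simps)
qed simp

definition orthonormal_eigenvectors :: "nat \<Rightarrow> (nat \<Rightarrow> l2) \<Rightarrow> (nat \<Rightarrow> real) \<Rightarrow> bool" where
  "orthonormal_eigenvectors j e \<mu> \<longleftrightarrow>
     (\<forall>i<j. (e i, \<mu> i *\<^sub>R e i) \<in> operator_graph h) \<and>
     (\<forall>i<j. \<forall>l<j. cinner (e i) (e l) = of_bool (i = l))"

text \<open>
  The trial vector \<open>u0\<close> shows that the numerical range of \<open>(T + 1)\<^sup>-\<^sup>1\<close> on the orthogonal complement of the
  known eigenvectors reaches \<open>1 / (1 + \<Lambda>)\<close>. The complement is invariant, so \<open>top_eigenvector\<close> finds an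
  eigenvector in it.
\<close>
lemma orthonormal_eigenvectors_extend:
  assumes ess: "ereal \<Lambda> < ess_bottom (schroedinger h V)" and \<Lambda>: "0 \<le> \<Lambda>"
    and e: "orthonormal_eigenvectors j e \<mu>"
    and u0: "u0 \<noteq> 0" "\<And>i. i < j \<Longrightarrow> cinner u0 (e i) = 0"
    and u0_form: "(u0, b, c) \<in> form_graph" "h\<^sup>2 * (norm b)\<^sup>2 + (norm c)\<^sup>2 \<le> \<Lambda> * (norm u0)\<^sup>2"
  obtains e' \<nu> where "\<nu> \<le> \<Lambda>" "orthonormal_eigenvectors (Suc j) (e(j := e')) (\<mu>(j := \<nu>))"
proof -
  have eig: "(e i, \<mu> i *\<^sub>R e i) \<in> operator_graph h" and on: "l < j \<Longrightarrow> cinner (e i) (e l) = of_bool (i = l)"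
    if "i < j" for i l using e that by (auto simp: orthonormal_eigenvectors_def)
  define S where "S x = (\<Sum>i<j. cscale (cinner x (e i)) (e i))" for x
  \<comment> \<open>The projection onto the orthogonal complement of the \<open>e i\<close>.\<close>
  define P where "P x = x - S x" for x
  have S_cinner: "cinner (S x) (e l) = cinner x (e l)" if "l < j" for x l
    using that by (simp add: S_def cinner_sum_left cinner_cscale_left on of_bool_def if_distrib cong: if_cong)
  have P_cinner: "cinner (P x) (e l) = 0" if "l < j" for x l
    using S_cinner[OF that] by (simp add: P_def cinner_diff_left)
  have P_iff: "P x = x \<longleftrightarrow> (\<forall>i<j. cinner x (e i) = 0)" for x
  proof
    assume "P x = x" then show "\<forall>i<j. cinner x (e i) = 0" using P_cinner by metis
  qed (simp add: P_def S_def)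
  have PP: "P (P x) = P x" for x using P_iff[of "P x"] P_cinner by simp
  have Pnorm: "norm (P x) \<le> norm x" for x
  proof (rule power2_le_imp_le)
    have "cinner (P x) (S x) = 0"
      unfolding S_def cinner_sum_right by (simp add: cinner_cscale_right P_cinner)
    then have "inner (P x) (S x) = 0" by (simp add: inner_l2_def)
    moreover have "x = P x + S x" by (simp add: P_def)
    ultimately have "(norm x)\<^sup>2 = (norm (P x))\<^sup>2 + (norm (S x))\<^sup>2"
      by (metis (no_types, lifting) add.commute add.right_neutral inner_add_left inner_add_right inner_commute power2_norm_eq_inner)
    then show "(norm (P x))\<^sup>2 \<le> (norm x)\<^sup>2" by simp
  qed simp
  have Padd: "P (x + y) = P x + P y" for x y
    by (simp add: P_def S_def cinner_add_left cscale_add_left sum.distrib)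
  have Pscale: "P (r *\<^sub>R x) = r *\<^sub>R P x" for r x
    by (simp add: P_def S_def cinner_scaleR_left scaleR_diff_right scaleR_sum_right cscale_cscale[symmetric] cscale_of_real)
  have Pbl: "bounded_linear P"
    by (rule bounded_linear_intro[where K = 1]) (auto simp: Padd Pscale Pnorm)
  have Ge: "resolvent (e i) = (1 / (1 + \<mu> i)) *\<^sub>R e i" if "i < j" for i
  proof -
    from operator_graph_self[OF eig[OF that]] obtain b c :: l2 where
      "cinner (\<mu> i *\<^sub>R e i) (e i) = of_real (h\<^sup>2 * (norm b)\<^sup>2 + (norm c)\<^sup>2)" by blast
    then have "complex_of_real (\<mu> i) = of_real (h\<^sup>2 * (norm b)\<^sup>2 + (norm c)\<^sup>2)"
      using on[OF that that] by (simp add: cinner_scaleR_left)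
    then have "\<mu> i = h\<^sup>2 * (norm b)\<^sup>2 + (norm c)\<^sup>2" unfolding of_real_eq_iff .
    then have "0 \<le> \<mu> i" by simp
    have "(e i, (1 + \<mu> i) *\<^sub>R e i - e i) \<in> operator_graph h" using eig[OF that] by (simp add: algebra_simps)
    then have r: "resolvent ((1 + \<mu> i) *\<^sub>R e i) = e i" by (rule resolvent_unique)
    have "resolvent (e i) = resolvent ((1 / (1 + \<mu> i)) *\<^sub>R (1 + \<mu> i) *\<^sub>R e i)" using \<open>0 \<le> \<mu> i\<close> by simp
    also have "\<dots> = (1 / (1 + \<mu> i)) *\<^sub>R e i"
      using resolvent_cscale[of "of_real (1 / (1 + \<mu> i))" "(1 + \<mu> i) *\<^sub>R e i"] r unfolding cscale_of_real by simp
    finally show ?thesis .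
  qed
  have resolvent_sum: "resolvent (\<Sum>i<n. f i) = (\<Sum>i<n. resolvent (f i))" for n :: nat and f
    using linear_sum[OF bounded_linear.linear[OF bounded_linear_resolvent]] .
  have PG: "P (resolvent x) = resolvent (P x)" for x
  proof -
    have "resolvent (S x) = (\<Sum>i<j. cscale (cinner x (e i)) (resolvent (e i)))"
      by (simp add: S_def resolvent_sum resolvent_cscale)
    also have "\<dots> = S (resolvent x)" unfolding S_def
      by (rule sum.cong) (simp_all add: cinner_resolvent Ge cscale_scaleR cinner_scaleR_right scaleR_cscale)
    finally show ?thesis unfolding P_def
      using linear_diff[OF bounded_linear.linear[OF bounded_linear_resolvent]] by simp
  qed
  have Gsym: "inner (resolvent x) y = inner x (resolvent y)" for x y by (simp add: inner_l2_def cinner_resolvent)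
  have Pu0: "P u0 = u0" using u0(2) by (simp add: P_iff)
  obtain t f where t: "t \<ge> 1 / (1 + \<Lambda>)" and f: "P f = f" "f \<noteq> 0" "resolvent f = t *\<^sub>R f"
    using top_eigenvector[OF bounded_linear_resolvent Gsym Pbl PP Pnorm PG
        resolvent_spectrum_isolated[OF ess \<Lambda>] Pu0 u0(1) resolvent_form_ge[OF u0_form \<Lambda>]] by blast
  have t0: "t > 0" using t \<Lambda> by (smt (verit) zero_less_divide_1_iff)
  define \<nu> where "\<nu> = 1 / t - 1"
  have "1 \<le> t * (1 + \<Lambda>)" using t \<Lambda> by (simp add: field_simps)
  then have \<nu>\<Lambda>: "\<nu> \<le> \<Lambda>" using t0 by (simp add: \<nu>_def field_simps)
  define e' where "e' = (1 / norm f) *\<^sub>R f"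
  have "(cscale (of_real (1 / (t * norm f))) (t *\<^sub>R f), cscale (of_real (1 / (t * norm f))) (f - t *\<^sub>R f)) \<in> operator_graph h"
    using operator_graph_cscale[OF resolvent_graph[of f], of "of_real (1 / (t * norm f))"] by (simp only: f(3))
  moreover have "(1 / (t * norm f)) *\<^sub>R (t *\<^sub>R f) = e'" using t0 by (simp add: e'_def)
  moreover have "(1 / (t * norm f)) *\<^sub>R (f - t *\<^sub>R f) = \<nu> *\<^sub>R e'"
    using t0 f(2) by (simp add: e'_def \<nu>_def algebra_simps flip: scaleR_left_diff_distrib)
  ultimately have e'_graph: "(e', \<nu> *\<^sub>R e') \<in> operator_graph h" unfolding cscale_of_real by simp
  have e'_norm: "cinner e' e' = 1" using f(2) by (simp add: cinner_self e'_def)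
  have e'_orth: "cinner e' (e i) = 0" if "i < j" for i
    using f(1) that unfolding P_iff by (simp add: e'_def cinner_scaleR_left)
  then have e'_orth': "cinner (e i) e' = 0" if "i < j" for i
    using that cinner_commute[of "e i" e'] by simp
  have "orthonormal_eigenvectors (Suc j) (e(j := e')) (\<mu>(j := \<nu>))"
    unfolding orthonormal_eigenvectors_def
    using eig on e'_graph e'_norm e'_orth e'_orth' by (auto simp: less_Suc_eq)
  then show ?thesis using that \<nu>\<Lambda> by blast
qed

lemma multiplicity_of_ge_card:
  assumes e: "orthonormal_eigenvectors k e \<mu>" and I: "I \<subseteq> {i. i < k \<and> \<mu> i = \<nu>}"
  shows "enat (card I) \<le> multiplicity_of (schroedinger h V) (of_real \<nu>)"
proof -
  have fin: "finite I" using I by (rule finite_subset) auto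
  define n where "n = card I"
  obtain \<pi> where \<pi>: "bij_betw \<pi> {0..<n} I" using ex_bij_betw_nat_finite[OF fin] by (auto simp: n_def)
  have \<pi>I: "\<pi> i < k" "\<mu> (\<pi> i) = \<nu>" if "i < n" for i
  proof -
    have "\<pi> i \<in> I" using \<pi> that by (auto simp: bij_betw_def)
    then show "\<pi> i < k" "\<mu> (\<pi> i) = \<nu>" using I by auto
  qed
  have inj: "\<pi> i = \<pi> l \<longleftrightarrow> i = l" if "i < n" "l < n" for i l
    using \<pi> that by (auto simp: bij_betw_def inj_on_def)
  define u where "u i = fn (e (\<pi> i))" for i
  have "(u i, \<lambda>x. of_real \<nu> * u i x) \<in> schroedinger h V" if "i < n" for i
  proof -
    have "to_l2 (\<lambda>x. of_real \<nu> * u i x) = \<nu> *\<^sub>R e (\<pi> i)"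
      using scaleR_to_l2[of "u i" \<nu>] by (simp add: u_def)
    then show ?thesis using e \<pi>I[OF that] schroedinger_iff[of "u i" "\<lambda>x. of_real \<nu> * u i x" h]
      by (auto simp: u_def orthonormal_eigenvectors_def L2_cmult)
  qed
  moreover have "L2_independent n u"
    unfolding L2_independent_def
  proof (intro allI impI)
    fix c l assume ae: "AE x in lborel. (\<Sum>i<n. c i * u i x) = 0" and l: "l < n"
    have "to_l2 (\<lambda>x. \<Sum>i<n. c i * u i x) = 0"
      unfolding zero_to_l2 using ae by (subst to_l2_eq_iff) (auto simp: u_def intro!: L2_sum L2_cmult L2_zero)
    then have "(\<Sum>i<n. cscale (c i) (e (\<pi> i))) = 0" by (simp add: to_l2_sum u_def)
    then have "0 = cinner (\<Sum>i<n. cscale (c i) (e (\<pi> i))) (e (\<pi> l))" by simp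
    also have "\<dots> = (\<Sum>i<n. c i * cinner (e (\<pi> i)) (e (\<pi> l)))" by (simp add: cinner_sum_left cinner_cscale_left)
    also have "\<dots> = (\<Sum>i<n. c i * of_bool (i = l))"
      by (rule sum.cong) (use e \<pi>I l inj in \<open>auto simp: orthonormal_eigenvectors_def\<close>)
    also have "\<dots> = c l" using l by (simp add: of_bool_def if_distrib cong: if_cong)
    finally show "c l = 0" by simp
  qed
  ultimately show ?thesis unfolding multiplicity_of_def n_def[symmetric] by (intro SUP_upper) blast
qed

lemma eigenvalue_count_ge_orthonormal:
  assumes e: "orthonormal_eigenvectors k e \<mu>" and \<mu>: "\<And>i. i < k \<Longrightarrow> \<mu> i \<le> \<Lambda>"
  shows "enat k \<le> eigenvalue_count (schroedinger h V) {..\<Lambda>}"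
proof -
  define F where "F = \<mu> ` {..<k}"
  have "k = (\<Sum>i<k. 1)" by simp
  also have "\<dots> = (\<Sum>\<nu>\<in>F. \<Sum>i\<in>{i \<in> {..<k}. \<mu> i = \<nu>}. 1)" unfolding F_def by (rule sum.image_gen) simp
  finally have "k = (\<Sum>\<nu>\<in>F. card {i \<in> {..<k}. \<mu> i = \<nu>})" by simp
  then have "enat k = (\<Sum>\<nu>\<in>F. enat (card {i \<in> {..<k}. \<mu> i = \<nu>}))"
    by (metis (no_types, lifting) of_nat_eq_enat of_nat_sum sum.cong)
  also have "\<dots> \<le> (\<Sum>\<nu>\<in>F. multiplicity_of (schroedinger h V) (of_real \<nu>))"
    by (intro sum_mono multiplicity_of_ge_card[OF e]) auto
  also have "\<dots> \<le> eigenvalue_count (schroedinger h V) {..\<Lambda>}"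
    by (rule eigenvalue_count_ge) (use \<mu> in \<open>auto simp: F_def\<close>)
  finally show ?thesis .
qed

text \<open>
  The min-max upper bound. A trial space of dimension \<open>k\<close> contains a nonzero vector orthogonal to any
  \<open>j < k\<close> given eigenvectors, so \<open>orthonormal_eigenvectors_extend\<close> can be iterated until there are \<open>k\<close>.
\<close>
lemma lambda_le_of_trial_space:
  assumes k: "k \<ge> 1" and \<Lambda>: "0 \<le> \<Lambda>"
    and indep: "\<And>c. (\<Sum>i<k. cscale (c i) (w i)) = 0 \<Longrightarrow> \<forall>i<k. c i = 0"
    and trial: "\<And>c. \<exists>b s. ((\<Sum>i<k. cscale (c i) (w i)), b, s) \<in> form_graph \<and>
      h\<^sup>2 * (norm b)\<^sup>2 + (norm s)\<^sup>2 \<le> \<Lambda> * (norm (\<Sum>i<k. cscale (c i) (w i)))\<^sup>2"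
  shows "lambda k (schroedinger h V) \<le> ereal \<Lambda>"
proof (rule lambda_upper_bound[OF k])
  assume ess: "ereal \<Lambda> < ess_bottom (schroedinger h V)"
  have "\<exists>e \<mu>. orthonormal_eigenvectors j e \<mu> \<and> (\<forall>i<j. \<mu> i \<le> \<Lambda>)" if "j \<le> k" for j
    using that
  proof (induction j)
    case 0
    then show ?case by (auto simp: orthonormal_eigenvectors_def)
  next
    case (Suc j)
    then obtain e \<mu> where e: "orthonormal_eigenvectors j e \<mu>" "\<forall>i<j. \<mu> i \<le> \<Lambda>" by auto
    obtain c where c: "\<exists>i\<in>{..<k}. c i \<noteq> 0" "\<forall>l\<in>{..<j}. (\<Sum>i<k. c i * cinner (w i) (e l)) = 0"
      using homogeneous_system_nontrivial_solution[of "{..<j}" "{..<k}" "\<lambda>l i. cinner (w i) (e l)"] Suc.prems by auto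
    define u where "u = (\<Sum>i<k. cscale (c i) (w i))"
    have u0: "u \<noteq> 0" using indep[of c] c(1) by (auto simp: u_def)
    have orth: "cinner u (e l) = 0" if "l < j" for l
      using c(2) that by (simp add: u_def cinner_sum_left cinner_cscale_left)
    obtain b s where bs: "(u, b, s) \<in> form_graph" "h\<^sup>2 * (norm b)\<^sup>2 + (norm s)\<^sup>2 \<le> \<Lambda> * (norm u)\<^sup>2"
      using trial[of c] unfolding u_def by blast
    obtain e' \<nu> where e': "\<nu> \<le> \<Lambda>" "orthonormal_eigenvectors (Suc j) (e(j := e')) (\<mu>(j := \<nu>))"
      by (rule orthonormal_eigenvectors_extend[OF ess \<Lambda> e(1) u0 orth bs])
    moreover have "\<forall>i<Suc j. (\<mu>(j := \<nu>)) i \<le> \<Lambda>" using e(2) e'(1) by (auto simp: less_Suc_eq)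
    ultimately show ?case by blast
  qed
  then show "enat k \<le> eigenvalue_count (schroedinger h V) {..\<Lambda>}"
    using eigenvalue_count_ge_orthonormal by blast
qed

end

section \<open>The form is large when the potential is large outside a window\<close>

lemma test_function_continuous_at: "test_function \<phi> \<Longrightarrow> isCont \<phi> x"
  using test_function_DERIV(1) DERIV_isCont by blast

text \<open>
  An antiderivative \<open>\<Theta>\<close> of \<open>\<phi>\<close> is constant to the left and to the right of the support of \<open>\<phi>\<close>, but in general
  not zero there. The difference \<open>\<Theta> x - \<Theta> (x - \<delta>)\<close> does have compact support.
\<close>
lemma test_function_window_integral:
  assumes \<phi>: "test_function \<phi>" and \<delta>: "0 \<le> \<delta>"
  obtains \<Psi> where "test_function \<Psi>" "\<And>x. deriv \<Psi> x = \<phi> x - \<phi> (x - \<delta>)"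
    "\<And>t. (LINT x|lborel. \<phi> x * indicator {t - \<delta>..t} x) = \<Psi> t"
proof -
  obtain \<Theta> where "\<forall>x::real. (-\<infinity>::ereal) < x \<longrightarrow> x < \<infinity> \<longrightarrow> (\<Theta> has_vector_derivative \<phi> x) (at x)"
    using einterval_antiderivative[of "-\<infinity>" "\<infinity>" \<phi>] test_function_continuous_at[OF \<phi>] by auto
  then have \<Theta>: "(\<Theta> has_real_derivative \<phi> x) (at x)" for x
    by (simp add: has_real_derivative_iff_has_vector_derivative)
  define \<Psi> where "\<Psi> x = \<Theta> x - \<Theta> (x - \<delta>)" for x
  have \<Psi>': "(\<Psi> has_real_derivative \<phi> x - \<phi> (x - \<delta>)) (at x)" for x
  proof -
    have "((\<lambda>x. \<Theta> (x + - \<delta>)) has_real_derivative \<phi> (x + - \<delta>)) (at x)"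
      using \<Theta>[of "x + - \<delta>"] by (subst (asm) DERIV_shift)
    then show ?thesis unfolding \<Psi>_def using \<Theta>[of x] by (intro DERIV_diff) simp_all
  qed
  have FTC: "(LINT x|lborel. \<phi> x * indicator {t - \<delta>..t} x) = \<Psi> t" for t
    unfolding \<Psi>_def
    by (rule integral_FTC_Icc_real) (use \<delta> \<Theta> test_function_continuous_at[OF \<phi>] in auto)
  have "times_differentiable n \<Psi>" for n
  proof (cases n)
    case (Suc m)
    have m: "times_differentiable m \<phi>" using \<phi> by (simp add: test_function_iff)
    have "times_differentiable m (\<lambda>x. \<phi> x + (- 1) * \<phi> (1 * x + - \<delta>))"
      by (rule times_differentiable_add[OF m times_differentiable_mult[OF times_differentiable_const
            times_differentiable_affine[OF m]]])
    then have "times_differentiable m (\<lambda>x. \<phi> x - \<phi> (x - \<delta>))" by simp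
    then show ?thesis unfolding Suc times_differentiable.simps
      by (intro exI[of _ "\<lambda>x. \<phi> x - \<phi> (x - \<delta>)"]) (simp add: \<Psi>')
  qed simp
  moreover obtain R where R: "\<And>x. \<phi> x \<noteq> 0 \<Longrightarrow> \<bar>x\<bar> \<le> R" using \<phi> unfolding test_function_iff by blast
  have "\<Psi> x = 0" if "\<not> \<bar>x\<bar> \<le> \<bar>R\<bar> + \<delta>" for x
  proof -
    have "\<phi> y = 0" if "y \<in> {x - \<delta>..x}" for y
    proof (rule ccontr)
      assume "\<phi> y \<noteq> 0"
      then have "\<bar>y\<bar> \<le> R" by (rule R)
      then show False using that \<open>\<not> \<bar>x\<bar> \<le> \<bar>R\<bar> + \<delta>\<close> \<delta> unfolding atLeastAtMost_iff by linarith
    qed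
    then have "(\<lambda>y. \<phi> y * indicator {x - \<delta>..x} y) = (\<lambda>y. 0)"
      by (intro ext) (simp split: split_indicator)
    then show ?thesis using FTC[of x] by simp
  qed
  ultimately have "test_function \<Psi>" unfolding test_function_iff by blast
  moreover have "deriv \<Psi> x = \<phi> x - \<phi> (x - \<delta>)" for x using \<Psi>' by (rule DERIV_imp_deriv)
  ultimately show ?thesis using that FTC by blast
qed

text \<open>
  Cauchy--Schwarz against the indicator function of an interval of length \<open>\<delta>\<close>.
\<close>
lemma window_integral_bound:
  assumes w: "w \<in> L2" and \<delta>: "0 \<le> \<delta>"
  shows "(cmod (LINT t|lborel. w t * of_real (indicator {x..x + \<delta>} t)))\<^sup>2 \<le> \<delta> * (LINT t|lborel. (cmod (w t))\<^sup>2)"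
proof -
  let ?i = "\<lambda>t. complex_of_real (indicator {x..x + \<delta>} t)"
  have "(LINT t|lborel. w t * ?i t) = L2_inner w ?i" by (simp add: L2_inner_def)
  then have "cmod (LINT t|lborel. w t * ?i t) \<le> L2_norm w * L2_norm ?i"
    using norm_cinner_le[of "to_l2 w" "to_l2 ?i"] w L2_indicator by (simp add: cinner_to_l2 norm_to_l2)
  then have "(cmod (LINT t|lborel. w t * ?i t))\<^sup>2 \<le> (L2_norm w * L2_norm ?i)\<^sup>2" by (intro power_mono) auto
  also have "\<dots> = (LINT t|lborel. (cmod (w t))\<^sup>2) * (LINT t|lborel. (cmod (?i t))\<^sup>2)"
    by (simp only: power_mult_distrib L2_norm_square)
  also have "(\<lambda>t. (cmod (?i t))\<^sup>2) = indicator {x..x + \<delta>}" by (auto simp: indicator_def)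
  also have "(LINT t|lborel. indicator {x..x + \<delta>} t) = \<delta>" using \<delta> by simp
  finally show ?thesis by (simp add: mult.commute)
qed

lemma L2_shift: assumes "u \<in> L2" shows "(\<lambda>x. u (x + \<delta>)) \<in> L2"
proof (rule L2_I)
  have [measurable]: "u \<in> borel_measurable borel" using assms by (rule L2_measurable)
  show "(\<lambda>x. u (x + \<delta>)) \<in> borel_measurable borel" by measurable
  show "integrable lborel (\<lambda>x. (cmod (u (x + \<delta>)))\<^sup>2)"
    using lborel_integrable_real_affine[OF L2_square_integrable[OF assms], of 1 \<delta>] by (simp add: add.commute)
qed

text \<open>
  Tested against \<open>\<phi>\<close>, the left-hand side becomes the integral of \<open>- u \<Psi>'\<close> with \<open>\<Psi>' x = \<phi> x - \<phi> (x - \<delta>)\<close>, that is,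
  of \<open>w \<Psi>\<close>. Since \<open>\<Psi> t\<close> is the integral of \<open>\<phi>\<close> over \<open>[t - \<delta>, t]\<close>, Fubini's theorem gives the right-hand side.
\<close>
lemma weak_deriv_difference:
  assumes u: "u \<in> L2" and w: "w \<in> L2" and wd: "has_weak_deriv u w" and \<delta>: "0 \<le> \<delta>"
  shows "AE x in lborel. u (x + \<delta>) - u x = (LINT t|lborel. w t * of_real (indicator {x..x + \<delta>} t))"
proof -
  define A where "A x = (LINT t|lborel. w t * of_real (indicator {x..x + \<delta>} t))" for x
  have um [measurable]: "u \<in> borel_measurable borel" and wm [measurable]: "w \<in> borel_measurable borel"
    using u w L2_measurable by auto
  have Am [measurable]: "A \<in> borel_measurable borel"
  proof -
    have "(\<lambda>(x, t). w t * of_real (indicator {x..x + \<delta>} t)) = (\<lambda>p. w (snd p) * of_real (indicator {p. fst p \<le> snd p \<and> snd p \<le> fst p + \<delta>} p))"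
      by (auto simp: indicator_def)
    also have "\<dots> \<in> borel_measurable (borel \<Otimes>\<^sub>M lborel)" by measurable
    finally show ?thesis unfolding A_def[abs_def] by (rule lborel.borel_measurable_lebesgue_integral)
  qed
  define K where "K = sqrt (\<delta> * (LINT t|lborel. (cmod (w t))\<^sup>2))"
  have AK: "cmod (A x) \<le> K" for x
    unfolding K_def A_def by (rule real_le_rsqrt) (rule window_integral_bound[OF w \<delta>])
  have Aint: "integrable lborel (\<lambda>x. indicator {-R..R} x *\<^sub>R A x)" for R
  proof (rule Bochner_Integration.integrable_bound)
    show "integrable lborel (\<lambda>x. indicator {-R..R} x * K)"
      by (intro integrable_mult_left integrable_real_indicator) (auto simp: emeasure_lborel_Icc_eq)
    have "0 \<le> K" using AK[of 0] norm_ge_zero order_trans by blast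
    then show "AE x in lborel. norm (indicator {-R..R} x *\<^sub>R A x) \<le> norm (indicator {-R..R} x * K)"
      using AK by (auto simp: indicator_def)
  qed measurable
  have "AE x in lborel. (u (x + \<delta>) - u x) - A x = 0"
  proof (rule fundamental_lemma)
    fix R
    show "integrable lborel (\<lambda>x. indicator {-R..R} x *\<^sub>R ((u (x + \<delta>) - u x) - A x))"
      unfolding scaleR_right_diff_distrib[of _ _ "A _"]
      by (intro Bochner_Integration.integrable_diff Aint L2_locally_integrable[OF L2_diff[OF L2_shift[OF u] u]])
  next
    fix \<phi> assume \<phi>: "test_function \<phi>"
    obtain \<Psi> where \<Psi>: "test_function \<Psi>" "\<And>x. deriv \<Psi> x = \<phi> x - \<phi> (x - \<delta>)"
      "\<And>t. (LINT x|lborel. \<phi> x * indicator {t - \<delta>..t} x) = \<Psi> t"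
      using test_function_window_integral[OF \<phi> \<delta>] by metis
    have \<phi>m [measurable]: "\<phi> \<in> borel_measurable borel"
      using test_function_continuous[OF \<phi>] by (rule borel_measurable_continuous_onI)
    have \<phi>L: "(\<lambda>x. of_real (\<phi> x)) \<in> L2" by (rule test_function_L2[OF \<phi>])
    have \<phi>sL: "(\<lambda>x. of_real (\<phi> (x - \<delta>))) \<in> L2" using L2_shift[OF \<phi>L, of "- \<delta>"] by simp
    have i1: "integrable lborel (\<lambda>x. u (x + \<delta>) * of_real (\<phi> x))" by (rule L2_mult_integrable(1)[OF L2_shift[OF u] \<phi>L])
    have i2: "integrable lborel (\<lambda>x. u x * of_real (\<phi> x))" by (rule L2_mult_integrable(1)[OF u \<phi>L])
    have i3: "integrable lborel (\<lambda>x. u x * of_real (\<phi> (x - \<delta>)))" by (rule L2_mult_integrable(1)[OF u \<phi>sL])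
    have "(LINT x|lborel. (u (x + \<delta>) - u x) * of_real (\<phi> x))
        = (LINT x|lborel. u (x + \<delta>) * of_real (\<phi> x)) - (LINT x|lborel. u x * of_real (\<phi> x))"
      using i1 i2 by (simp add: left_diff_distrib)
    also have "(LINT x|lborel. u (x + \<delta>) * of_real (\<phi> x)) = (LINT x|lborel. u x * of_real (\<phi> (x - \<delta>)))"
      using lborel_integral_real_affine[of 1 "\<lambda>x. u x * of_real (\<phi> (x - \<delta>))" \<delta>] by (simp add: add.commute)
    also have "\<dots> - (LINT x|lborel. u x * of_real (\<phi> x)) = (LINT x|lborel. - (u x * of_real (deriv \<Psi> x)))"
      using i2 i3 by (simp add: \<Psi>(2) right_diff_distrib)
    also have "\<dots> = (LINT x|lborel. w x * of_real (\<Psi> x))"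
      using wd \<Psi>(1) by (simp add: has_weak_deriv_def)
    finally have 1: "(LINT x|lborel. (u (x + \<delta>) - u x) * of_real (\<phi> x)) = (LINT x|lborel. w x * of_real (\<Psi> x))" .
    obtain R where R: "\<And>x. \<phi> x \<noteq> 0 \<Longrightarrow> \<bar>x\<bar> \<le> R" using \<phi> unfolding test_function_iff by blast
    define F where "F x t = w t * of_real (indicator {x..x + \<delta>} t * \<phi> x)" for x t
    \<comment> \<open>A product that dominates \<open>F\<close>: if \<open>\<bar>x\<bar> \<le> R\<close> and \<open>x \<le> t \<le> x + \<delta>\<close>, then \<open>\<bar>t\<bar> \<le> \<bar>R\<bar> + \<delta>\<close>.\<close>
    define H where "H x t = of_real (\<phi> x) * (indicator {-(\<bar>R\<bar> + \<delta>)..\<bar>R\<bar> + \<delta>} t *\<^sub>R w t)" for x t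
    have \<phi>i: "integrable lborel (\<lambda>x. \<bar>\<phi> x\<bar>)"
    proof -
      have "integrable lborel (\<lambda>x. norm (indicator {-\<bar>R\<bar>..\<bar>R\<bar>} x *\<^sub>R complex_of_real (\<phi> x)))"
        by (intro integrable_norm L2_locally_integrable \<phi>L)
      moreover have "(\<lambda>x. norm (indicator {-\<bar>R\<bar>..\<bar>R\<bar>} x *\<^sub>R complex_of_real (\<phi> x))) = (\<lambda>x. \<bar>\<phi> x\<bar>)"
        using R by (fastforce simp: indicator_def abs_le_iff)
      ultimately show ?thesis by simp
    qed
    have Fm: "case_prod F \<in> borel_measurable (lborel \<Otimes>\<^sub>M lborel)"
    proof -
      have "case_prod F = (\<lambda>p. w (snd p) * of_real (indicator {p. fst p \<le> snd p \<and> snd p \<le> fst p + \<delta>} p * \<phi> (fst p)))"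
        by (auto simp: indicator_def F_def)
      also have "\<dots> \<in> borel_measurable (lborel \<Otimes>\<^sub>M lborel)" by measurable
      finally show ?thesis .
    qed
    have Hint: "integrable (lborel \<Otimes>\<^sub>M lborel) (case_prod H)"
    proof (rule lborel_pair.Fubini_integrable)
      show "case_prod H \<in> borel_measurable (lborel \<Otimes>\<^sub>M lborel)" unfolding H_def by measurable
      show "integrable lborel (\<lambda>x. LINT t|lborel. norm (case (x, t) of (x, t) \<Rightarrow> H x t))"
        unfolding split_conv H_def norm_mult norm_of_real integral_mult_right_zero
        by (rule integrable_mult_left) (rule \<phi>i)
      show "AE x in lborel. integrable lborel (\<lambda>t. case (x, t) of (x, t) \<Rightarrow> H x t)"
        unfolding split_conv H_def by (intro AE_I2 integrable_mult_right L2_locally_integrable w)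
    qed
    have "integrable (lborel \<Otimes>\<^sub>M lborel) (case_prod F)"
    proof (rule Bochner_Integration.integrable_bound[OF Hint Fm])
      have "norm (F x t) \<le> norm (H x t)" for x t
        using R[of x] by (cases "\<phi> x = 0") (auto simp: F_def H_def norm_mult indicator_def abs_le_iff)
      then show "AE p in lborel \<Otimes>\<^sub>M lborel. norm (case_prod F p) \<le> norm (case_prod H p)" by auto
    qed
    then have "(LINT t|lborel. LINT x|lborel. F x t) = (LINT x|lborel. LINT t|lborel. F x t)"
      by (rule lborel_pair.Fubini_integral)
    moreover have "(LINT t|lborel. F x t) = A x * of_real (\<phi> x)" for x
      unfolding A_def by (simp add: F_def mult_ac flip: integral_mult_right_zero)
    moreover have "(LINT x|lborel. F x t) = w t * of_real (\<Psi> t)" for t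
    proof -
      have "(\<lambda>x. F x t) = (\<lambda>x. w t * of_real (\<phi> x * indicator {t - \<delta>..t} x))"
        unfolding F_def by (rule ext) (auto split: split_indicator)
      then show ?thesis by (simp only: integral_mult_right_zero integral_complex_of_real \<Psi>(3))
    qed
    ultimately have 2: "(LINT x|lborel. A x * of_real (\<phi> x)) = (LINT x|lborel. w x * of_real (\<Psi> x))" by simp
    have i4: "integrable lborel (\<lambda>x. A x * of_real (\<phi> x))"
      using lborel_pair.integrable_fst'[OF \<open>integrable (lborel \<Otimes>\<^sub>M lborel) (case_prod F)\<close>]
        \<open>\<And>x. (LINT t|lborel. F x t) = A x * of_real (\<phi> x)\<close> by simp
    have i5: "integrable lborel (\<lambda>x. (u (x + \<delta>) - u x) * of_real (\<phi> x))"
      by (rule L2_mult_integrable(1)[OF L2_diff[OF L2_shift[OF u] u] \<phi>L])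
    show "(LINT x|lborel. ((u (x + \<delta>) - u x) - A x) * of_real (\<phi> x)) = 0"
      using i4 i5 1 2 by (simp add: left_diff_distrib[of _ "A _"])
  qed measurable
  then show ?thesis by (simp add: A_def)
qed

text \<open>
  Translation by \<open>\<delta>\<close> moves the window off itself. On the window \<open>\<bar>u x\<bar>\<^sup>2 \<le> 2 \<bar>u (x + \<delta>)\<bar>\<^sup>2 + 2 \<delta> \<parallel>w\<parallel>\<^sup>2\<close>, and
  integration over the window, which has length \<open>\<delta>\<close>, bounds its mass by twice the mass outside plus
  \<open>2 \<delta>\<^sup>2 \<parallel>w\<parallel>\<^sup>2\<close>.
\<close>
lemma poincare_with_window:
  assumes u: "u \<in> L2" and w: "w \<in> L2" and wd: "has_weak_deriv u w" and \<delta>: "0 \<le> \<delta>"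
  shows "(LINT x|lborel. (cmod (u x))\<^sup>2)
    \<le> 3 * (LINT x|lborel. indicator (- {a<..<a + \<delta>}) x * (cmod (u x))\<^sup>2) + 2 * \<delta>\<^sup>2 * (LINT x|lborel. (cmod (w x))\<^sup>2)"
proof -
  define W where "W = (LINT t|lborel. (cmod (w t))\<^sup>2)"
  define q where "q x = (cmod (u x))\<^sup>2" for x
  let ?I = "{a<..<a + \<delta>}"
  have qi: "integrable lborel q" unfolding q_def by (rule L2_square_integrable[OF u])
  have qsi: "integrable lborel (\<lambda>x. q (x + \<delta>))" unfolding q_def by (rule L2_square_integrable[OF L2_shift[OF u]])
  have ind: "integrable lborel (\<lambda>x. indicator A x * f x)" if "A \<in> sets borel" "integrable lborel f" for A and f :: "real \<Rightarrow> real"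
    using integrable_mult_indicator[of A lborel f] that by simp
  have ae: "AE x in lborel. q x \<le> indicator (- ?I) x * q x + 2 * (indicator ?I x * q (x + \<delta>)) + 2 * \<delta> * W * indicator ?I x"
    using weak_deriv_difference[OF u w wd \<delta>]
  proof eventually_elim
    fix x
    define A where "A = (LINT t|lborel. w t * of_real (indicator {x..x + \<delta>} t))"
    assume "u (x + \<delta>) - u x = (LINT t|lborel. w t * of_real (indicator {x..x + \<delta>} t))"
    then have ux: "u x = u (x + \<delta>) + - A" unfolding A_def by (simp add: algebra_simps)
    have "q x \<le> 2 * q (x + \<delta>) + 2 * (cmod (- A))\<^sup>2" unfolding q_def ux by (rule cmod_add_square_le)
    also have "\<dots> \<le> 2 * q (x + \<delta>) + 2 * (\<delta> * W)"
      using window_integral_bound[OF w \<delta>, of x] by (simp add: A_def W_def)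
    finally show "q x \<le> indicator (- ?I) x * q x + 2 * (indicator ?I x * q (x + \<delta>)) + 2 * \<delta> * W * indicator ?I x"
      by (auto simp: indicator_def)
  qed
  have iI: "integrable lborel (indicator ?I :: real \<Rightarrow> real)"
    by (rule integrable_real_indicator) (auto simp: emeasure_lborel_Ioo \<delta>)
  have "(LINT x|lborel. q x) \<le> (LINT x|lborel. indicator (- ?I) x * q x + 2 * (indicator ?I x * q (x + \<delta>)) + 2 * \<delta> * W * indicator ?I x)"
    by (rule integral_mono_AE[OF qi _ ae])
       (intro Bochner_Integration.integrable_add integrable_mult_right ind iI qi qsi; simp)
  also have "\<dots> = (LINT x|lborel. indicator (- ?I) x * q x) + 2 * (LINT x|lborel. indicator ?I x * q (x + \<delta>)) + 2 * \<delta> * W * \<delta>"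
    using ind[OF _ qi, of "- ?I"] ind[OF _ qsi, of ?I] iI \<delta> by simp
  also have "(LINT x|lborel. indicator ?I x * q (x + \<delta>)) = (LINT x|lborel. indicator ?I (x - \<delta>) * q x)"
    using lborel_integral_real_affine[of 1 "\<lambda>x. indicator ?I (x - \<delta>) * q x" \<delta>] by (simp add: add.commute)
  also have "\<dots> \<le> (LINT x|lborel. indicator (- ?I) x * q x)"
  proof (rule integral_mono)
    have "(\<lambda>x. indicator ?I (x - \<delta>) * q x) = (\<lambda>x. indicator {a + \<delta><..<a + 2 * \<delta>} x * q x)"
      by (auto simp: indicator_def less_diff_eq add.commute)
    then show "integrable lborel (\<lambda>x. indicator ?I (x - \<delta>) * q x)" using ind[OF _ qi] by simp
    show "integrable lborel (\<lambda>x. indicator (- ?I) x * q x)" by (rule ind[OF _ qi]) simp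
    show "indicator ?I (x - \<delta>) * q x \<le> indicator (- ?I) x * q x" for x by (auto simp: indicator_def q_def)
  qed
  finally show ?thesis by (simp add: q_def W_def power2_eq_square algebra_simps)
qed

context schroedinger_potential
begin

text \<open>
  Multiply \<open>poincare_with_window\<close> by \<open>E = h\<^sup>2 / \<delta>\<^sup>2\<close>: outside the window \<open>E \<le> V\<close>, and \<open>E \<delta>\<^sup>2 = h\<^sup>2\<close>.
\<close>
lemma form_lower_bound:
  assumes g: "(p, b, c) \<in> form_graph" and \<delta>: "0 < \<delta>" and outside: "\<And>x. x \<notin> {a<..<a + \<delta>} \<Longrightarrow> h\<^sup>2 / \<delta>\<^sup>2 \<le> V x"
  shows "h\<^sup>2 / \<delta>\<^sup>2 / 3 * (norm p)\<^sup>2 \<le> h\<^sup>2 * (norm b)\<^sup>2 + (norm c)\<^sup>2"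
proof -
  define E where "E = h\<^sup>2 / \<delta>\<^sup>2"
  have E: "0 \<le> E" "E * \<delta>\<^sup>2 = h\<^sup>2" using \<delta> by (auto simp: E_def)
  from form_graph_cases[OF g] obtain u where
    u: "u \<in> form_dom" "p = to_l2 u" "b = to_l2 (weak_deriv u)" "c = to_l2 (sqrt_mult V u)" by blast
  note d = domD[OF u(1)]
  define U W S where "U = (LINT x|lborel. (cmod (u x))\<^sup>2)" and "W = (LINT x|lborel. (cmod (weak_deriv u x))\<^sup>2)"
    and "S = (LINT x|lborel. (cmod (sqrt_mult V u x))\<^sup>2)"
  have n: "(norm p)\<^sup>2 = U" "(norm b)\<^sup>2 = W" "(norm c)\<^sup>2 = S"
    using d u by (simp_all add: norm_to_l2 L2_norm_square U_def W_def S_def)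
  define O' where "O' = (LINT x|lborel. indicator (- {a<..<a + \<delta>}) x * (cmod (u x))\<^sup>2)"
  have "U \<le> 3 * O' + 2 * \<delta>\<^sup>2 * W"
    unfolding U_def O'_def W_def by (rule poincare_with_window[OF d(1,2,3)]) (use \<delta> in simp)
  then have "E * U \<le> 3 * (E * O') + 2 * (E * \<delta>\<^sup>2) * W"
    using mult_left_mono[OF _ E(1)] by (fastforce simp: algebra_simps)
  also have "E * O' \<le> S"
  proof -
    have i: "integrable lborel (\<lambda>x. indicator (- {a<..<a + \<delta>}) x * (cmod (u x))\<^sup>2)"
      using integrable_mult_indicator[OF _ L2_square_integrable[OF d(1)], of "- {a<..<a + \<delta>}"] by simp
    have "E * O' = (LINT x|lborel. E * (indicator (- {a<..<a + \<delta>}) x * (cmod (u x))\<^sup>2))"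
      by (simp add: O'_def)
    also have "\<dots> \<le> S" unfolding S_def
    proof (rule integral_mono)
      show "integrable lborel (\<lambda>x. E * (indicator (- {a<..<a + \<delta>}) x * (cmod (u x))\<^sup>2))" using i by simp
      show "integrable lborel (\<lambda>x. (cmod (sqrt_mult V u x))\<^sup>2)" by (rule L2_square_integrable[OF d(4)])
      show "E * (indicator (- {a<..<a + \<delta>}) x * (cmod (u x))\<^sup>2) \<le> (cmod (sqrt_mult V u x))\<^sup>2" for x
        using outside[of x] V_nonneg[of x] unfolding E_def[symmetric]
        by (auto simp: sqrt_mult_def norm_mult power_mult_distrib indicator_def intro!: mult_right_mono)
    qed
    finally show ?thesis .
  qed
  finally have "E * U \<le> 3 * S + 2 * h\<^sup>2 * W" by (simp add: E(2))
  moreover have "0 \<le> h\<^sup>2 * W" unfolding W_def by (intro mult_nonneg_nonneg integral_nonneg) auto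
  ultimately show ?thesis unfolding n E_def[symmetric] by simp
qed

end

section \<open>Trial functions in a window\<close>

lemma LINT_Ioo_eq_Icc:
  fixes f :: "real \<Rightarrow> real"
  assumes [measurable]: "f \<in> borel_measurable borel"
  shows "(LINT x|lborel. f x * indicator {a<..<b} x) = (LINT x|lborel. f x * indicator {a..b} x)"
proof (rule integral_cong_AE)
  show "AE x in lborel. f x * indicator {a<..<b} x = f x * indicator {a..b} x"
    using AE_lborel_singleton[of a] AE_lborel_singleton[of b]
    by eventually_elim (auto simp: indicator_def)
qed measurable

text \<open>
  A parabola over \<open>(a, b)\<close>; the function \<open>hat'\<close> below is its weak derivative. The quotient of the integrals of
  \<open>hat'\<^sup>2\<close> and \<open>hat\<^sup>2\<close> is \<open>10 / (b - a)\<^sup>2\<close>. Open intervals make the supports of the derivatives of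
  neighbouring hats disjoint as well.
\<close>
definition hat :: "real \<Rightarrow> real \<Rightarrow> real \<Rightarrow> real" where
  "hat a b x = (x - a) * (b - x) * indicator {a<..<b} x"

definition hat' :: "real \<Rightarrow> real \<Rightarrow> real \<Rightarrow> real" where
  "hat' a b x = (a + b - 2 * x) * indicator {a<..<b} x"

lemma hat_continuous: "a < b \<Longrightarrow> continuous_on UNIV (hat a b)"
proof -
  assume ab: "a < b"
  have "hat a b = (\<lambda>x. max 0 ((x - a) * (b - x)))"
  proof
    fix x
    have "0 < (x - a) * (b - x) \<longleftrightarrow> x \<in> {a<..<b}" using ab by (auto simp: zero_less_mult_iff)
    then show "hat a b x = max 0 ((x - a) * (b - x))" by (auto simp: hat_def max_def indicator_def)
  qed
  then show ?thesis by (auto intro!: continuous_intros)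
qed

lemma hat_bounded_support: "hat a b x \<noteq> 0 \<Longrightarrow> \<bar>x\<bar> \<le> \<bar>a\<bar> + \<bar>b\<bar>"
  by (auto simp: hat_def indicator_def split: if_splits)

lemma hat_L2: "a < b \<Longrightarrow> (\<lambda>x. of_real (hat a b x)) \<in> L2"
  using hat_bounded_support
  by (intro L2_continuous_compact_support[where R = "\<bar>a\<bar> + \<bar>b\<bar>"] continuous_intros hat_continuous) auto

lemma integral_hat_square:
  assumes "a < b"
  shows "(LINT x|lborel. (hat a b x)\<^sup>2) = (b - a) ^ 5 / 30"
proof -
  define l where "l = b - a"
  define F where "F x = l\<^sup>2 * (x - a) ^ 3 / 3 - l * (x - a) ^ 4 / 2 + (x - a) ^ 5 / 5" for x
  have "(LINT x|lborel. (hat a b x)\<^sup>2) = (LINT x|lborel. ((x - a) * (b - x))\<^sup>2 * indicator {a<..<b} x)"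
    by (rule Bochner_Integration.integral_cong) (auto simp: hat_def indicator_def)
  also have "\<dots> = (LINT x|lborel. ((x - a) * (b - x))\<^sup>2 * indicator {a..b} x)" by (rule LINT_Ioo_eq_Icc) measurable
  also have "\<dots> = F b - F a"
  proof (rule integral_FTC_Icc_real)
    fix x
    have b: "b = a + l" by (simp add: l_def)
    show "(F has_real_derivative ((x - a) * (b - x))\<^sup>2) (at x)"
      unfolding F_def b by (auto intro!: derivative_eq_intros simp: field_simps power2_eq_square power3_eq_cube eval_nat_numeral)
  qed (use assms in \<open>auto intro!: continuous_intros\<close>)
  also have "\<dots> = l ^ 5 / 30" by (simp add: F_def flip: l_def) (simp add: eval_nat_numeral)
  finally show ?thesis by (simp add: l_def)
qed

lemma hat'_square_integral:
  assumes "a < b"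
  shows "integrable lborel (\<lambda>x. (hat' a b x)\<^sup>2)" "(LINT x|lborel. (hat' a b x)\<^sup>2) = (b - a) ^ 3 / 3"
proof -
  define F where "F x = - ((a + b - 2 * x) ^ 3) / 6" for x
  have eq: "(\<lambda>x. (hat' a b x)\<^sup>2) = (\<lambda>x. (a + b - 2 * x)\<^sup>2 * indicator {a<..<b} x)"
    by (auto simp: hat'_def indicator_def)
  have bi: "has_bochner_integral lborel (\<lambda>x. (a + b - 2 * x)\<^sup>2 * indicator {a..b} x) (F b - F a)"
  proof (rule has_bochner_integral_FTC_Icc_real)
    show "(F has_real_derivative (a + b - 2 * x)\<^sup>2) (at x)" for x
      unfolding F_def by (auto intro!: derivative_eq_intros)
  qed (use assms in \<open>auto intro!: continuous_intros\<close>)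
  have "integrable lborel (\<lambda>x. indicator {a<..<b} x *\<^sub>R ((a + b - 2 * x)\<^sup>2 * indicator {a..b} x))"
    using bi by (intro integrable_mult_indicator) (auto simp: has_bochner_integral_iff)
  moreover have "(\<lambda>x. indicator {a<..<b} x *\<^sub>R ((a + b - 2 * x)\<^sup>2 * indicator {a..b} x)) = (\<lambda>x. (a + b - 2 * x)\<^sup>2 * indicator {a<..<b} x)"
    by (auto simp: indicator_def)
  ultimately show "integrable lborel (\<lambda>x. (hat' a b x)\<^sup>2)" by (simp add: eq)
  have "(LINT x|lborel. (hat' a b x)\<^sup>2) = (LINT x|lborel. (a + b - 2 * x)\<^sup>2 * indicator {a..b} x)"
    unfolding eq by (rule LINT_Ioo_eq_Icc) measurable
  also have "\<dots> = F b - F a" using bi by (simp add: has_bochner_integral_iff)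
  also have "\<dots> = (b - a) ^ 3 / 3" by (simp add: F_def eval_nat_numeral field_simps)
  finally show "(LINT x|lborel. (hat' a b x)\<^sup>2) = (b - a) ^ 3 / 3" .
qed

lemma hat'_measurable: "hat' a b \<in> borel_measurable borel"
  unfolding hat'_def[abs_def] by measurable

lemma hat'_L2: "a < b \<Longrightarrow> (\<lambda>x. of_real (hat' a b x)) \<in> L2"
  using hat'_square_integral(1)[of a b] hat'_measurable[of a b] by (intro L2_I) auto

text \<open>
  Integration by parts; there are no boundary terms because the parabola vanishes at \<open>a\<close> and \<open>b\<close>.
\<close>
lemma has_weak_deriv_hat:
  assumes "a < b"
  shows "has_weak_deriv (\<lambda>x. of_real (hat a b x)) (\<lambda>x. of_real (hat' a b x))"
  unfolding has_weak_deriv_def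
proof (intro allI impI)
  fix \<phi> assume \<phi>: "test_function \<phi>"
  have [measurable]: "\<phi> \<in> borel_measurable borel" "deriv \<phi> \<in> borel_measurable borel"
    using test_function_continuous[OF \<phi>] test_function_continuous[OF test_function_DERIV(2)[OF \<phi>]]
    by (auto intro: borel_measurable_continuous_onI)
  define f where "f x = (a + b - 2 * x) * \<phi> x + (x - a) * (b - x) * deriv \<phi> x" for x
  have "(LINT x|lborel. of_real (hat a b x) * of_real (deriv \<phi> x)) + (LINT x|lborel. of_real (hat' a b x) * complex_of_real (\<phi> x))
      = (LINT x|lborel. of_real (hat a b x) * of_real (deriv \<phi> x) + of_real (hat' a b x) * complex_of_real (\<phi> x))"
    by (rule Bochner_Integration.integral_add[symmetric])
       (intro L2_mult_integrable(1) hat_L2 hat'_L2 assms test_function_L2 test_function_DERIV(2) \<phi>)+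
  also have "\<dots> = (LINT x|lborel. complex_of_real (f x * indicator {a<..<b} x))"
    by (rule Bochner_Integration.integral_cong) (auto simp: f_def hat_def hat'_def indicator_def)
  also have "\<dots> = of_real (LINT x|lborel. f x * indicator {a<..<b} x)" by (rule integral_complex_of_real)
  also have "(LINT x|lborel. f x * indicator {a<..<b} x) = (LINT x|lborel. f x * indicator {a..b} x)"
    by (rule LINT_Ioo_eq_Icc) (unfold f_def, measurable)
  also have "\<dots> = (b - a) * (b - b) * \<phi> b - (a - a) * (b - a) * \<phi> a"
  proof (rule integral_FTC_Icc_real)
    fix x
    show "((\<lambda>x. (x - a) * (b - x) * \<phi> x) has_real_derivative f x) (at x)"
      unfolding f_def
      by (auto intro!: derivative_eq_intros test_function_DERIV(1)[OF \<phi>] simp: algebra_simps)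
    show "isCont f x"
      unfolding f_def
      by (intro continuous_intros test_function_continuous_at \<phi> test_function_DERIV(2))
  qed (use assms in simp)
  finally show "(LINT x|lborel. complex_of_real (hat a b x) * of_real (deriv \<phi> x))
      = - (LINT x|lborel. complex_of_real (hat' a b x) * of_real (\<phi> x))"
    by (simp add: eq_neg_iff_add_eq_0)
qed

lemma norm_sum_orthogonal:
  fixes k :: nat
  assumes "\<And>i l. i < k \<Longrightarrow> l < k \<Longrightarrow> i \<noteq> l \<Longrightarrow> cinner (f i) (f l) = 0"
  shows "(norm (\<Sum>i<k. cscale (c i) (f i)))\<^sup>2 = (\<Sum>i<k. (cmod (c i))\<^sup>2 * (norm (f i))\<^sup>2)"
  using assms
proof (induction k)
  case (Suc k)
  have "cinner (\<Sum>i<k. cscale (c i) (f i)) (cscale (c k) (f k)) = 0"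
    unfolding cinner_sum_left
    by (rule sum.neutral) (use Suc.prems in \<open>auto simp: cinner_cscale_left cinner_cscale_right\<close>)
  then have "inner (\<Sum>i<k. cscale (c i) (f i)) (cscale (c k) (f k)) = 0" by (simp add: inner_l2_def)
  then have "(norm ((\<Sum>i<k. cscale (c i) (f i)) + cscale (c k) (f k)))\<^sup>2
      = (norm (\<Sum>i<k. cscale (c i) (f i)))\<^sup>2 + (norm (cscale (c k) (f k)))\<^sup>2"
    unfolding power2_norm_eq_inner by (simp add: inner_add inner_commute)
  then show ?case using Suc by (simp add: norm_cscale power_mult_distrib)
qed simp

lemma cinner_disjoint_support:
  assumes "u \<in> L2" "v \<in> L2" "\<And>x. u x = 0 \<or> v x = 0"
  shows "cinner (to_l2 u) (to_l2 v) = 0"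
proof -
  have "(\<lambda>x. u x * cnj (v x)) = (\<lambda>x. 0)" using assms(3) by (metis complex_cnj_zero mult_zero_left mult_zero_right)
  then show ?thesis using assms by (simp add: cinner_to_l2 L2_inner_def)
qed

lemma norm_to_l2_real:
  assumes "(\<lambda>x. complex_of_real (f x)) \<in> L2"
  shows "(norm (to_l2 (\<lambda>x. of_real (f x))))\<^sup>2 = (LINT x|lborel. (f x)\<^sup>2)"
  using assms by (simp add: norm_to_l2 L2_norm_square)

context schroedinger_operator
begin

lemma form_graph_sum:
  assumes "\<And>i. i < (k::nat) \<Longrightarrow> (a i, b i, s i) \<in> form_graph"
  shows "(\<Sum>i<k. cscale (c i) (a i), \<Sum>i<k. cscale (c i) (b i), \<Sum>i<k. cscale (c i) (s i)) \<in> form_graph"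
  using assms
proof (induction k)
  case 0
  then show ?case using subspace_0[OF subspace_form_graph] by (simp add: zero_prod_def)
next
  case (Suc k)
  have "(\<Sum>i<k. cscale (c i) (a i), \<Sum>i<k. cscale (c i) (b i), \<Sum>i<k. cscale (c i) (s i)) \<in> form_graph"
    by (rule Suc.IH) (use Suc.prems in auto)
  from subspace_add[OF subspace_form_graph this cscale_form_graph[of "a k" "b k" "s k" "c k"]] Suc.prems[of k]
  show ?case by simp
qed

text \<open>
  The trial space is spanned by hats on the \<open>k\<close> parts of the window. The supports are disjoint, so all
  norms are sums over the hats and it suffices to compare the energies of a single one.
\<close>
lemma lambda_le_window:
  assumes k: "k \<ge> 1" and \<delta>: "0 < \<delta>"
    and inside: "\<And>x. x \<in> {a<..<a + \<delta>} \<Longrightarrow> V x \<le> h\<^sup>2 / \<delta>\<^sup>2"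
  shows "lambda k (schroedinger h V) \<le> ereal ((10 * (real k)\<^sup>2 + 1) * (h\<^sup>2 / \<delta>\<^sup>2))"
proof -
  define E where "E = h\<^sup>2 / \<delta>\<^sup>2"
  have E: "0 \<le> E" by (simp add: E_def)
  define l where "l = \<delta> / real k"
  have kl: "real k * l = \<delta>" using k by (simp add: l_def)
  have l: "0 < l" using k \<delta> by (simp add: l_def)
  define p where "p i = a + real i * l" for i :: nat
  have p: "p i < p i + l" for i using l by simp
  have disj: "{p i<..<p i + l} \<inter> {p j<..<p j + l} = {}" if "i \<noteq> j" for i j
  proof -
    have *: "p i + l \<le> p j" if "i < j" for i j
    proof -
      have "real (Suc i) * l \<le> real j * l" using that l by (intro mult_right_mono) auto
      then show ?thesis by (simp add: p_def algebra_simps)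
    qed
    show ?thesis using *[of i j] *[of j i] that by (cases "i < j") (auto simp: not_less le_less)
  qed
  have sub: "{p i<..<p i + l} \<subseteq> {a<..<a + \<delta>}" if "i < k" for i
  proof -
    have "real (Suc i) * l \<le> real k * l" using that l by (intro mult_right_mono) auto
    then have "p i + l \<le> a + \<delta>" using kl by (simp add: p_def algebra_simps)
    moreover have "a \<le> p i" using l by (simp add: p_def)
    ultimately show ?thesis by auto
  qed
  define u where "u i x = complex_of_real (hat (p i) (p i + l) x)" for i x
  define u' where "u' i x = complex_of_real (hat' (p i) (p i + l) x)" for i x
  define s where "s i = sqrt_mult V (u i)" for i
  have uL: "u i \<in> L2" for i unfolding u_def[abs_def] by (rule hat_L2[OF p])
  have u'L: "u' i \<in> L2" for i unfolding u'_def[abs_def] by (rule hat'_L2[OF p])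
  have sL: "s i \<in> L2" for i
    unfolding s_def sqrt_mult_def u_def
    by (rule L2_continuous_compact_support[where R = "\<bar>p i\<bar> + \<bar>p i + l\<bar>"])
       (use hat_bounded_support hat_continuous[OF p] V_cont in \<open>auto intro!: continuous_intros\<close>)
  have graph: "(to_l2 (u i), to_l2 (u' i), to_l2 (s i)) \<in> form_graph" for i
    unfolding s_def
    by (rule form_graph_I[OF uL u'L _ sL[unfolded s_def]]) (unfold u_def u'_def, rule has_weak_deriv_hat[OF p])
  have supp: "u i x = 0" "u' i x = 0" "s i x = 0" if "x \<notin> {p i<..<p i + l}" for i x
    using that by (simp_all add: u_def u'_def s_def sqrt_mult_def hat_def hat'_def)
  have orth: "cinner (to_l2 (u i)) (to_l2 (u j)) = 0" "cinner (to_l2 (u' i)) (to_l2 (u' j)) = 0"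
    "cinner (to_l2 (s i)) (to_l2 (s j)) = 0" if "i \<noteq> j" for i j
  proof -
    have "x \<notin> {p i<..<p i + l} \<or> x \<notin> {p j<..<p j + l}" for x using disj[OF that] by blast
    then have "u i x = 0 \<or> u j x = 0" "u' i x = 0 \<or> u' j x = 0" "s i x = 0 \<or> s j x = 0" for x
      using supp by meson+
    then show "cinner (to_l2 (u i)) (to_l2 (u j)) = 0" "cinner (to_l2 (u' i)) (to_l2 (u' j)) = 0"
      "cinner (to_l2 (s i)) (to_l2 (s j)) = 0"
      using uL u'L sL by (simp_all add: cinner_disjoint_support)
  qed
  have nu: "(norm (to_l2 (u i)))\<^sup>2 = l ^ 5 / 30" for i
    using norm_to_l2_real[of "hat (p i) (p i + l)"] uL[of i] integral_hat_square[OF p[of i]] by (simp add: u_def[abs_def])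
  have nu': "(norm (to_l2 (u' i)))\<^sup>2 = l ^ 3 / 3" for i
    using norm_to_l2_real[of "hat' (p i) (p i + l)"] u'L[of i] hat'_square_integral(2)[OF p[of i]] by (simp add: u'_def[abs_def])
  have ns: "(norm (to_l2 (s i)))\<^sup>2 \<le> E * (l ^ 5 / 30)" if "i < k" for i
  proof -
    have "(norm (to_l2 (s i)))\<^sup>2 = (LINT x|lborel. (cmod (s i x))\<^sup>2)" using sL by (simp add: norm_to_l2 L2_norm_square)
    also have "\<dots> \<le> (LINT x|lborel. E * (cmod (u i x))\<^sup>2)"
    proof (rule integral_mono)
      show "integrable lborel (\<lambda>x. (cmod (s i x))\<^sup>2)" by (rule L2_square_integrable[OF sL])
      show "integrable lborel (\<lambda>x. E * (cmod (u i x))\<^sup>2)" using L2_square_integrable[OF uL] by simp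
      show "(cmod (s i x))\<^sup>2 \<le> E * (cmod (u i x))\<^sup>2" for x
      proof (cases "x \<in> {p i<..<p i + l}")
        case True
        then have "V x \<le> E" using sub[OF that] inside unfolding E_def by blast
        then show ?thesis using V_nonneg[of x]
          by (simp add: s_def sqrt_mult_def norm_mult power_mult_distrib mult_right_mono)
      qed (simp add: supp)
    qed
    also have "\<dots> = E * (norm (to_l2 (u i)))\<^sup>2" using uL by (simp add: norm_to_l2 L2_norm_square)
    finally show ?thesis by (simp only: nu)
  qed
  define \<Lambda> where "\<Lambda> = (10 * (real k)\<^sup>2 + 1) * E"
  have hl: "h\<^sup>2 * (l ^ 3 / 3) = 10 * (real k)\<^sup>2 * E * (l ^ 5 / 30)"
  proof -
    have "(real k)\<^sup>2 * E * l\<^sup>2 = h\<^sup>2"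
      using k \<delta> by (simp add: E_def l_def field_simps)
    then have "10 * (real k)\<^sup>2 * E * (l ^ 5 / 30) = h\<^sup>2 * (l ^ 3 / 3)"
      by (simp add: eval_nat_numeral field_simps)
    then show ?thesis by simp
  qed
  have "lambda k (schroedinger h V) \<le> ereal \<Lambda>"
  proof (rule lambda_le_of_trial_space[OF k, where w = "\<lambda>i. to_l2 (u i)"])
    show "0 \<le> \<Lambda>" using E by (simp add: \<Lambda>_def)
  next
    fix c :: "nat \<Rightarrow> complex"
    have n: "(norm (\<Sum>i<k. cscale (c i) (to_l2 (u i))))\<^sup>2 = (\<Sum>i<k. (cmod (c i))\<^sup>2 * (l ^ 5 / 30))"
      by (subst norm_sum_orthogonal) (simp_all add: orth nu)
    {
      assume "(\<Sum>i<k. cscale (c i) (to_l2 (u i))) = 0"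
      then have "(\<Sum>i<k. (cmod (c i))\<^sup>2 * (l ^ 5 / 30)) = 0" using n by simp
      then have "\<forall>i\<in>{..<k}. (cmod (c i))\<^sup>2 * (l ^ 5 / 30) = 0"
        using l by (subst (asm) sum_nonneg_eq_0_iff) auto
      then show "\<forall>i<k. c i = 0" using l by auto
    }
    define b where "b = (\<Sum>i<k. cscale (c i) (to_l2 (u' i)))"
    define t where "t = (\<Sum>i<k. cscale (c i) (to_l2 (s i)))"
    have g: "((\<Sum>i<k. cscale (c i) (to_l2 (u i))), b, t) \<in> form_graph"
      unfolding b_def t_def by (rule form_graph_sum) (rule graph)
    have nb: "(norm b)\<^sup>2 = (\<Sum>i<k. (cmod (c i))\<^sup>2 * (l ^ 3 / 3))"
      unfolding b_def by (subst norm_sum_orthogonal) (simp_all add: orth nu')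
    have nt: "(norm t)\<^sup>2 = (\<Sum>i<k. (cmod (c i))\<^sup>2 * (norm (to_l2 (s i)))\<^sup>2)"
      unfolding t_def by (rule norm_sum_orthogonal) (simp add: orth)
    have "h\<^sup>2 * (norm b)\<^sup>2 + (norm t)\<^sup>2
        = (\<Sum>i<k. (cmod (c i))\<^sup>2 * (h\<^sup>2 * (l ^ 3 / 3) + (norm (to_l2 (s i)))\<^sup>2))"
      by (simp only: nb nt sum_distrib_left distrib_left sum.distrib mult.left_commute)
    also have "\<dots> \<le> (\<Sum>i<k. (cmod (c i))\<^sup>2 * (\<Lambda> * (l ^ 5 / 30)))"
    proof (intro sum_mono mult_left_mono)
      fix i assume "i \<in> {..<k}"
      then show "h\<^sup>2 * (l ^ 3 / 3) + (norm (to_l2 (s i)))\<^sup>2 \<le> \<Lambda> * (l ^ 5 / 30)"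
        using ns[of i] unfolding hl \<Lambda>_def distrib_right by simp
    qed simp
    also have "\<dots> = \<Lambda> * (norm (\<Sum>i<k. cscale (c i) (to_l2 (u i))))\<^sup>2"
      unfolding n sum_distrib_left by (rule sum.cong) auto
    finally show "\<exists>b s. ((\<Sum>i<k. cscale (c i) (to_l2 (u i))), b, s) \<in> form_graph \<and>
      h\<^sup>2 * (norm b)\<^sup>2 + (norm s)\<^sup>2 \<le> \<Lambda> * (norm (\<Sum>i<k. cscale (c i) (to_l2 (u i))))\<^sup>2"
      using g by blast
  qed
  then show ?thesis by (simp add: \<Lambda>_def E_def)
qed

text \<open>
  The constant \<open>1 / 3\<close> does not depend on \<open>k\<close>: the form bound excludes all spectrum below \<open>E / 3\<close>.
\<close>
lemma lambda_ge_window: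
  assumes k: "k \<ge> 1" and \<delta>: "0 < \<delta>"
    and outside: "\<And>x. x \<notin> {a<..<a + \<delta>} \<Longrightarrow> h\<^sup>2 / \<delta>\<^sup>2 \<le> V x"
  shows "ereal (1 / 3 * (h\<^sup>2 / \<delta>\<^sup>2)) \<le> lambda k (schroedinger h V)"
proof -
  interpret B: bounded_below_form V h "h\<^sup>2 / \<delta>\<^sup>2 / 3"
    by unfold_locales (use h_nonzero form_lower_bound[OF _ \<delta> outside] in auto)
  show ?thesis
    using lambda_lower_bound[OF _ k B.below_in_resolvent_set] schroedinger_L2 by simp
qed

end

section \<open>The well at small values of the semiclassical parameter\<close>

text \<open>
  Quantities that make ``\<open>h\<close> small'' explicit. The condition \<open>h\<^sup>2 < \<epsilon> \<eta>\<^sup>2\<close> forces the level of a delta pair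
  below \<open>\<epsilon>\<close>: a level of at least \<open>\<epsilon>\<close> is attained only outside \<open>(- \<eta>, \<eta>)\<close>, the width is then at least \<open>\<eta>\<close>,
  and the level at most \<open>h\<^sup>2 / \<eta>\<^sup>2\<close>. A level below \<open>\<epsilon>\<close> in turn is attained only in \<open>(- \<rho>, \<rho>)\<close>, where
  \<open>V\<close> is monotone on either side of \<open>0\<close>.
\<close>
locale single_well = schroedinger_potential +
  fixes \<rho> \<epsilon> \<eta> :: real
  assumes \<rho>: "0 < \<rho>" and \<epsilon>: "0 < \<epsilon>" and \<eta>: "0 < \<eta>" and V_0: "V 0 = 0"
    and increasing: "0 \<le> x \<Longrightarrow> x < y \<Longrightarrow> y \<le> \<rho> \<Longrightarrow> V x < V y"
    and decreasing: "- \<rho> \<le> x \<Longrightarrow> x < y \<Longrightarrow> y \<le> 0 \<Longrightarrow> V y < V x"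
    and far: "\<rho> \<le> \<bar>x\<bar> \<Longrightarrow> \<epsilon> \<le> V x"
    and near: "\<bar>x\<bar> < \<eta> \<Longrightarrow> V x < \<epsilon>"
begin

lemma increasing_le: "0 \<le> x \<Longrightarrow> x \<le> y \<Longrightarrow> y \<le> \<rho> \<Longrightarrow> V x \<le> V y"
  using increasing[of x y] by (cases "x = y") auto

lemma decreasing_le: "- \<rho> \<le> x \<Longrightarrow> x \<le> y \<Longrightarrow> y \<le> 0 \<Longrightarrow> V y \<le> V x"
  using decreasing[of x y] by (cases "x = y") auto

lemma level_small:
  assumes d: "delta_pair V h dm dp" and h: "h\<^sup>2 < \<epsilon> * \<eta>\<^sup>2"
  shows "h\<^sup>2 / (dp - dm)\<^sup>2 < \<epsilon>"
proof (rule ccontr)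
  assume "\<not> ?thesis"
  then have "\<epsilon> \<le> V dp" "\<epsilon> \<le> h\<^sup>2 / (dp - dm)\<^sup>2" using d by (auto simp: delta_pair_def)
  have pm: "dm < 0" "0 < dp" using d by (auto simp: delta_pair_def)
  then have "\<eta> \<le> dp" using near[of dp] \<open>\<epsilon> \<le> V dp\<close> by (cases "dp < \<eta>") auto
  then have "\<eta>\<^sup>2 \<le> (dp - dm)\<^sup>2" using pm \<eta> by (intro power_mono) auto
  then have "\<epsilon> * \<eta>\<^sup>2 \<le> \<epsilon> * (dp - dm)\<^sup>2" using \<epsilon> by simp
  moreover have "\<epsilon> * (dp - dm)\<^sup>2 \<le> h\<^sup>2"
    using \<open>\<epsilon> \<le> h\<^sup>2 / (dp - dm)\<^sup>2\<close> pm by (simp add: le_divide_eq)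
  ultimately show False using h by simp
qed

lemma delta_pair_in_well:
  assumes d: "delta_pair V h dm dp" and h: "h\<^sup>2 < \<epsilon> * \<eta>\<^sup>2"
  shows "- \<rho> < dm" "dp < \<rho>"
proof -
  have e: "dm < 0" "0 < dp" "V dp < \<epsilon>" "V dm < \<epsilon>" using level_small[OF d h] d by (auto simp: delta_pair_def)
  show "- \<rho> < dm" using far[of dm] e by (cases "- \<rho> < dm") auto
  show "dp < \<rho>" using far[of dp] e by (cases "dp < \<rho>") auto
qed

lemma V_le_inside:
  assumes d: "delta_pair V h dm dp" and h: "h\<^sup>2 < \<epsilon> * \<eta>\<^sup>2" and x: "dm < x" "x < dp"
  shows "V x \<le> h\<^sup>2 / (dp - dm)\<^sup>2"
proof (cases "0 \<le> x")
  case True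
  then show ?thesis using increasing_le[of x dp] delta_pair_in_well[OF d h] x d by (auto simp: delta_pair_def)
next
  case False
  then show ?thesis using decreasing_le[of dm x] delta_pair_in_well[OF d h] x d by (auto simp: delta_pair_def)
qed

lemma V_ge_outside:
  assumes d: "delta_pair V h dm dp" and h: "h\<^sup>2 < \<epsilon> * \<eta>\<^sup>2" and x: "x \<le> dm \<or> dp \<le> x"
  shows "h\<^sup>2 / (dp - dm)\<^sup>2 \<le> V x"
proof (cases "\<rho> \<le> \<bar>x\<bar>")
  case True
  then show ?thesis using far[of x] level_small[OF d h] by simp
next
  case False
  have "0 < dp" "dm < 0" "V dp = h\<^sup>2 / (dp - dm)\<^sup>2" "V dm = h\<^sup>2 / (dp - dm)\<^sup>2"
    using d by (auto simp: delta_pair_def)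
  then show ?thesis using False x increasing_le[of dp x] decreasing_le[of x dm] by auto
qed

text \<open>
  A higher level of \<open>V\<close> has a wider window, whereas \<open>h\<^sup>2\<close> divided by the square of the width decreases.
\<close>
lemma delta_pair_mono:
  assumes d: "delta_pair V h dm dp" and d': "delta_pair V h dm' dp'"
    and h: "h\<^sup>2 < \<epsilon> * \<eta>\<^sup>2" "h \<noteq> 0"
  shows "dp \<le> dp'"
proof (rule ccontr)
  assume "\<not> dp \<le> dp'"
  then have p: "dp' < dp" by simp
  have e: "dm < 0" "0 < dp" "V dp = h\<^sup>2 / (dp - dm)\<^sup>2" "V dm = V dp"
    "dm' < 0" "0 < dp'" "V dp' = h\<^sup>2 / (dp' - dm')\<^sup>2" "V dm' = V dp'"
    using d d' by (auto simp: delta_pair_def)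
  note w = delta_pair_in_well[OF d h(1)] delta_pair_in_well[OF d' h(1)]
  have lt: "V dp' < V dp" using increasing[of dp' dp] p e w by auto
  have "dm < dm'" using decreasing_le[of dm' dm] e w lt by (cases "dm' \<le> dm") auto
  then have "(dp' - dm')\<^sup>2 < (dp - dm)\<^sup>2" using p e by (intro power_strict_mono) auto
  moreover have "0 < (dp' - dm')\<^sup>2" "0 < (dp - dm)\<^sup>2" using e by auto
  ultimately have "h\<^sup>2 / (dp - dm)\<^sup>2 < h\<^sup>2 / (dp' - dm')\<^sup>2"
    using h(2) by (intro divide_strict_left_mono mult_pos_pos) auto
  then show False using lt e by simp
qed

lemma delta_pair_unique:
  assumes d: "delta_pair V h dm dp" and d': "delta_pair V h dm' dp'"
    and h: "h\<^sup>2 < \<epsilon> * \<eta>\<^sup>2" "h \<noteq> 0"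
  shows "dm = dm' \<and> dp = dp'"
proof -
  have p: "dp = dp'" using delta_pair_mono[OF d d' h] delta_pair_mono[OF d' d h] by simp
  then have "V dm = V dm'" "dm < 0" "dm' < 0" using d d' by (auto simp: delta_pair_def)
  moreover note delta_pair_in_well(1)[OF d h(1)] delta_pair_in_well(1)[OF d' h(1)]
  ultimately have "dm = dm'" using decreasing[of dm dm'] decreasing[of dm' dm] by (cases dm dm' rule: linorder_cases) auto
  with p show ?thesis by simp
qed

text \<open>
  Let \<open>P t\<close> and \<open>N t\<close> be the points to the right and to the left of \<open>0\<close> at which \<open>V\<close> has the value \<open>t\<close>. The equation
  for the level becomes \<open>t (P t - N t)\<^sup>2 = h\<^sup>2\<close>, which has a solution by the intermediate value theorem.
\<close>
lemma delta_pair_exists: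
  obtains h0 where "0 < h0" "\<And>h. 0 < h \<Longrightarrow> h < h0 \<Longrightarrow> \<exists>dm dp. delta_pair V h dm dp"
proof -
  define \<theta> where "\<theta> = min (V \<rho>) (V (- \<rho>))"
  have \<theta>: "0 < \<theta>" using increasing[of 0 \<rho>] decreasing[of "- \<rho>" 0] \<rho> V_0 by (simp add: \<theta>_def)
  define P where "P = inv_into {0..\<rho>} V"
  define N where "N = inv_into {- \<rho>..0} V"
  have injP: "inj_on V {0..\<rho>}"
  proof (rule linorder_inj_onI)
    show "V x \<noteq> V y" if "x < y" "x \<in> {0..\<rho>}" "y \<in> {0..\<rho>}" for x y using increasing[of x y] that by auto
  qed auto
  have injN: "inj_on V {- \<rho>..0}"
  proof (rule linorder_inj_onI)
    show "V x \<noteq> V y" if "x < y" "x \<in> {- \<rho>..0}" "y \<in> {- \<rho>..0}" for x y using decreasing[of x y] that by auto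
  qed auto
  have cont: "continuous_on A V" for A using V_cont by (rule continuous_on_subset) simp
  have subP: "{0..\<theta>} \<subseteq> V ` {0..\<rho>}"
  proof
    fix t assume "t \<in> {0..\<theta>}"
    then show "t \<in> V ` {0..\<rho>}" using IVT'[of V 0 t \<rho>] V_0 \<rho> cont by (auto simp: \<theta>_def)
  qed
  have subN: "{0..\<theta>} \<subseteq> V ` {- \<rho>..0}"
  proof
    fix t assume "t \<in> {0..\<theta>}"
    then show "t \<in> V ` {- \<rho>..0}" using IVT2'[of V 0 t "- \<rho>"] V_0 \<rho> cont by (auto simp: \<theta>_def)
  qed
  have "continuous_on (V ` {0..\<rho>}) P"
    unfolding P_def by (rule continuous_on_inv[OF cont]) (auto simp: injP)
  then have cP: "continuous_on {0..\<theta>} P" using subP by (rule continuous_on_subset)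
  have "continuous_on (V ` {- \<rho>..0}) N"
    unfolding N_def by (rule continuous_on_inv[OF cont]) (auto simp: injN)
  then have cN: "continuous_on {0..\<theta>} N" using subN by (rule continuous_on_subset)
  have P: "P t \<in> {0..\<rho>}" "V (P t) = t" and N: "N t \<in> {- \<rho>..0}" "V (N t) = t" if "t \<in> {0..\<theta>}" for t
    using that subP subN by (auto simp: P_def N_def intro!: inv_into_into f_inv_into_f simp del: atLeastAtMost_iff)
  have pos: "0 < P t" "N t < 0" if "0 < t" "t \<le> \<theta>" for t
    using P[of t] N[of t] that V_0 by (auto simp: le_less)
  define g where "g t = t * (P t - N t)\<^sup>2" for t
  have g: "continuous_on {0..\<theta>} g" unfolding g_def by (intro continuous_intros cP cN)
  have "0 < P \<theta> - N \<theta>" using pos[of \<theta>] \<theta> by simp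
  then have g\<theta>: "0 < g \<theta>" using \<theta> by (simp add: g_def)
  show ?thesis
  proof
    show "0 < sqrt (g \<theta>)" using g\<theta> by simp
    fix h assume h: "0 < h" "h < sqrt (g \<theta>)"
    have "h\<^sup>2 < g \<theta>" using power_strict_mono[OF h(2), of 2] h g\<theta> by simp
    then obtain t where t: "0 \<le> t" "t \<le> \<theta>" "g t = h\<^sup>2"
      using IVT'[of g 0 "h\<^sup>2" \<theta>] g \<theta> by (auto simp: g_def)
    then have t0: "0 < t" using h by (auto simp: g_def le_less)
    have d: "0 < P t - N t" using pos[OF t0 t(2)] by simp
    have "t = h\<^sup>2 / (P t - N t)\<^sup>2" using t(3) d by (simp add: g_def field_simps)
    then have "delta_pair V h (N t) (P t)"
      using P(2)[of t] N(2)[of t] pos[OF t0 t(2)] t by (simp add: delta_pair_def)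
    then show "\<exists>dm dp. delta_pair V h dm dp" by blast
  qed
qed

definition threshold :: real where "threshold = sqrt (\<epsilon> * \<eta>\<^sup>2)"

lemma threshold: "0 < threshold" "0 < h \<Longrightarrow> h < threshold \<Longrightarrow> h\<^sup>2 < \<epsilon> * \<eta>\<^sup>2"
proof -
  show "0 < threshold" using \<epsilon> \<eta> by (simp add: threshold_def)
  assume "0 < h" "h < threshold"
  then show "h\<^sup>2 < \<epsilon> * \<eta>\<^sup>2" using power_strict_mono[of h threshold 2] \<epsilon> by (simp add: threshold_def)
qed

lemma eventually_unique_delta_pair: "\<forall>\<^sub>F h in at_right 0. \<exists>!(dm, dp). delta_pair V h dm dp"
proof -
  obtain h0 where h0: "0 < h0" "\<And>h. 0 < h \<Longrightarrow> h < h0 \<Longrightarrow> \<exists>dm dp. delta_pair V h dm dp"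
    using delta_pair_exists by blast
  have "\<forall>\<^sub>F h in at_right 0. h \<in> {0<..<min h0 threshold}"
    using h0(1) threshold(1) by (intro eventually_at_right_real) simp
  then show ?thesis
  proof eventually_elim
    fix h assume h: "h \<in> {0<..<min h0 threshold}"
    obtain dm dp where d: "delta_pair V h dm dp" using h0(2)[of h] h by auto
    show "\<exists>!(dm, dp). delta_pair V h dm dp"
    proof (rule ex1I[of _ "(dm, dp)"])
      show "case (dm, dp) of (dm, dp) \<Rightarrow> delta_pair V h dm dp" using d by simp
      fix q assume "case q of (dm, dp) \<Rightarrow> delta_pair V h dm dp"
      then show "q = (dm, dp)" using delta_pair_unique[OF _ d] threshold(2)[of h] h by (cases q) auto
    qed
  qed
qed

lemma lambda_bounds:
  assumes k: "k \<ge> 1" and small: "0 < h" "h < threshold" and d: "delta_pair V h dm dp"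
  shows "ereal (1 / 3 * (h\<^sup>2 / (dp - dm)\<^sup>2)) \<le> lambda k (schroedinger h V)"
    and "lambda k (schroedinger h V) \<le> ereal ((10 * (real k)\<^sup>2 + 1) * (h\<^sup>2 / (dp - dm)\<^sup>2))"
proof -
  interpret schroedinger_operator V h by unfold_locales (use small in simp)
  note h2 = threshold(2)[OF small]
  have \<delta>: "0 < dp - dm" using d by (simp add: delta_pair_def)
  show "ereal (1 / 3 * (h\<^sup>2 / (dp - dm)\<^sup>2)) \<le> lambda k (schroedinger h V)"
    by (rule lambda_ge_window[OF k \<delta>, of dm]) (use V_ge_outside[OF d h2] in force)
  show "lambda k (schroedinger h V) \<le> ereal ((10 * (real k)\<^sup>2 + 1) * (h\<^sup>2 / (dp - dm)\<^sup>2))"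
    by (rule lambda_le_window[OF k \<delta>, of dm]) (use V_le_inside[OF d h2] in force)
qed

end

text \<open>
  The lower bound \<open>\<epsilon>\<close> away from \<open>0\<close> combines the limes inferior at infinity with the minimum of \<open>V\<close> on a
  compact set; \<open>\<rho>\<close> is half the given radius, so that monotonicity extends to closed intervals.
\<close>
lemma single_well_of_potential:
  fixes V :: "real \<Rightarrow> real"
  assumes cont: "continuous_on UNIV V" and nonneg: "\<forall>x. 0 \<le> V x"
    and lim: "0 < Liminf at_infinity (\<lambda>x. ereal (V x))" and zero: "V -` {0} = {0}"
    and mono: "r > 0" "strict_mono_on {0<..<r} V" "strict_antimono_on {-r<..<0} V"
  obtains \<rho> \<epsilon> \<eta> where "single_well V \<rho> \<epsilon> \<eta>"
proof -
  have V0: "V x = 0 \<longleftrightarrow> x = 0" for x using zero by auto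
  then have pos: "0 < V x" if "x \<noteq> 0" for x using nonneg that by (metis less_eq_real_def)
  define \<rho> where "\<rho> = r / 2"
  have \<rho>: "0 < \<rho>" "\<rho> < r" using mono(1) by (auto simp: \<rho>_def)
  obtain l where l: "0 < ereal l" "ereal l < Liminf at_infinity (\<lambda>x. ereal (V x))"
    using ereal_dense2[OF lim] by blast
  have "\<forall>\<^sub>F x in at_infinity. ereal l < ereal (V x)" by (rule less_LiminfD[OF l(2)])
  then obtain R where R: "\<And>x. R \<le> \<bar>x\<bar> \<Longrightarrow> l < V x" by (auto simp: eventually_at_infinity)
  define K where "K = {- max R \<rho>..- \<rho>} \<union> {\<rho>..max R \<rho>}"
  have "compact K" "K \<noteq> {}" by (auto simp: K_def compact_Un)
  then obtain x0 where x0: "x0 \<in> K" "\<And>x. x \<in> K \<Longrightarrow> V x0 \<le> V x"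
    using continuous_attains_inf[of K V] continuous_on_subset[OF cont] by blast
  have "x0 \<noteq> 0" using x0(1) \<rho> by (auto simp: K_def)
  define \<epsilon> where "\<epsilon> = min l (V x0)"
  have \<epsilon>: "0 < \<epsilon>" using l pos[OF \<open>x0 \<noteq> 0\<close>] by (simp add: \<epsilon>_def)
  have "isCont V 0" using cont by (simp add: continuous_on_eq_continuous_at)
  then obtain \<eta> where \<eta>: "0 < \<eta>" "\<And>x. dist x 0 < \<eta> \<Longrightarrow> dist (V x) (V 0) < \<epsilon>"
    using \<epsilon> unfolding continuous_at_eps_delta by blast
  have "single_well V \<rho> \<epsilon> \<eta>"
  proof unfold_locales
    show "continuous_on UNIV V" "0 < \<rho>" "0 < \<epsilon>" "0 < \<eta>" "V 0 = 0"
      using cont \<rho>(1) \<epsilon> \<eta>(1) V0[of 0] by auto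
    show "0 \<le> V x" for x using nonneg by simp
    show "V x < V y" if "0 \<le> x" "x < y" "y \<le> \<rho>" for x y
    proof (cases "x = 0")
      case True
      then show ?thesis using pos[of y] that V0[of 0] by simp
    next
      case False
      then show ?thesis using mono(2) that \<rho> by (auto simp: strict_mono_on_def)
    qed
    show "V y < V x" if "- \<rho> \<le> x" "x < y" "y \<le> 0" for x y
    proof (cases "y = 0")
      case True
      then show ?thesis using pos[of x] that V0[of 0] by simp
    next
      case False
      then show ?thesis using monotone_onD[OF mono(3), of x y] that \<rho> by auto
    qed
    show "\<epsilon> \<le> V x" if "\<rho> \<le> \<bar>x\<bar>" for x
    proof (cases "R \<le> \<bar>x\<bar>")
      case True
      then show ?thesis using R[of x] by (simp add: \<epsilon>_def)
    next
      case False
      then have "x \<in> K" using that by (auto simp: K_def)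
      then show ?thesis using x0(2)[of x] by (simp add: \<epsilon>_def)
    qed
    show "V x < \<epsilon>" if "\<bar>x\<bar> < \<eta>" for x using \<eta>(2)[of x] that V0[of 0] nonneg by (simp add: dist_real_def)
  qed
  then show ?thesis by (rule that)
qed

theorem theorem3p1:
  shows "\<exists>C c :: nat \<Rightarrow> real.
    (\<forall>k\<ge>1. 0 < C k \<and> 0 < c k) \<and>
    (\<forall>V :: real \<Rightarrow> real.
       continuous_on UNIV V \<and> (\<forall>x. 0 \<le> V x) \<and>
       0 < Liminf at_infinity (\<lambda>x. ereal (V x)) \<and>
       V -` {0} = {0} \<and>
       (\<exists>r>0. strict_mono_on {0<..<r} V \<and> strict_antimono_on {-r<..<0} V) \<longrightarrow>
       (\<forall>\<^sub>F h in at_right 0. \<exists>!(dm, dp). delta_pair V h dm dp) \<and>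
       (\<forall>k\<ge>1. \<forall>\<^sub>F h in at_right 0. \<forall>dm dp. delta_pair V h dm dp \<longrightarrow>
          ereal (c k * h\<^sup>2 / (dp - dm)\<^sup>2) \<le> lambda k (schroedinger h V) \<and>
          lambda k (schroedinger h V) \<le> ereal (C k * h\<^sup>2 / (dp - dm)\<^sup>2)))"
proof (rule exI[of _ "\<lambda>k. 10 * (real k)\<^sup>2 + 1"], rule exI[of _ "\<lambda>k. 1 / 3"],
    intro conjI allI impI; (elim conjE exE)?)
  fix k :: nat
  show "0 < 10 * (real k)\<^sup>2 + 1" by (simp add: add_nonneg_pos)
  show "0 < (1 / 3 :: real)" by simp
next
  fix V :: "real \<Rightarrow> real" and r
  assume "continuous_on UNIV V" "\<forall>x. 0 \<le> V x" "0 < Liminf at_infinity (\<lambda>x. ereal (V x))" "V -` {0} = {0}"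
    "0 < r" "strict_mono_on {0<..<r} V" "strict_antimono_on {-r<..<0} V"
  then obtain \<rho> \<epsilon> \<eta> where "single_well V \<rho> \<epsilon> \<eta>" by (rule single_well_of_potential)
  then interpret single_well V \<rho> \<epsilon> \<eta> .
  show "\<forall>\<^sub>F h in at_right 0. \<exists>!(dm, dp). delta_pair V h dm dp" by (rule eventually_unique_delta_pair)
  fix k :: nat assume k: "1 \<le> k"
  have "\<forall>\<^sub>F h in at_right 0. h \<in> {0<..<threshold}" using threshold(1) by (rule eventually_at_right_real)
  then show "\<forall>\<^sub>F h in at_right 0. \<forall>dm dp. delta_pair V h dm dp \<longrightarrow>
      ereal (1 / 3 * h\<^sup>2 / (dp - dm)\<^sup>2) \<le> lambda k (schroedinger h V) \<and>
      lambda k (schroedinger h V) \<le> ereal ((10 * (real k)\<^sup>2 + 1) * h\<^sup>2 / (dp - dm)\<^sup>2)"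
  proof eventually_elim
    fix h assume "h \<in> {0<..<threshold}"
    then have "0 < h" "h < threshold" by auto
    from lambda_bounds[OF k this] show "\<forall>dm dp. delta_pair V h dm dp \<longrightarrow>
      ereal (1 / 3 * h\<^sup>2 / (dp - dm)\<^sup>2) \<le> lambda k (schroedinger h V) \<and>
      lambda k (schroedinger h V) \<le> ereal ((10 * (real k)\<^sup>2 + 1) * h\<^sup>2 / (dp - dm)\<^sup>2)"
      by (simp only: times_divide_eq_right) blast
  qed
qed

end
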